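(* Let $P$ be a smooth Gorenstein polytope of dimension $d$ and index $r$. Then $r > \frac{d+3}{3}$ if and only if one of the following holds: (1) $P \cong S_d$ (here, $r=d+1$); (2) $P \cong 2S_d$ with $d\ge5$ odd (here, $r=\frac{d+1}{2}$); (3) $P \cong S_{d/2}\times S_{d/2}$ with $d\ge 4$ even (here, $r=\frac{d+2}{2}$); (4) $P \cong (a_1+1)S_{d+1-r} * \cdots * (a_t+1)S_{d+1-r} * S_{d+1-r} * \cdots * S_{d+1-r}$, where there are $r$ Cayley factors in total, $\frac{d+3}{3} < r \le \frac{d+1}{2}$, and $a_1,\ldots,a_t$ is an integer partition of $d+2-2r$. Different integer partitions in (4) yield non-isomorphic Gorenstein polytopes.
   Context: Let $M\cong\mathbb{Z}^d$ be a lattice, $N$ its dual lattice, $M_{\mathbb R}=M\otimes\mathbb{R}$, $N_{\mathbb R}=N\otimes\mathbb{R}$. A lattice polytope is the convex hull of finitely many points of $M$; it is regarded as full-dimensional (otherwise replace $M$ by the affine lattice $\mathrm{aff}(P)\cap M$). Two lattice polytopes are isomorphic ($\cong$) if an affine isomorphism of the ambient lattices maps one onto the other. A lattice polytope $Q\subset M_{\mathbb R}$ with the origin in its interior is reflexive if $Q^*=\{y\in N_{\mathbb R}:\langle y,x\rangle\ge-1\ \forall x\in Q\}$ is a lattice polytope. $P$ is Gorenstein of index $r\in\mathbb{Z}_{>0}$ if $rP$ is a reflexive polytope up to translation by a lattice point ($r$ is unique). A $d$-dimensional lattice polytope is smooth if every vertex lies on exactly $d$ edges and the primitive lattice vectors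 along these edges starting at that vertex form a lattice basis. $S_d=\mathrm{conv}(0,e_1,\ldots,e_d)$ is the unimodular $d$-simplex, where $e_1,\ldots,e_d$ is a lattice basis. For lattice polytopes $P_0,\ldots,P_k\subset\mathbb{R}^s$, the Cayley polytope is $P_0*\cdots*P_k=\mathrm{conv}(P_0\times e_0,\ldots,P_k\times e_k)\subset\mathbb{R}^s\oplus\mathbb{R}^{k+1}$, where $e_0,\ldots,e_k$ is a lattice basis of $\mathbb{R}^{k+1}$; the $P_i$ are called Cayley factors. An integer partition of $N$ is a multiset of nonnegative integers summing up to $N$; in the last sentence of the claim, partitions differing only in the number of parts equal to $0$ are not regarded as different.
   Formalization: As printed the claim fails for d=2: the unit square S_1×S_1 is smooth Gorenstein of index 2 > 5/3 but none of (1)–(4) holds. The formal equivalence adds the case d=2, P ≅ S_1×S_1, and takes d ≥ 1 (for d=0 the index is not unique and r=1 with P=S_0 violates it). *)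

theory Defs
  imports "HOL-Analysis.Analysis" "HOL-Analysis.Finite_Function_Topology"
begin

(* A real vector space M_R together with a lattice M.  A polytope of dimension d is
   studied in "real ^ 'n" with CARD('n) = d and M = Z^d.  The polytopes of a classification list
   have varying dimensions; they live in the space "nat \<Rightarrow>\<^sub>0 real" of finitely supported sequences,
   which contains every R^s and Z^s, and in products of this space. *)
class lattice_space = real_vector +
  fixes lattice_points :: "'a set"

instantiation vec :: ("{lattice_space}", finite) lattice_space
begin
definition lattice_points_vec :: "('a ^ 'b) set" where
  "lattice_points_vec = {x. \<forall>i. x $ i \<in> lattice_points}"
instance ..
end

instantiation poly_mapping :: (type, lattice_space) lattice_space
begin
definition lattice_points_poly_mapping :: "('a \<Rightarrow>\<^sub>0 'b) set" where
  "lattice_points_poly_mapping = {x. \<forall>i. Poly_Mapping.lookup x i \<in> lattice_points}"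
instance ..
end

instantiation prod :: (lattice_space, lattice_space) lattice_space
begin
definition lattice_points_prod :: "('a \<times> 'b) set" where
  "lattice_points_prod = lattice_points \<times> lattice_points"
instance ..
end

instantiation real :: lattice_space
begin
definition lattice_points_real :: "real set" where
  "lattice_points_real = \<int>"
instance ..
end

definition lattice_polytope :: "'a::lattice_space set \<Rightarrow> bool" where
  "lattice_polytope P \<longleftrightarrow>
     (\<exists>V. finite V \<and> V \<noteq> {} \<and> V \<subseteq> lattice_points \<and> P = convex hull V)"

(* The ambient lattice of P is the affine lattice aff(P) \<inter> M.  Every affine map aff(P) \<rightarrow> aff(Q)
   is the restriction of some x \<mapsto> f x + c with f linear on the whole space. *)
definition lattice_isomorphic ::
    "'a::lattice_space set \<Rightarrow> 'b::lattice_space set \<Rightarrow> bool"  (infix \<open>\<cong>\<^sub>L\<close> 50) where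
  "P \<cong>\<^sub>L Q \<longleftrightarrow>
     (\<exists>f c. linear f \<and>
        bij_betw (\<lambda>x. f x + c) (affine hull P \<inter> lattice_points) (affine hull Q \<inter> lattice_points) \<and>
        (\<lambda>x. f x + c) ` P = Q)"

(* The dual space of R^d is identified with R^d by the standard inner product; this identifies
   the dual lattice of Z^d with Z^d. *)
definition dual_polytope :: "(real ^ 'n) set \<Rightarrow> (real ^ 'n) set" where
  "dual_polytope Q = {y. \<forall>x\<in>Q. y \<bullet> x \<ge> -1}"

definition reflexive :: "(real ^ 'n) set \<Rightarrow> bool" where
  "reflexive Q \<longleftrightarrow> lattice_polytope Q \<and> 0 \<in> interior Q \<and> lattice_polytope (dual_polytope Q)"

definition dilate :: "nat \<Rightarrow> 'a::real_vector set \<Rightarrow> 'a set" where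
  "dilate k P = (\<lambda>x. real k *\<^sub>R x) ` P"

definition gorenstein :: "nat \<Rightarrow> (real ^ 'n) set \<Rightarrow> bool" where
  "gorenstein r P \<longleftrightarrow> r > 0 \<and> lattice_polytope P \<and>
     (\<exists>m\<in>lattice_points. reflexive ((\<lambda>x. x + m) ` dilate r P))"

definition primitive :: "'a::lattice_space \<Rightarrow> bool" where
  "primitive u \<longleftrightarrow> u \<in> lattice_points \<and> u \<noteq> 0 \<and>
     (\<forall>w\<in>lattice_points. \<forall>k::nat. u = real k *\<^sub>R w \<longrightarrow> k = 1)"

definition lattice_basis :: "'a::lattice_space set \<Rightarrow> bool" where
  "lattice_basis B \<longleftrightarrow> finite B \<and> independent B \<and>
     lattice_points = range (\<lambda>c :: 'a \<Rightarrow> int. \<Sum>b\<in>B. of_int (c b) *\<^sub>R b)"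

definition primitive_edge_vectors :: "(real ^ 'n) set \<Rightarrow> real ^ 'n \<Rightarrow> (real ^ 'n) set" where
  "primitive_edge_vectors P v =
     {u. primitive u \<and> (\<exists>E. E edge_of P \<and> v \<in> E \<and> (\<exists>t>0. v + t *\<^sub>R u \<in> E))}"

definition smooth_polytope :: "(real ^ 'n) set \<Rightarrow> bool" where
  "smooth_polytope P \<longleftrightarrow> lattice_polytope P \<and> aff_dim P = int CARD('n) \<and>
     (\<forall>v. v extreme_point_of P \<longrightarrow>
        card {E. E edge_of P \<and> v \<in> E} = CARD('n) \<and>
        lattice_basis (primitive_edge_vectors P v))"

definition unit_seq :: "nat \<Rightarrow> (nat \<Rightarrow>\<^sub>0 real)" where
  "unit_seq i = Poly_Mapping.single i 1"

definition unimodular_simplex :: "nat \<Rightarrow> (nat \<Rightarrow>\<^sub>0 real) set" where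
  "unimodular_simplex s = convex hull (insert 0 (unit_seq ` {..<s}))"

definition cayley :: "'a::real_vector set list \<Rightarrow> ('a \<times> (nat \<Rightarrow>\<^sub>0 real)) set" where
  "cayley Ps = convex hull (\<Union>i<length Ps. (Ps ! i) \<times> {unit_seq i})"

(* A multiset of nonnegative integers is given by the list of its elements in any order. *)
definition integer_partition :: "nat list \<Rightarrow> nat \<Rightarrow> bool" where
  "integer_partition as N \<longleftrightarrow> sum_list as = N"

definition same_partition :: "nat list \<Rightarrow> nat list \<Rightarrow> bool" where
  "same_partition as bs \<longleftrightarrow> filter_mset (\<lambda>a. a \<noteq> 0) (mset as) = filter_mset (\<lambda>b. b \<noteq> 0) (mset bs)"

(* (a_1 + 1) S_s * ... * (a_t + 1) S_s * S_s * ... * S_s with r Cayley factors in total;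
   meant for t \<le> r only. *)
definition cayley_simplices ::
    "nat \<Rightarrow> nat \<Rightarrow> nat list \<Rightarrow> ((nat \<Rightarrow>\<^sub>0 real) \<times> (nat \<Rightarrow>\<^sub>0 real)) set" where
  "cayley_simplices s r as =
     cayley (map (\<lambda>a. dilate (a + 1) (unimodular_simplex s)) as
             @ replicate (r - length as) (unimodular_simplex s))"

(* The range of r in the Cayley family.  It guarantees r \<le> d + 1 and 2 * r \<le> d + 2, so that
   the natural number differences d + 1 - r and d + 2 - 2 * r are not truncated. *)
definition cayley_range :: "nat \<Rightarrow> nat \<Rightarrow> bool" where
  "cayley_range d r \<longleftrightarrow> (real d + 3) / 3 < real r \<and> real r \<le> (real d + 1) / 2"

end

theory Submission imports Defs
begin

text \<open>Throughout, \<open>d\<close> is the dimension of the smooth polytope \<open>P\<close> and each facet of \<open>P\<close> is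
measured by its lattice distance: the integral affine form \<open>h\<close> with primitive linear part that is
nonnegative on \<open>P\<close> and vanishes on the facet (\<open>facet_forms\<close>). If \<open>P\<close> is Gorenstein of index \<open>r\<close>,
then some point of \<open>P\<close> has distance exactly \<open>1/r\<close> from every facet, because the vertices of the
dual of a reflexive polytope are lattice points (\<open>gorenstein_facet_distance\<close>).

Why few facets suffice: with \<open>N\<close> facets, the sum of all the distances is an affine function with
value \<open>N/r\<close> at that point, so at some vertex \<open>u\<close> it is at most \<open>N/r\<close>. Smoothness makes \<open>P\<close> simple,
so exactly \<open>d\<close> of the distances vanish at \<open>u\<close>, while the others are integers and at least \<open>1\<close>.
Hence \<open>N - d \<le> N/r\<close>, and \<open>r > (d+3)/3\<close> leaves only \<open>N = d + 1\<close> and \<open>N = d + 2\<close>. This is the bound on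
the Picard number of toric Fano manifolds of large index, in an elementary form.

The edges at \<open>u\<close> are a lattice basis, so that in suitable coordinates \<open>u = 0\<close> and \<open>P\<close> is the
nonnegative orthant cut by one or two further inequalities \<open>a \<bullet> x \<le> C\<close>
(\<open>smooth_gorenstein_normal_form\<close>). One inequality: smoothness at the ends of the coordinate edges
forces \<open>a = (1,...,1)\<close>, a dilated unimodular simplex with \<open>r C = d + 1\<close>. Two inequalities: the same
averaging makes both constants \<open>1\<close>, so the coordinate edges end at the unit vectors, each on exactly
one of the two new facets. This splits the coordinates into two blocks, on which the forms \<open>a\<close> and
\<open>b\<close> have coefficient \<open>1\<close>. Of their remaining coefficients, which are at most \<open>0\<close>, boundedness
lets only one of the two forms have nonzero ones. What is left is a Cayley
polytope of dilated simplices, where the negated remaining coefficients are the partition; it is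
a product of simplices if they all vanish (\<open>large_index_imp_list\<close>).

Conversely, the index of each listed polytope can be computed from the facet distances of an
explicit model in \<open>real^'n\<close>. The Cayley polytopes are Gorenstein since the dual of the translated
dilate is the convex hull of the facet normals. They are distinguished by the lattice lengths of
the segments between their vertices: within a factor the length is the dilation factor, between
different factors it is one (\<open>cayley_simplices_isomorphic_imp_counts\<close>).\<close>


section \<open>Lattices and lattice isomorphisms\<close>

lemma lattice_points_vec_iff: "(x :: real^'n) \<in> lattice_points \<longleftrightarrow> (\<forall>i. x $ i \<in> \<int>)"
  by (simp add: lattice_points_vec_def lattice_points_real_def)

lemma lattice_points_seq_iff: "(p :: 'a \<Rightarrow>\<^sub>0 real) \<in> lattice_points \<longleftrightarrow> (\<forall>i. Poly_Mapping.lookup p i \<in> \<int>)"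
  by (simp add: lattice_points_poly_mapping_def lattice_points_real_def)

lemma lattice_points_pair_iff: "(p, q) \<in> lattice_points \<longleftrightarrow> p \<in> lattice_points \<and> q \<in> lattice_points"
  by (simp add: lattice_points_prod_def)

lemma lattice_points_add: "x \<in> lattice_points \<Longrightarrow> y \<in> lattice_points \<Longrightarrow> x + y \<in> (lattice_points :: (real^'n) set)"
  by (simp add: lattice_points_vec_iff)

lemma lattice_points_diff: "x \<in> lattice_points \<Longrightarrow> y \<in> lattice_points \<Longrightarrow> x - y \<in> (lattice_points :: (real^'n) set)"
  by (simp add: lattice_points_vec_iff)

lemma lattice_points_scaleR: "a \<in> \<int> \<Longrightarrow> y \<in> lattice_points \<Longrightarrow> a *\<^sub>R y \<in> (lattice_points :: (real^'n) set)"
  by (simp add: lattice_points_vec_iff)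

lemma axis_in_lattice_points: "axis i 1 \<in> (lattice_points :: (real^'n) set)"
  by (simp add: lattice_points_vec_iff axis_def)

lemma zero_in_lattice_points: "0 \<in> (lattice_points :: (real^'n) set)"
  by (simp add: lattice_points_vec_iff)

lemma inner_lattice_points: "x \<in> lattice_points \<Longrightarrow> y \<in> lattice_points \<Longrightarrow> (x :: real^'n) \<bullet> y \<in> \<int>"
  by (auto simp: inner_vec_def lattice_points_vec_iff intro!: Ints_sum Ints_mult)

lemma lattice_isomorphic_trans:
  assumes "P \<cong>\<^sub>L Q" "Q \<cong>\<^sub>L R"
  shows "P \<cong>\<^sub>L R"
proof -
  obtain f c where f: "linear f"
    "bij_betw (\<lambda>x. f x + c) (affine hull P \<inter> lattice_points) (affine hull Q \<inter> lattice_points)"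
    "(\<lambda>x. f x + c) ` P = Q" using assms(1) unfolding lattice_isomorphic_def by auto
  obtain g e where g: "linear g"
    "bij_betw (\<lambda>x. g x + e) (affine hull Q \<inter> lattice_points) (affine hull R \<inter> lattice_points)"
    "(\<lambda>x. g x + e) ` Q = R" using assms(2) unfolding lattice_isomorphic_def by auto
  have eq: "(\<lambda>x. (g \<circ> f) x + (g c + e)) = (\<lambda>x. g x + e) \<circ> (\<lambda>x. f x + c)"
    using g(1) by (auto simp: linear_add)
  have "bij_betw (\<lambda>x. (g \<circ> f) x + (g c + e)) (affine hull P \<inter> lattice_points) (affine hull R \<inter> lattice_points)"
    unfolding eq using bij_betw_trans[OF f(2) g(2)] .
  moreover have "(\<lambda>x. (g \<circ> f) x + (g c + e)) ` P = R"
    unfolding eq using f(3) g(3) by (metis image_comp)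
  moreover have "linear (g \<circ> f)" using f(1) g(1) by (rule linear_compose)
  ultimately show ?thesis unfolding lattice_isomorphic_def by blast
qed

lemma affine_hull_affine_image:
  fixes f :: "real^'n \<Rightarrow> 'b::real_normed_vector"
  assumes "linear f"
  shows "affine hull ((\<lambda>x. f x + c) ` S) = (\<lambda>x. f x + c) ` (affine hull S)"
proof -
  have bl: "bounded_linear f" using assms linear_conv_bounded_linear by blast
  have "(\<lambda>x. f x + c) ` S = (\<lambda>x. c + x) ` (f ` S)" for S by (auto simp: add.commute image_image)
  then show ?thesis using affine_hull_linear_image[OF bl] affine_hull_translation by metis
qed

text \<open>The classification lists live in spaces of sequences. An explicit affine chart from
  \<open>real^'n\<close>, with a linear retraction, moves them into the space of the polytope under
  consideration; the isomorphism is needed in both directions because the definition is not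
  visibly symmetric.\<close>

lemma lattice_isomorphic_chart:
  fixes f :: "real^'n \<Rightarrow> 'b::{lattice_space,real_normed_vector}"
  assumes f: "linear f" and g: "linear g" and inv: "\<And>x. g (f x + c) + e = x"
    and lat: "\<And>x. f x + c \<in> lattice_points \<longleftrightarrow> x \<in> lattice_points"
    and full: "affine hull Q = UNIV" and R: "R = (\<lambda>x. f x + c) ` Q"
  shows "Q \<cong>\<^sub>L R" "R \<cong>\<^sub>L Q"
proof -
  have hull: "affine hull R = range (\<lambda>x. f x + c)"
    unfolding R affine_hull_affine_image[OF f] full ..
  have im: "(\<lambda>x. f x + c) ` lattice_points = affine hull R \<inter> lattice_points"
    unfolding hull using lat by auto
  have "bij_betw (\<lambda>x. f x + c) lattice_points (affine hull R \<inter> lattice_points)"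
    using im inv by (auto simp: bij_betw_def intro: inj_on_inverseI[where g = "\<lambda>y. g y + e"])
  then show "Q \<cong>\<^sub>L R"
    unfolding lattice_isomorphic_def full using f R by (intro exI[of _ f] exI[of _ c] conjI) simp_all
  have "bij_betw (\<lambda>x. g x + e) (affine hull R \<inter> lattice_points) lattice_points"
  proof -
    have "(\<lambda>x. g x + e) ` ((\<lambda>x. f x + c) ` lattice_points) = lattice_points"
      unfolding image_image by (simp add: inv)
    moreover have "inj_on (\<lambda>x. g x + e) (affine hull R \<inter> lattice_points)"
      unfolding hull by (auto intro!: inj_onI simp: inv)
    ultimately show ?thesis unfolding im bij_betw_def by simp
  qed
  moreover have "(\<lambda>x. g x + e) ` R = Q" unfolding R image_image by (simp add: inv)
  ultimately show "R \<cong>\<^sub>L Q"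
    unfolding lattice_isomorphic_def full using g by (intro exI[of _ g] exI[of _ e] conjI) simp_all
qed

lemma lattice_polytope_linear_image:
  assumes "lattice_polytope P" "linear f" "\<And>x. x \<in> lattice_points \<Longrightarrow> f x \<in> lattice_points"
  shows "lattice_polytope (f ` P)"
proof -
  obtain V where V: "finite V" "V \<noteq> {}" "V \<subseteq> lattice_points" "P = convex hull V"
    using assms(1) unfolding lattice_polytope_def by blast
  have "f ` P = convex hull (f ` V)" using convex_hull_linear_image[OF assms(2)] V by metis
  then show ?thesis unfolding lattice_polytope_def using V assms(3)
    by (intro exI[of _ "f ` V"]) auto
qed

lemma lattice_polytope_translate:
  fixes P :: "(real^'n) set"
  assumes "lattice_polytope P" "c \<in> lattice_points"
  shows "lattice_polytope ((\<lambda>x. x + c) ` P)"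
proof -
  obtain V where V: "finite V" "V \<noteq> {}" "V \<subseteq> lattice_points" "P = convex hull V"
    using assms(1) unfolding lattice_polytope_def by blast
  have "(\<lambda>x. x + c) ` P = convex hull ((\<lambda>x. x + c) ` V)"
    using convex_hull_translation[of c V] V by (simp add: add.commute)
  then show ?thesis unfolding lattice_polytope_def using V assms(2)
    by (intro exI[of _ "(\<lambda>x. x + c) ` V"]) (auto intro!: lattice_points_add)
qed

text \<open>A linear map that permutes the lattice points is surjective on the whole space since its range
contains the unit vectors, hence it is invertible; this recovers injectivity on the real space,
which an isomorphism of lattice polytopes provides on lattice points only.\<close>

lemma unimodular_inverse:
  fixes f :: "real^'n \<Rightarrow> real^'n"
  assumes f: "linear f" and bij: "bij_betw (\<lambda>x. f x + c) lattice_points lattice_points"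
  obtains g where "linear g" "\<And>x. g (f x) = x" "\<And>x. f (g x) = x"
    "\<And>x. f x \<in> lattice_points \<longleftrightarrow> x \<in> lattice_points" "c \<in> lattice_points"
proof -
  have c: "c \<in> lattice_points"
    using bij_betwE[OF bij] zero_in_lattice_points linear_0[OF f] by fastforce
  have fL: "f x \<in> lattice_points" if "x \<in> lattice_points" for x
    using bij_betwE[OF bij] that lattice_points_diff[OF _ c] by (metis add_diff_cancel_right')
  have ex: "\<exists>x\<in>lattice_points. f x = y" if y: "y \<in> lattice_points" for y
  proof -
    have "y + c \<in> (\<lambda>x. f x + c) ` lattice_points"
      using bij lattice_points_add[OF y c] by (simp add: bij_betw_def)
    then show ?thesis by auto
  qed
  have "Basis \<subseteq> range f"
  proof
    fix b :: "real^'n" assume "b \<in> Basis"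
    then obtain i where "b = axis i 1" by (auto simp: Basis_vec_def)
    then show "b \<in> range f" using ex[OF axis_in_lattice_points[of i]] by (metis rangeI)
  qed
  then have "span Basis \<subseteq> range f"
    using span_minimal linear_subspace_image[OF f subspace_UNIV] by metis
  then have surj: "surj f" by auto
  then have inj: "inj f" using linear_surjective_imp_injective[OF f] by blast
  obtain g where g: "linear g" "\<And>x. g (f x) = x" "\<And>x. f (g x) = x"
    using linear_injective_isomorphism[OF f inj] by blast
  have "x \<in> lattice_points" if "f x \<in> lattice_points" for x
    using ex[OF that] inj by (metis injD)
  then show ?thesis using that g fL c by metis
qed

text \<open>The dual polytope transforms by the inverse adjoint map, which preserves the lattice as well.\<close>

lemma gorenstein_lattice_isomorphic:
  fixes P Q :: "(real^'n) set"
  assumes gor: "gorenstein r P" and iso: "P \<cong>\<^sub>L Q"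
    and full: "affine hull P = UNIV" "affine hull Q = UNIV"
  shows "gorenstein r Q"
proof -
  obtain f c where f: "linear f" "bij_betw (\<lambda>x. f x + c) lattice_points lattice_points"
    "(\<lambda>x. f x + c) ` P = Q" using iso unfolding lattice_isomorphic_def full by auto
  obtain g where g: "linear g" "\<And>x. g (f x) = x" "\<And>x. f (g x) = x"
    and fL: "\<And>x. f x \<in> lattice_points \<longleftrightarrow> x \<in> lattice_points" and c: "c \<in> lattice_points"
    using unimodular_inverse[OF f(1,2)] by metis
  obtain m where m: "m \<in> lattice_points" and ref: "reflexive ((\<lambda>x. x + m) ` dilate r P)"
    and r: "r > 0" and lp: "lattice_polytope P"
    using gor unfolding gorenstein_def by auto
  define R where "R = (\<lambda>x. x + m) ` dilate r P"
  define k where "k = f m - real r *\<^sub>R c"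
  have k: "k \<in> lattice_points"
    unfolding k_def using m fL c by (intro lattice_points_diff lattice_points_scaleR) auto
  have R': "(\<lambda>x. x + k) ` dilate r Q = f ` R"
    unfolding R_def dilate_def f(3)[symmetric] image_image k_def
    using f(1) by (intro image_cong) (auto simp: linear_add linear_scale algebra_simps)
  have bl: "bounded_linear g" using g(1) linear_conv_bounded_linear by blast
  define h where "h = adjoint g"
  have h: "linear h" "x \<bullet> g y = h x \<bullet> y" for x y
    unfolding h_def using adjoint_linear[OF g(1)] adjoint_works[OF g(1)] by (auto simp: inner_commute)
  have f': "linear (adjoint f)" "x \<bullet> f y = adjoint f x \<bullet> y" for x y
    using adjoint_linear[OF f(1)] adjoint_works[OF f(1)] by (auto simp: inner_commute)
  have hf: "h (adjoint f y) = y" for y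
  proof -
    have "h (adjoint f y) \<bullet> x = y \<bullet> x" for x using h(2) f'(2) g by metis
    then show ?thesis using vector_eq_rdot by blast
  qed
  have "dual_polytope (f ` R) = h ` dual_polytope R"
  proof (intro equalityI subsetI)
    fix y assume "y \<in> dual_polytope (f ` R)"
    then have "adjoint f y \<in> dual_polytope R" unfolding dual_polytope_def using f' by auto
    then show "y \<in> h ` dual_polytope R" using hf by (metis image_eqI)
  next
    fix y assume "y \<in> h ` dual_polytope R"
    then show "y \<in> dual_polytope (f ` R)" unfolding dual_polytope_def
      using h(2)[symmetric] g by auto
  qed
  moreover have "h y \<in> lattice_points" if y: "y \<in> lattice_points" for y
  proof -
    have "h y $ i \<in> \<int>" for i
    proof -
      have "h y $ i = h y \<bullet> axis i 1" by (simp add: inner_axis)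
      also have "\<dots> = y \<bullet> g (axis i 1)" using h by simp
      also have "\<dots> \<in> \<int>" using fL[of "g (axis i 1)"] g y axis_in_lattice_points
        by (intro inner_lattice_points) auto
      finally show ?thesis .
    qed
    then show ?thesis by (simp add: lattice_points_vec_iff)
  qed
  ultimately have dual: "lattice_polytope (dual_polytope (f ` R))"
    using lattice_polytope_linear_image[OF _ h(1)] ref unfolding reflexive_def R_def by auto
  have "inj f" using g by (metis injI)
  then have "0 \<in> interior (f ` R)"
    using interior_injective_linear_image[OF f(1)] ref linear_0[OF f(1)]
    unfolding reflexive_def R_def by (metis image_eqI)
  moreover have "lattice_polytope (f ` R)"
    using lattice_polytope_linear_image[OF _ f(1)] ref fL unfolding reflexive_def R_def by auto
  ultimately have "reflexive (f ` R)" using dual unfolding reflexive_def by auto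
  moreover have "lattice_polytope Q"
  proof -
    have "lattice_polytope (f ` P)" using lattice_polytope_linear_image[OF lp f(1)] fL by auto
    from lattice_polytope_translate[OF this c] show ?thesis
      using f(3) by (simp add: image_image)
  qed
  ultimately show ?thesis unfolding gorenstein_def using r k R' by metis
qed

section \<open>Facet distances of Gorenstein polytopes\<close>

text \<open>The last conjunct says that the points of the polytope with distance \<open>0\<close> span a hyperplane,
so that the zero set is a facet and not a smaller face. It is phrased by the functionals that are
constant on this set, the form in which it is verified and used.\<close>

definition facet_form :: "(real^'n) set \<Rightarrow> real^'n \<Rightarrow> real \<Rightarrow> bool" where
  "facet_form P y c \<longleftrightarrow> y \<in> lattice_points \<and> (\<exists>z\<in>lattice_points. y \<bullet> z = 1) \<and>
     (\<forall>x\<in>P. 0 \<le> y \<bullet> x + c) \<and> (\<exists>x\<in>P \<inter> lattice_points. y \<bullet> x + c = 0) \<and>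
     (\<forall>\<delta>. (\<forall>x1\<in>P. \<forall>x2\<in>P. y \<bullet> x1 + c = 0 \<and> y \<bullet> x2 + c = 0 \<longrightarrow> \<delta> \<bullet> x1 = \<delta> \<bullet> x2) \<longrightarrow>
        (\<exists>\<tau>. \<delta> = \<tau> *\<^sub>R y))"

text \<open>Let \<open>R\<close> be the reflexive translate of \<open>r P\<close> and \<open>k\<close> the value at the origin of the form that
measures the corresponding facet of \<open>R\<close>. Then \<open>y / k\<close> is a vertex of the dual of \<open>R\<close> and hence a
lattice point. As \<open>y\<close> takes the value \<open>1\<close> on the lattice, \<open>1 / k\<close> is an integer. So is \<open>k\<close>, since the
form is integral. The point \<open>m\<close> is the interior lattice point of \<open>r P\<close>.\<close>

lemma gorenstein_facet_distance:
  fixes P :: "(real^'n) set"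
  assumes "gorenstein r P"
  obtains m where "m \<in> lattice_points" "\<And>y c. facet_form P y c \<Longrightarrow> y \<bullet> m + real r * c = 1"
proof -
  obtain m' where m': "m' \<in> lattice_points" and ref: "reflexive ((\<lambda>x. x + m') ` dilate r P)"
    and r: "r > 0" using assms unfolding gorenstein_def by auto
  define R where "R = (\<lambda>x. x + m') ` dilate r P"
  define m where "m = - m'"
  have m: "m \<in> lattice_points" using m' by (simp add: m_def lattice_points_vec_iff)
  have R: "R = (\<lambda>x. real r *\<^sub>R x - m) ` P" by (auto simp: R_def m_def dilate_def image_image)
  have "y \<bullet> m + real r * c = 1" if ff: "facet_form P y c" for y c
  proof -
    obtain z where z: "z \<in> lattice_points" "y \<bullet> z = 1" using ff unfolding facet_form_def by blast
    obtain x0 where x0: "x0 \<in> P" "x0 \<in> lattice_points" "y \<bullet> x0 + c = 0"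
      using ff unfolding facet_form_def by blast
    have yL: "y \<in> lattice_points" and pos: "\<And>x. x \<in> P \<Longrightarrow> 0 \<le> y \<bullet> x + c"
      and dir: "\<And>\<delta>. (\<And>x1 x2. x1\<in>P \<Longrightarrow> x2\<in>P \<Longrightarrow> y \<bullet> x1 + c = 0 \<Longrightarrow> y \<bullet> x2 + c = 0 \<Longrightarrow> \<delta> \<bullet> x1 = \<delta> \<bullet> x2) \<Longrightarrow>
        (\<exists>\<tau>. \<delta> = \<tau> *\<^sub>R y)"
      using ff unfolding facet_form_def by blast+
    define k where "k = y \<bullet> m + real r * c"
    have val: "y \<bullet> (real r *\<^sub>R x - m) = real r * (y \<bullet> x + c) - k" for x
      by (simp add: k_def inner_diff_right algebra_simps)
    have kZ: "k \<in> \<int>"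
    proof -
      have "c = - (y \<bullet> x0)" using x0 by simp
      then have "c \<in> \<int>" using inner_lattice_points[OF yL x0(2)] by simp
      then show ?thesis unfolding k_def using inner_lattice_points[OF yL m] by auto
    qed
    have "k > 0"
    proof -
      have "0 \<in> interior R" using ref unfolding reflexive_def R_def by auto
      then obtain e where e: "e > 0" "ball 0 e \<subseteq> R" by (meson mem_interior)
      have y0: "y \<noteq> 0" using z by auto
      define w where "w = - (e / (2 * norm y)) *\<^sub>R y"
      have "norm w < e" using e y0 by (simp add: w_def)
      then have "w \<in> R" using e by auto
      then obtain x where x: "x \<in> P" "w = real r *\<^sub>R x - m" unfolding R by auto
      have "y \<bullet> w \<ge> - k" unfolding x(2) val using pos[OF x(1)] r by simp
      moreover have "y \<bullet> w < 0" using y0 e by (simp add: w_def)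
      ultimately show ?thesis by simp
    qed
    obtain W where W: "dual_polytope R = convex hull W" "W \<subseteq> lattice_points"
      using ref unfolding reflexive_def R_def lattice_polytope_def by auto
    define y0 where "y0 = (1/k) *\<^sub>R y"
    \<comment> \<open>\<open>y / k\<close> is the normal of the facet, scaled as a point of the dual polytope\<close>
    have y0D: "y0 \<in> dual_polytope R"
      unfolding dual_polytope_def
    proof (intro CollectI ballI)
      fix X assume "X \<in> R"
      then obtain x where x: "x \<in> P" "X = real r *\<^sub>R x - m" unfolding R by auto
      have "y \<bullet> X \<ge> - k" unfolding x(2) val using pos[OF x(1)] r by simp
      then show "- 1 \<le> y0 \<bullet> X" using \<open>k > 0\<close> by (simp add: y0_def field_simps)
    qed
    have "y0 extreme_point_of dual_polytope R"
      unfolding extreme_point_of_def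
    proof (intro conjI y0D ballI notI)
      fix a b assume ab: "a \<in> dual_polytope R" "b \<in> dual_polytope R" "y0 \<in> open_segment a b"
      then obtain u where u: "0 < u" "u < 1" "y0 = (1 - u) *\<^sub>R a + u *\<^sub>R b" and "a \<noteq> b"
        by (auto simp: in_segment)
      have tight: "a \<bullet> (real r *\<^sub>R x - m) = -1 \<and> b \<bullet> (real r *\<^sub>R x - m) = -1"
        if x: "x \<in> P" "y \<bullet> x + c = 0" for x
      proof -
        define X where "X = real r *\<^sub>R x - m"
        have "X \<in> R" using x R X_def by auto
        then have ge: "a \<bullet> X \<ge> -1" "b \<bullet> X \<ge> -1" using ab unfolding dual_polytope_def by auto
        have "y0 \<bullet> X = -1" unfolding y0_def X_def using val[of x] x \<open>k > 0\<close> by simp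
        then have eq: "(1 - u) * (a \<bullet> X + 1) + u * (b \<bullet> X + 1) = 0"
          unfolding u(3) by (simp add: inner_add_left algebra_simps)
        have "(1 - u) * (a \<bullet> X + 1) \<ge> 0" "u * (b \<bullet> X + 1) \<ge> 0" using ge u by auto
        then have "(1 - u) * (a \<bullet> X + 1) = 0" "u * (b \<bullet> X + 1) = 0" using eq by linarith+
        then show ?thesis using u unfolding X_def by auto
      qed
      have "\<exists>\<tau>. a - b = \<tau> *\<^sub>R y"
      proof (rule dir)
        fix x1 x2 assume *: "x1 \<in> P" "x2 \<in> P" "y \<bullet> x1 + c = 0" "y \<bullet> x2 + c = 0"
        have "(a - b) \<bullet> (real r *\<^sub>R x1 - m) = (a - b) \<bullet> (real r *\<^sub>R x2 - m)"
          using tight[OF *(1,3)] tight[OF *(2,4)] by (simp add: inner_diff_left)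
        then show "(a - b) \<bullet> x1 = (a - b) \<bullet> x2" using r by (simp add: inner_diff_right)
      qed
      then obtain \<tau> where \<tau>: "a - b = \<tau> *\<^sub>R y" by blast
      have "(a - b) \<bullet> (real r *\<^sub>R x0 - m) = 0" using tight[OF x0(1,3)] by (simp add: inner_diff_left)
      then have "\<tau> * (- k) = 0" unfolding \<tau> using val[of x0] x0(3) by simp
      then show False using \<tau> \<open>k > 0\<close> \<open>a \<noteq> b\<close> by auto
    qed
    then have "y0 \<in> lattice_points" using W extreme_point_of_convex_hull by fastforce
    then have "y0 \<bullet> z \<in> \<int>" using z inner_lattice_points by blast
    then have "1 / k \<in> \<int>" unfolding y0_def using z by simp
    \<comment> \<open>both \<open>k\<close> and its inverse are positive integers\<close>
    then obtain i j where ij: "k = of_int i" "1 / k = of_int j" using kZ by (auto elim!: Ints_cases)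
    then have "of_int (i * j) = (1 :: real)" using \<open>k > 0\<close> by (metis nonzero_mult_div_cancel_left less_irrefl of_int_mult times_divide_eq_right mult_1_right)
    then have "i * j = 1" by linarith
    then have "i = 1" using \<open>k > 0\<close> ij by (auto simp: zmult_eq_1_iff)
    then show ?thesis using ij k_def by simp
  qed
  then show ?thesis using that m by blast
qed

section \<open>The cone at a vertex is generated by the edges\<close>

lemma exists_primitive_divisor:
  fixes x :: "real^'n"
  assumes x: "x \<in> lattice_points" "x \<noteq> 0"
  obtains u g where "primitive u" "0 < g" "x = real g *\<^sub>R u"
proof -
  obtain i where i: "x $ i \<noteq> 0" using x(2) by (metis vec_eq_iff zero_index)
  define G where "G = {k::nat. k > 0 \<and> (1 / real k) *\<^sub>R x \<in> lattice_points}"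
  have bound: "k \<le> nat \<lceil>\<bar>x $ i\<bar>\<rceil>" if "k \<in> G" for k
  proof -
    have k: "k > 0" "x $ i / real k \<in> \<int>" using that by (auto simp: G_def lattice_points_vec_iff)
    have "1 \<le> \<bar>x $ i / real k\<bar>" using k i by (intro Ints_nonzero_abs_ge1) auto
    then have "real k \<le> \<bar>x $ i\<bar>" using k by (simp add: field_simps)
    then show ?thesis by linarith
  qed
  have fin: "finite G" using bound finite_nat_set_iff_bounded_le by blast
  have ne: "1 \<in> G" using x by (simp add: G_def)
  define g where "g = Max G"
  have g: "g \<in> G" using Max_in[OF fin] ne g_def by auto
  define u where "u = (1 / real g) *\<^sub>R x"
  have gpos: "g > 0" using g by (simp add: G_def)
  have "primitive u"
    unfolding primitive_def
  proof (intro conjI ballI allI impI)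
    show "u \<in> lattice_points" using g by (simp add: G_def u_def)
    show "u \<noteq> 0" using x gpos by (simp add: u_def)
    fix w :: "real^'n" and k :: nat assume w: "w \<in> lattice_points" "u = real k *\<^sub>R w"
    have k: "k > 0" using w \<open>u \<noteq> 0\<close> by (cases k) auto
    have "(1 / real (k * g)) *\<^sub>R x = (1 / real k) *\<^sub>R u" by (simp add: u_def)
    also have "\<dots> = w" using w k by simp
    finally have "k * g \<in> G" using w k gpos by (simp add: G_def)
    then have "k * g \<le> g" using Max_ge[OF fin] g_def by auto
    then show "k = 1" using k gpos by simp
  qed
  moreover have "x = real g *\<^sub>R u" using gpos by (simp add: u_def)
  ultimately show ?thesis using that gpos by blast
qed

definition nonneg_span :: "'a::real_vector set \<Rightarrow> 'a set" where
  "nonneg_span B = {\<Sum>b\<in>B. c b *\<^sub>R b | c. \<forall>b. (0::real) \<le> c b}"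

lemma nonneg_span_add: "x \<in> nonneg_span B \<Longrightarrow> y \<in> nonneg_span B \<Longrightarrow> x + y \<in> nonneg_span B"
  unfolding nonneg_span_def
proof clarify
  fix c d :: "'a \<Rightarrow> real" assume "\<forall>b. 0 \<le> c b" "\<forall>b. 0 \<le> d b"
  then show "\<exists>e. (\<Sum>b\<in>B. c b *\<^sub>R b) + (\<Sum>b\<in>B. d b *\<^sub>R b) = (\<Sum>b\<in>B. e b *\<^sub>R b) \<and> (\<forall>b. 0 \<le> e b)"
    by (intro exI[of _ "\<lambda>b. c b + d b"]) (simp add: sum.distrib scaleR_add_left)
qed

lemma nonneg_span_scaleR: "x \<in> nonneg_span B \<Longrightarrow> 0 \<le> t \<Longrightarrow> t *\<^sub>R x \<in> nonneg_span B"
  unfolding nonneg_span_def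
proof clarify
  fix c :: "'a \<Rightarrow> real" assume "\<forall>b. 0 \<le> c b" "0 \<le> t"
  then show "\<exists>e. t *\<^sub>R (\<Sum>b\<in>B. c b *\<^sub>R b) = (\<Sum>b\<in>B. e b *\<^sub>R b) \<and> (\<forall>b. 0 \<le> e b)"
    by (intro exI[of _ "\<lambda>b. t * c b"]) (simp add: scaleR_sum_right)
qed

lemma convex_nonneg_span: "convex (nonneg_span B)"
  unfolding convex_def by (simp add: nonneg_span_add nonneg_span_scaleR)

lemma nonneg_span_base: "finite B \<Longrightarrow> b \<in> B \<Longrightarrow> b \<in> nonneg_span B"
  unfolding nonneg_span_def
  by (auto intro!: exI[of _ "\<lambda>b'. if b' = b then 1 else 0"] simp: if_distrib[of "\<lambda>t. t *\<^sub>R _"] cong: if_cong)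

text \<open>\<open>K\<close> is the vertex figure at \<open>v\<close>, normalised to lie in the hyperplane \<open>a \<bullet> k = 1\<close>. A segment of \<open>P\<close>
through a point of the ray \<open>v + t k0\<close> other than \<open>v\<close> projects from \<open>v\<close> to a segment of \<open>K\<close> through \<open>k0\<close>; since \<open>k0\<close>
is extreme, the projection is a single point and the segment lies on the ray.\<close>

lemma vertex_figure_edge:
  fixes P K :: "(real^'n) set"
  assumes P: "P \<subseteq> (\<lambda>x. v + x) ` (conic hull K)" "convex P" "v \<in> P"
    and K: "convex K" "\<And>k. k \<in> K \<Longrightarrow> a \<bullet> k = 1"
    and k0: "k0 extreme_point_of K" and w: "v + t0 *\<^sub>R k0 \<in> P" "t0 > 0"
  shows "{x \<in> P. \<exists>t\<ge>0. x = v + t *\<^sub>R k0} edge_of P"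
proof -
  define E where "E = {x \<in> P. \<exists>t\<ge>0. x = v + t *\<^sub>R k0}"
  have ray: "\<exists>\<alpha>\<ge>0. \<exists>\<kappa>\<in>K. y = v + \<alpha> *\<^sub>R \<kappa>" if "y \<in> P" for y
    using P(1) that unfolding conic_hull_explicit by blast
  have ak0: "a \<bullet> k0 = 1" using k0 K by (auto simp: extreme_point_of_def)
  have key: "y \<in> E" if yz: "y \<in> P" "z \<in> P" and x: "x \<in> E" "x = (1 - u) *\<^sub>R y + u *\<^sub>R z"
    and u: "0 < u" "u < 1" for x y z u
  proof -
    obtain \<alpha> \<kappa> where \<alpha>: "\<alpha> \<ge> 0" "\<kappa> \<in> K" "y = v + \<alpha> *\<^sub>R \<kappa>" using ray[OF yz(1)] by blast
    obtain \<beta> \<mu> where \<beta>: "\<beta> \<ge> 0" "\<mu> \<in> K" "z = v + \<beta> *\<^sub>R \<mu>" using ray[OF yz(2)] by blast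
    obtain t where t: "t \<ge> 0" "x = v + t *\<^sub>R k0" using x by (auto simp: E_def)
    have eq: "t *\<^sub>R k0 = ((1 - u) * \<alpha>) *\<^sub>R \<kappa> + (u * \<beta>) *\<^sub>R \<mu>"
      using x(2) t(2) unfolding \<alpha>(3) \<beta>(3) by (simp add: algebra_simps)
    have "a \<bullet> (t *\<^sub>R k0) = t" using ak0 by simp
    then have teq: "t = (1 - u) * \<alpha> + u * \<beta>" unfolding eq using K \<alpha> \<beta>
      by (simp add: inner_add_right)
    show ?thesis
    proof (cases "\<alpha> = 0")
      case True
      then show ?thesis using \<alpha> P by (auto simp: E_def intro!: exI[of _ 0])
    next
      case False
      then have pos: "(1 - u) * \<alpha> > 0" using u \<alpha> by simp
      then have "t > 0" using teq u \<beta> by (simp add: add_pos_nonneg)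
      have "\<kappa> = k0"
      proof (cases "\<beta> = 0")
        case True
        then show ?thesis using eq teq pos by (metis add.right_neutral less_irrefl mult_zero_right real_vector.scale_left_imp_eq scaleR_zero_left)
      next
        case False
        then have pos2: "u * \<beta> > 0" using u \<beta> by simp
        define s where "s = u * \<beta> / t"
        have s: "0 < s" "s < 1" "1 - s = (1 - u) * \<alpha> / t" using pos pos2 \<open>t > 0\<close> teq
          by (auto simp: s_def field_simps)
        have "k0 = (1 / t) *\<^sub>R (t *\<^sub>R k0)" using \<open>t > 0\<close> by simp
        also have "\<dots> = (1 - s) *\<^sub>R \<kappa> + s *\<^sub>R \<mu>" unfolding eq s(3) unfolding s_def
          by (simp only: scaleR_add_right scaleR_scaleR times_divide_eq_left mult_1_left)
        finally have k0eq: "k0 = (1 - s) *\<^sub>R \<kappa> + s *\<^sub>R \<mu>" .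
        have "\<kappa> = \<mu>"
        proof (rule ccontr)
          assume "\<kappa> \<noteq> \<mu>"
          then have "k0 \<in> open_segment \<kappa> \<mu>" using s k0eq by (auto simp: in_segment)
          then show False using k0 \<alpha> \<beta> by (auto simp: extreme_point_of_def)
        qed
        then show ?thesis using k0eq by (simp add: scaleR_left_distrib[symmetric])
      qed
      then show ?thesis using \<alpha> yz by (auto simp: E_def)
    qed
  qed
  have "E face_of P"
    unfolding face_of_def
  proof (intro conjI ballI impI)
    show "E \<subseteq> P" by (auto simp: E_def)
    have "E = P \<inter> (\<lambda>x. v + x) ` ((\<lambda>t. t *\<^sub>R k0) ` {0..})" by (auto simp: E_def)
    moreover have "convex ((\<lambda>t. t *\<^sub>R k0) ` {0::real..})"
      by (intro convex_linear_image) (auto intro!: linearI simp: algebra_simps)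
    ultimately show "convex E" using P(2) by (metis convex_Int convex_translation)
    fix y z x assume *: "y \<in> P" "z \<in> P" "x \<in> E" "x \<in> open_segment y z"
    then obtain u where u: "0 < u" "u < 1" "x = (1 - u) *\<^sub>R y + u *\<^sub>R z" by (auto simp: in_segment)
    show "y \<in> E" using key[OF *(1,2,3)] u by blast
    show "z \<in> E" using key[OF *(2,1,3), of "1 - u"] u by (simp add: add.commute)
  qed
  moreover have "aff_dim E = 1"
  proof -
    define w where "w = v + t0 *\<^sub>R k0"
    have "k0 \<noteq> 0" using ak0 by auto
    then have vw: "v \<noteq> w" using \<open>t0 > 0\<close> by (simp add: w_def)
    have "E \<subseteq> affine hull {v, w}"
    proof
      fix x assume "x \<in> E"
      then obtain t where t: "x = v + t *\<^sub>R k0" by (auto simp: E_def)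
      have "x = (1 - t / t0) *\<^sub>R v + (t / t0) *\<^sub>R w" using \<open>t0 > 0\<close> by (simp add: t w_def algebra_simps)
      then show "x \<in> affine hull {v, w}" unfolding affine_hull_2
        by (intro CollectI exI[of _ "1 - t/t0"] exI[of _ "t/t0"]) simp
    qed
    then have "aff_dim E \<le> aff_dim (affine hull {v, w})" by (rule aff_dim_subset)
    then have "aff_dim E \<le> 1" using vw by (simp add: aff_dim_2)
    moreover have "{v, w} \<subseteq> E"
      using P(3) \<open>t0 > 0\<close> assms(7) by (auto simp: E_def w_def intro: exI[of _ 0] exI[of _ t0])
    then have "aff_dim {v, w} \<le> aff_dim E" by (rule aff_dim_subset)
    ultimately show ?thesis using vw by (simp add: aff_dim_2)
  qed
  ultimately show ?thesis unfolding E_def edge_of_def by blast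
qed

text \<open>The cone at \<open>v\<close> is generated by the vertex figure, the vertex figure by its extreme points
(Krein-Milman), and each of these spans an edge by the previous lemma.\<close>

lemma lattice_polytope_vertex_cone:
  fixes P :: "(real^'n) set"
  assumes P: "lattice_polytope P" and v: "v extreme_point_of P"
    and fin: "finite (primitive_edge_vectors P v)" and x: "x \<in> P"
  shows "x - v \<in> nonneg_span (primitive_edge_vectors P v)"
proof -
  let ?C = "nonneg_span (primitive_edge_vectors P v)"
  obtain V where V: "finite V" "V \<subseteq> lattice_points" "P = convex hull V"
    using P unfolding lattice_polytope_def by blast
  have "polytope P" using V polytope_def by blast
  then have "{v} exposed_face_of P"
    using exposed_face_of_polyhedron polytope_imp_polyhedron v face_of_singleton by blast
  then obtain a0 \<beta> where a0: "P \<subseteq> {x. a0 \<bullet> x \<le> \<beta>}" "{v} = P \<inter> {x. a0 \<bullet> x = \<beta>}"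
    unfolding exposed_face_of_def by blast
  define a where "a = - a0"
  have vV: "v \<in> V" using v V extreme_point_of_convex_hull by blast
  have vP: "v \<in> P" using a0 by blast
  have a: "0 < a \<bullet> (w - v)" if "w \<in> P" "w \<noteq> v" for w
  proof -
    have "a0 \<bullet> w \<le> \<beta>" "a0 \<bullet> w \<noteq> \<beta>" "a0 \<bullet> v = \<beta>" using that a0 by blast+
    then show ?thesis by (simp add: a_def inner_diff_right)
  qed
  define k where "k = (\<lambda>w. (1 / (a \<bullet> (w - v))) *\<^sub>R (w - v))"
  define K where "K = convex hull (k ` (V - {v}))"
  have VP: "V \<subseteq> P" unfolding V by (rule hull_subset)
  have kk: "w - v = (a \<bullet> (w - v)) *\<^sub>R k w" if "w \<in> V - {v}" for w
  proof -
    have "a \<bullet> (w - v) \<noteq> 0" using a[of w] that VP by auto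
    then show ?thesis unfolding k_def by simp
  qed
  have aK: "a \<bullet> q = 1" if "q \<in> K" for q
  proof -
    have "K \<subseteq> {x. a \<bullet> x = 1}" unfolding K_def
    proof (rule hull_minimal)
      show "k ` (V - {v}) \<subseteq> {x. a \<bullet> x = 1}"
      proof clarify
        fix w assume w: "w \<in> V" "w \<noteq> v"
        have "a \<bullet> (w - v) \<noteq> 0" using a[of w] w VP by auto
        then show "a \<bullet> k w = 1" by (simp add: k_def)
      qed
    qed (rule convex_hyperplane)
    then show ?thesis using that by blast
  qed
  have PK: "P \<subseteq> (\<lambda>x. v + x) ` (conic hull K)" if "K \<noteq> {}"
    unfolding V(3)
  proof (rule hull_minimal)
    show "convex ((\<lambda>x. v + x) ` (conic hull K))"
      unfolding K_def by (intro convex_translation convex_conic_hull convex_convex_hull)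
    show "V \<subseteq> (\<lambda>x. v + x) ` (conic hull K)"
    proof
      fix w assume w: "w \<in> V"
      have "w - v \<in> conic hull K"
      proof (cases "w = v")
        case True
        then show ?thesis using that conic_hull_contains_0[of K] by simp
      next
        case False
        then have "w - v = (a \<bullet> (w - v)) *\<^sub>R k w" "k w \<in> K" "0 \<le> a \<bullet> (w - v)"
          using kk[of w] w a[of w] VP hull_inc[of "k w" "k ` (V - {v})" convex] by (auto simp: K_def intro: less_imp_le)
        then show ?thesis unfolding conic_hull_explicit by blast
      qed
      then show "w \<in> (\<lambda>x. v + x) ` (conic hull K)" by (intro image_eqI[of _ _ "w - v"]) auto
    qed
  qed
  \<comment> \<open>an extreme point of the vertex figure is a positive multiple of a primitive edge vector\<close>
  have extC: "q \<in> ?C" if q: "q extreme_point_of K" for q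
  proof -
    have Kne: "K \<noteq> {}" using q by (auto simp: extreme_point_of_def)
    have "q \<in> k ` (V - {v})" using q extreme_point_of_convex_hull unfolding K_def by blast
    then obtain w where w: "w \<in> V" "w \<noteq> v" "q = k w" by blast
    define t where "t = a \<bullet> (w - v)"
    have t: "t > 0" "w = v + t *\<^sub>R q" using a[of w] kk[of w] w VP by (auto simp: t_def algebra_simps)
    have PK': "P \<subseteq> (\<lambda>x. v + x) ` (conic hull K)" using PK[OF Kne] .
    have wP: "v + t *\<^sub>R q \<in> P" using w(1) VP t(2) by (metis subsetD)
    have edge: "{x \<in> P. \<exists>t\<ge>0. x = v + t *\<^sub>R q} edge_of P"
      by (rule vertex_figure_edge[OF PK' _ vP _ aK q wP t(1)]) (auto simp: V K_def)
    have "w - v \<in> lattice_points" using w vV V lattice_points_diff by blast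
    then obtain u g where u: "primitive u" "0 < g" "w - v = real g *\<^sub>R u"
      using exists_primitive_divisor w(2) by (metis right_minus_eq)
    have gpos: "0 < real g" using u(2) by simp
    have "v + real g *\<^sub>R u \<in> {x \<in> P. \<exists>t\<ge>0. x = v + t *\<^sub>R q}"
      unfolding u(3)[symmetric] using wP t(1) less_imp_le[OF t(1)]
      by (intro CollectI conjI exI[of _ t]) (simp_all add: t(2)[symmetric])
    moreover have "v \<in> {x \<in> P. \<exists>t\<ge>0. x = v + t *\<^sub>R q}" using vP by (auto intro: exI[of _ 0])
    ultimately have "u \<in> primitive_edge_vectors P v"
      unfolding primitive_edge_vectors_def
      using u(1) edge gpos by blast
    then have "u \<in> ?C" using nonneg_span_base fin by blast
    then have "(real g / t) *\<^sub>R u \<in> ?C" using t by (intro nonneg_span_scaleR) auto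
    moreover have "q = (real g / t) *\<^sub>R u"
    proof -
      have "t *\<^sub>R q = real g *\<^sub>R u" using u(3) t(2) by (simp add: algebra_simps)
      then have "(1/t) *\<^sub>R (t *\<^sub>R q) = (1/t) *\<^sub>R (real g *\<^sub>R u)" by simp
      then show ?thesis using t(1) by simp
    qed
    ultimately show ?thesis by simp
  qed
  have "K = convex hull {q. q extreme_point_of K}"
    unfolding K_def using V(1) by (intro Krein_Milman_polytope) auto
  also have "\<dots> \<subseteq> ?C" by (rule hull_minimal) (auto simp: extC convex_nonneg_span)
  finally have KC: "K \<subseteq> ?C" .
  have "V \<subseteq> (\<lambda>x. v + x) ` ?C"
  proof
    fix w assume w: "w \<in> V"
    have "w - v \<in> ?C"
    proof (cases "w = v")
      case True
      then show ?thesis by (auto simp: nonneg_span_def intro!: exI[of _ "\<lambda>_. 0"])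
    next
      case False
      then have "k w \<in> K" using w unfolding K_def by (intro hull_inc) auto
      then have "(a \<bullet> (w - v)) *\<^sub>R k w \<in> ?C"
        using a[of w] False w VP KC by (intro nonneg_span_scaleR) (auto intro: less_imp_le)
      then show ?thesis using kk w False by auto
    qed
    then show "w \<in> (\<lambda>x. v + x) ` ?C" by (auto intro!: image_eqI[of _ _ "w - v"])
  qed
  then have "P \<subseteq> (\<lambda>x. v + x) ` ?C" unfolding V(3)
    by (rule hull_minimal) (intro convex_translation convex_nonneg_span)
  then show ?thesis using x by auto
qed

section \<open>Facet forms of a smooth polytope\<close>

lemma lattice_basis_finite: "lattice_basis B \<Longrightarrow> finite B"
  by (simp add: lattice_basis_def)

lemma lattice_basis_expansion:
  assumes "lattice_basis B" "x \<in> lattice_points"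
  obtains c :: "_ \<Rightarrow> int" where "x = (\<Sum>b\<in>B. of_int (c b) *\<^sub>R b)"
  using assms unfolding lattice_basis_def by blast

lemma lattice_basis_subset:
  assumes "lattice_basis B" shows "B \<subseteq> lattice_points"
proof
  fix b assume b: "b \<in> B"
  have "b = (\<Sum>b'\<in>B. of_int (if b' = b then 1 else 0) *\<^sub>R b')"
    using b lattice_basis_finite[OF assms] by (simp add: if_distrib[of "\<lambda>t. of_int t *\<^sub>R _"] cong: if_cong)
  then show "b \<in> lattice_points"
    using assms rangeI[of "\<lambda>c :: 'a \<Rightarrow> int. \<Sum>b\<in>B. of_int (c b) *\<^sub>R b"]
    unfolding lattice_basis_def by metis
qed

lemma lattice_basis_span:
  assumes "lattice_basis (B :: (real^'n) set)"
  shows "span B = UNIV"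
proof -
  have "Basis \<subseteq> span B"
  proof
    fix e :: "real^'n" assume "e \<in> Basis"
    then have "e \<in> lattice_points" using axis_in_lattice_points by (auto simp: Basis_vec_def)
    then obtain c where "e = (\<Sum>b\<in>B. of_int (c b) *\<^sub>R b)" using lattice_basis_expansion[OF assms] by metis
    then show "e \<in> span B" by (simp add: span_sum span_scale span_base)
  qed
  then have "span Basis \<subseteq> span B" by (rule span_minimal) simp
  then show ?thesis by auto
qed

lemma lattice_basis_card:
  assumes "lattice_basis (B :: (real^'n) set)"
  shows "card B = CARD('n)"
proof -
  have "dim (span B) = card B" using assms dim_span_eq_card_independent by (auto simp: lattice_basis_def)
  then show ?thesis using lattice_basis_span[OF assms] by simp
qed

lemma inner_lattice_basis_eq:
  assumes "lattice_basis (B :: (real^'n) set)" "\<And>b. b \<in> B \<Longrightarrow> x \<bullet> b = y \<bullet> b"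
  shows "x = y"
proof -
  have "(x - y) \<bullet> z = 0" for z
  proof -
    have "z \<in> span B" using lattice_basis_span[OF assms(1)] by simp
    then show ?thesis
      by (induction rule: span_induct_alt) (auto simp: inner_add_right inner_diff_left assms(2))
  qed
  then show ?thesis by (metis inner_eq_zero_iff right_minus_eq)
qed

definition dual_vector :: "(real^'n) set \<Rightarrow> real^'n \<Rightarrow> real^'n \<Rightarrow> bool" where
  "dual_vector B b y \<longleftrightarrow> (\<forall>b'\<in>B. y \<bullet> b' = (if b' = b then 1 else 0))"

lemma dual_vector_exists:
  assumes "lattice_basis (B :: (real^'n) set)"
  obtains y where "dual_vector B b y"
proof -
  have "independent B" using assms by (simp add: lattice_basis_def)
  then obtain g where g: "linear g" "\<forall>b'\<in>B. g b' = (if b' = b then 1 else 0 :: real)"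
    using linear_independent_extend[of B "\<lambda>b'. if b' = b then 1 else 0 :: real"] by blast
  define y where "y = adjoint g 1"
  have "x \<bullet> y = g x" for x unfolding y_def adjoint_works[OF g(1)] by simp
  then have "y \<bullet> x = g x" for x by (subst inner_commute)
  then show ?thesis using that[of y] g(2) by (simp add: dual_vector_def)
qed

lemma dual_vector_unique:
  "lattice_basis B \<Longrightarrow> dual_vector B b y \<Longrightarrow> dual_vector B b y' \<Longrightarrow> y = y'"
  by (rule inner_lattice_basis_eq) (auto simp: dual_vector_def)

lemma dual_vector_lattice:
  assumes B: "lattice_basis (B :: (real^'n) set)" and y: "dual_vector B b y"
  shows "y \<in> lattice_points"
proof -
  have "y $ i \<in> \<int>" for i
  proof -
    obtain c where c: "axis i 1 = (\<Sum>b\<in>B. of_int (c b) *\<^sub>R b)"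
      using lattice_basis_expansion[OF B axis_in_lattice_points] by metis
    have "y $ i = y \<bullet> axis i 1" by (simp add: inner_axis)
    also have "\<dots> = (\<Sum>b'\<in>B. of_int (c b') * (y \<bullet> b'))" unfolding c by (simp add: inner_sum_right)
    also have "\<dots> \<in> \<int>" using y by (intro Ints_sum Ints_mult) (auto simp: dual_vector_def)
    finally show ?thesis .
  qed
  then show ?thesis by (simp add: lattice_points_vec_iff)
qed

text \<open>At a vertex of a smooth polytope the facets are the coordinate hyperplanes with respect to the
edge vectors, so their forms are the dual basis vectors. Collecting them over all vertices gives
all facets, each with the same form at all of its vertices.\<close>

definition facet_forms :: "(real^'n) set \<Rightarrow> ((real^'n) \<times> real) set" where
  "facet_forms P = {(y, c). \<exists>v b. v extreme_point_of P \<and> b \<in> primitive_edge_vectors P v \<and>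
      dual_vector (primitive_edge_vectors P v) b y \<and> c = - (y \<bullet> v)}"

lemma smooth_polytopeD:
  assumes "smooth_polytope P"
  shows "lattice_polytope P" "v extreme_point_of P \<Longrightarrow> lattice_basis (primitive_edge_vectors P v)"
    "affine hull P = UNIV"
  using assms by (auto simp: smooth_polytope_def) (metis DIM_cart DIM_real UNIV_I aff_dim_eq_full mult_1_right)

lemma lattice_polytope_extreme_point:
  assumes "lattice_polytope P" "v extreme_point_of P"
  shows "v \<in> lattice_points"
  using assms extreme_point_of_convex_hull unfolding lattice_polytope_def by blast

lemma finite_extreme_points_lattice_polytope:
  assumes "lattice_polytope P"
  shows "finite {v. v extreme_point_of P}"
proof -
  obtain V where V: "finite V" "P = convex hull V" using assms unfolding lattice_polytope_def by blast
  then have "{v. v extreme_point_of P} \<subseteq> V" using extreme_point_of_convex_hull by blast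
  then show ?thesis using V(1) finite_subset by blast
qed

lemma finite_facet_forms:
  assumes P: "smooth_polytope P"
  shows "finite (facet_forms P)"
proof -
  let ?X = "SIGMA v:{v. v extreme_point_of P}. primitive_edge_vectors P v"
  let ?f = "\<lambda>(v,b). let y = (THE y. dual_vector (primitive_edge_vectors P v) b y) in (y, - (y \<bullet> v))"
  have "facet_forms P \<subseteq> ?f ` ?X"
  proof clarify
    fix y c assume "(y, c) \<in> facet_forms P"
    then obtain v b where vb: "v extreme_point_of P" "b \<in> primitive_edge_vectors P v"
      "dual_vector (primitive_edge_vectors P v) b y" "c = - (y \<bullet> v)" unfolding facet_forms_def by blast
    have "(THE y. dual_vector (primitive_edge_vectors P v) b y) = y"
      using vb(3) dual_vector_unique smooth_polytopeD(2)[OF P vb(1)] by blast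
    then show "(y, c) \<in> ?f ` ?X" using vb by (intro image_eqI[of _ _ "(v, b)"]) (auto simp: Let_def)
  qed
  moreover have "finite ?X"
    using finite_extreme_points_lattice_polytope smooth_polytopeD[OF P] lattice_basis_finite by blast
  ultimately show ?thesis by (meson finite_imageI finite_subset)
qed

lemma smooth_vertex_cone:
  assumes P: "smooth_polytope P" and v: "v extreme_point_of P" and x: "x \<in> P"
  obtains c where "\<And>b. 0 \<le> c b" "x = v + (\<Sum>b\<in>primitive_edge_vectors P v. c b *\<^sub>R b)"
proof -
  have "x - v \<in> nonneg_span (primitive_edge_vectors P v)"
    using lattice_polytope_vertex_cone smooth_polytopeD[OF P] lattice_basis_finite v x by blast
  then obtain c where "\<forall>b. 0 \<le> c b" "x - v = (\<Sum>b\<in>primitive_edge_vectors P v. c b *\<^sub>R b)"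
    unfolding nonneg_span_def by blast
  then show ?thesis using that by (metis add.commute diff_add_cancel)
qed

lemma dual_vector_sum:
  assumes "finite B" "b \<in> B" "dual_vector B b y"
  shows "y \<bullet> (\<Sum>b'\<in>B. c b' *\<^sub>R b') = c b"
proof -
  have "y \<bullet> (\<Sum>b'\<in>B. c b' *\<^sub>R b') = (\<Sum>b'\<in>B. c b' * (if b' = b then 1 else 0))"
    using assms by (auto simp: inner_sum_right dual_vector_def intro!: sum.cong)
  also have "\<dots> = c b" using assms by (simp add: if_distrib[of "\<lambda>t. _ * t"] cong: if_cong)
  finally show ?thesis .
qed

lemma facet_forms_nonneg:
  assumes P: "smooth_polytope P" and yc: "(y, c) \<in> facet_forms P" and x: "x \<in> P"
  shows "0 \<le> y \<bullet> x + c"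
proof -
  obtain v b where vb: "v extreme_point_of P" "b \<in> primitive_edge_vectors P v"
    "dual_vector (primitive_edge_vectors P v) b y" "c = - (y \<bullet> v)" using yc unfolding facet_forms_def by blast
  obtain e where e: "\<And>b. 0 \<le> e b" "x = v + (\<Sum>b\<in>primitive_edge_vectors P v. e b *\<^sub>R b)"
    by (rule smooth_vertex_cone[OF P vb(1) x]) blast
  have "y \<bullet> x + c = e b" unfolding e vb(4)
    using dual_vector_sum[OF lattice_basis_finite[OF smooth_polytopeD(2)[OF P vb(1)]] vb(2,3)]
    by (simp add: inner_add_right)
  then show ?thesis using e by simp
qed

lemma lattice_polytope_compact:
  fixes P :: "(real^'n) set"
  shows "lattice_polytope P \<Longrightarrow> compact P" "lattice_polytope P \<Longrightarrow> convex P" "lattice_polytope P \<Longrightarrow> P \<noteq> {}"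
  unfolding lattice_polytope_def by (auto intro: finite_imp_compact_convex_hull)

text \<open>A polytope is the intersection of its vertex cones: a linear functional that separates a
  point from the polytope attains its minimum over the polytope at a vertex, and then separates
  the point from the cone at that vertex.\<close>

lemma smooth_polytope_eq_facet_forms:
  assumes P: "smooth_polytope P"
  shows "P = {x. \<forall>(y, c)\<in>facet_forms P. 0 \<le> y \<bullet> x + c}"
proof (intro equalityI subsetI)
  fix x assume "x \<in> P"
  then show "x \<in> {x. \<forall>(y, c)\<in>facet_forms P. 0 \<le> y \<bullet> x + c}" using facet_forms_nonneg[OF P] by auto
next
  fix x assume "x \<in> {x. \<forall>(y, c)\<in>facet_forms P. 0 \<le> y \<bullet> x + c}"
  then have x: "\<And>y c. (y, c) \<in> facet_forms P \<Longrightarrow> 0 \<le> y \<bullet> x + c" by auto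
  note cpt = lattice_polytope_compact[OF smooth_polytopeD(1)[OF P]]
  show "x \<in> P"
  proof (rule ccontr)
    assume "x \<notin> P"
    then obtain a \<beta> where a: "a \<bullet> x < \<beta>" "\<And>y. y \<in> P \<Longrightarrow> \<beta> < a \<bullet> y"
      using separating_hyperplane_closed_point[of P x] cpt by (auto simp: compact_imp_closed)
    have "continuous_on P (\<lambda>y. a \<bullet> y)" by (intro continuous_intros)
    then obtain w where w: "w \<in> P" "\<And>y. y \<in> P \<Longrightarrow> a \<bullet> w \<le> a \<bullet> y"
      using continuous_attains_inf[OF cpt(1,3)] by blast
    have face: "P \<inter> {y. a \<bullet> y = a \<bullet> w} face_of P"
      using face_of_Int_supporting_hyperplane_ge[OF cpt(2)] w by auto
    have "compact (P \<inter> {y. a \<bullet> y = a \<bullet> w})" using cpt by (simp add: compact_Int_closed closed_hyperplane)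
    moreover have "convex (P \<inter> {y. a \<bullet> y = a \<bullet> w})" using cpt by (simp add: convex_Int convex_hyperplane)
    ultimately obtain v where "v extreme_point_of (P \<inter> {y. a \<bullet> y = a \<bullet> w})"
      using extreme_point_exists_convex w by blast
    then have v: "v extreme_point_of P" "a \<bullet> v = a \<bullet> w"
      using extreme_point_of_face[OF face] by (auto simp: extreme_point_of_def)
    let ?B = "primitive_edge_vectors P v"
    have B: "lattice_basis ?B" using smooth_polytopeD(2)[OF P v(1)] .
    have "x - v \<in> span ?B" using lattice_basis_span[OF B] by simp
    then obtain e where e: "x - v = (\<Sum>b\<in>?B. e b *\<^sub>R b)"
      using span_finite[OF lattice_basis_finite[OF B]] by auto
    have "0 \<le> e b" if b: "b \<in> ?B" for b
    proof -
      obtain y where y: "dual_vector ?B b y" using dual_vector_exists[OF B] .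
      then have "(y, - (y \<bullet> v)) \<in> facet_forms P" unfolding facet_forms_def using v b by blast
      from x[OF this] have "0 \<le> y \<bullet> (x - v)" by (simp add: inner_diff_right)
      then show ?thesis unfolding e using dual_vector_sum[OF lattice_basis_finite[OF B] b y] by simp
    qed
    moreover have "0 \<le> a \<bullet> b" if b: "b \<in> ?B" for b
    proof -
      obtain E t where E: "E edge_of P" "t > 0" "v + t *\<^sub>R b \<in> E" using b unfolding primitive_edge_vectors_def by blast
      then have "v + t *\<^sub>R b \<in> P" using edge_of_imp_subset by blast
      then have "0 \<le> t * (a \<bullet> b)" using w(2)[of "v + t *\<^sub>R b"] v by (simp add: inner_add_right)
      then show ?thesis using E by (simp add: zero_le_mult_iff)
    qed
    ultimately have "0 \<le> a \<bullet> (x - v)" unfolding e by (auto simp: inner_sum_right intro!: sum_nonneg)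
    then have "a \<bullet> v \<le> a \<bullet> x" by (simp add: inner_diff_right)
    moreover have "\<beta> < a \<bullet> v" using a(2)[of v] v(1) by (simp add: extreme_point_of_def)
    ultimately show False using a by simp
  qed
qed

lemma edge_vector_step:
  assumes P: "smooth_polytope P" and b: "b \<in> primitive_edge_vectors P v"
  obtains t where "t > 0" "v + t *\<^sub>R b \<in> P"
  using b edge_of_imp_subset unfolding primitive_edge_vectors_def by blast

text \<open>If the form is dual to the edge \<open>b\<close> at the vertex \<open>v\<close>, then its zero set is spanned by \<open>v\<close> and
the other edges at \<open>v\<close>.\<close>

lemma facet_forms_facet_form:
  assumes P: "smooth_polytope P" and yc: "(y, c) \<in> facet_forms P"
  shows "facet_form P y c"
proof -
  obtain v b where vb: "v extreme_point_of P" "b \<in> primitive_edge_vectors P v"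
    "dual_vector (primitive_edge_vectors P v) b y" "c = - (y \<bullet> v)" using yc unfolding facet_forms_def by blast
  let ?B = "primitive_edge_vectors P v"
  have B: "lattice_basis ?B" using smooth_polytopeD(2)[OF P vb(1)] .
  have vL: "v \<in> lattice_points" and vP: "v \<in> P"
    using lattice_polytope_extreme_point smooth_polytopeD(1)[OF P] vb by (auto simp: extreme_point_of_def)
  show ?thesis
    unfolding facet_form_def
  proof (intro conjI allI impI)
    show "y \<in> lattice_points" using dual_vector_lattice[OF B vb(3)] .
    show "\<exists>z\<in>lattice_points. y \<bullet> z = 1" using vb(2,3) lattice_basis_subset[OF B]
      by (intro bexI[of _ b]) (auto simp: dual_vector_def)
    show "\<forall>x\<in>P. 0 \<le> y \<bullet> x + c" using facet_forms_nonneg[OF P yc] by blast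
    show "\<exists>x\<in>P \<inter> lattice_points. y \<bullet> x + c = 0" using vL vP vb by auto
    fix \<delta> :: "real^'a" assume \<delta>: "\<forall>x1\<in>P. \<forall>x2\<in>P. y \<bullet> x1 + c = 0 \<and> y \<bullet> x2 + c = 0 \<longrightarrow> \<delta> \<bullet> x1 = \<delta> \<bullet> x2"
    have "\<delta> = (\<delta> \<bullet> b) *\<^sub>R y"
    proof (rule inner_lattice_basis_eq[OF B])
      fix b' assume b': "b' \<in> ?B"
      show "\<delta> \<bullet> b' = ((\<delta> \<bullet> b) *\<^sub>R y) \<bullet> b'"
      proof (cases "b' = b")
        case True
        then show ?thesis using vb by (simp add: dual_vector_def)
      next
        case False
        then have y0: "y \<bullet> b' = 0" using vb b' by (simp add: dual_vector_def)
        obtain t where t: "t > 0" "v + t *\<^sub>R b' \<in> P" using edge_vector_step[OF P b'] .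
        have "y \<bullet> (v + t *\<^sub>R b') + c = 0" "y \<bullet> v + c = 0" using y0 vb(4) by (simp_all add: inner_add_right)
        then have "\<delta> \<bullet> (v + t *\<^sub>R b') = \<delta> \<bullet> v" using \<delta> t(2) vP by blast
        then show ?thesis using y0 t by (simp add: inner_add_right)
      qed
    qed
    then show "\<exists>\<tau>. \<delta> = \<tau> *\<^sub>R y" by blast
  qed
qed

text \<open>A form obtained at a vertex \<open>w\<close> that vanishes at another vertex \<open>v\<close> is again a dual basis vector
there: it vanishes on as many independent edge directions at \<open>w\<close> as a facet has dimensions, and
these must be combinations of the edges at \<open>v\<close> on which it vanishes. Hence it is a multiple of a
dual basis vector, and the multiple is \<open>1\<close> because the form takes the value \<open>1\<close> on the lattice.\<close>

lemma tight_facet_form_dual: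
  assumes P: "smooth_polytope P" and yc: "(y, c) \<in> facet_forms P"
    and v: "v extreme_point_of P" and tight: "y \<bullet> v + c = 0"
  obtains b where "b \<in> primitive_edge_vectors P v" "dual_vector (primitive_edge_vectors P v) b y"
proof -
  let ?B = "primitive_edge_vectors P v"
  have B: "lattice_basis ?B" using smooth_polytopeD(2)[OF P v] .
  obtain w b0 where w: "w extreme_point_of P" "b0 \<in> primitive_edge_vectors P w"
    "dual_vector (primitive_edge_vectors P w) b0 y" "c = - (y \<bullet> w)" using yc unfolding facet_forms_def by blast
  let ?D = "primitive_edge_vectors P w"
  have D: "lattice_basis ?D" using smooth_polytopeD(2)[OF P w(1)] .
  have wP: "w \<in> P" using w by (auto simp: extreme_point_of_def)
  have yB: "0 \<le> y \<bullet> b" if b: "b \<in> ?B" for b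
  proof -
    obtain t where t: "t > 0" "v + t *\<^sub>R b \<in> P" using edge_vector_step[OF P b] .
    have "0 \<le> t * (y \<bullet> b)" using facet_forms_nonneg[OF P yc t(2)] tight by (simp add: inner_add_right)
    then show ?thesis using t by (simp add: zero_le_mult_iff)
  qed
  define Z where "Z = {b\<in>?B. y \<bullet> b = 0}"
  \<comment> \<open>a point of the facet has no component along an edge leaving the facet\<close>
  have face: "x - v \<in> span Z" if x: "x \<in> P" "y \<bullet> x + c = 0" for x
  proof -
    obtain e where e: "\<And>b. 0 \<le> e b" "x = v + (\<Sum>b\<in>?B. e b *\<^sub>R b)"
      by (rule smooth_vertex_cone[OF P v x(1)]) blast
    have "(\<Sum>b\<in>?B. e b * (y \<bullet> b)) = 0"
      using x(2) tight unfolding e by (simp add: inner_add_right inner_sum_right)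
    then have z: "\<forall>b\<in>?B. e b * (y \<bullet> b) = 0"
      using e yB lattice_basis_finite[OF B] by (subst (asm) sum_nonneg_eq_0_iff) auto
    have "x - v = (\<Sum>b\<in>?B. e b *\<^sub>R b)" using e by simp
    also have "\<dots> \<in> span Z"
    proof (rule span_sum)
      fix b assume b: "b \<in> ?B"
      show "e b *\<^sub>R b \<in> span Z"
      proof (cases "y \<bullet> b = 0")
        case True
        then show ?thesis using b by (auto simp: Z_def intro: span_scale span_base)
      next
        case False
        then have "e b = 0" using z b by auto
        then show ?thesis by (simp add: span_zero)
      qed
    qed
    finally show ?thesis .
  qed
  have "?D - {b0} \<subseteq> span Z"
  proof
    fix b' assume b': "b' \<in> ?D - {b0}"
    then obtain t where t: "t > 0" "w + t *\<^sub>R b' \<in> P" using edge_vector_step[OF P] by blast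
    have "y \<bullet> b' = 0" using b' w by (auto simp: dual_vector_def)
    then have "w + t *\<^sub>R b' - v \<in> span Z" "w - v \<in> span Z"
      using face[OF t(2)] face[OF wP] w by (auto simp: inner_add_right)
    then have "(w + t *\<^sub>R b' - v) - (w - v) \<in> span Z" by (rule span_diff)
    then have "t *\<^sub>R b' \<in> span Z" by simp
    then have "(1/t) *\<^sub>R (t *\<^sub>R b') \<in> span Z" by (rule span_scale)
    moreover have "(1/t) *\<^sub>R (t *\<^sub>R b') = b'" using t by simp
    ultimately show "b' \<in> span Z" by metis
  qed
  moreover have "independent (?D - {b0})" using D independent_mono[of ?D "?D - {b0}"] unfolding lattice_basis_def by blast
  moreover have finZ: "finite Z" using lattice_basis_finite[OF B] by (simp add: Z_def)
  ultimately have "card (?D - {b0}) \<le> card Z" using independent_span_bound by blast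
  moreover have "card (?D - {b0}) = CARD('a) - 1" using w(2) lattice_basis_card[OF D] by simp
  moreover have "card (?B - Z) = CARD('a) - card Z"
    using lattice_basis_card[OF B] finZ by (subst card_Diff_subset) (auto simp: Z_def)
  ultimately have "card (?B - Z) \<le> 1" by simp
  moreover have "?B - Z \<noteq> {}"
  proof
    assume "?B - Z = {}"
    then have "y = 0" by (intro inner_lattice_basis_eq[OF B]) (auto simp: Z_def)
    then show False using w by (auto simp: dual_vector_def)
  qed
  ultimately have "card (?B - Z) = 1" using lattice_basis_finite[OF B] by (metis card_0_eq finite_Diff le_antisym less_one not_le)
  then obtain b where b: "?B - Z = {b}" using card_1_singletonE by blast
  then have bB: "b \<in> ?B" by blast
  have "y \<bullet> b = 1"
  proof -
    obtain e where e: "b0 = (\<Sum>b\<in>?B. of_int (e b) *\<^sub>R b)"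
      using lattice_basis_expansion[OF B] lattice_basis_subset[OF D] w by blast
    have "1 = y \<bullet> b0" using w by (simp add: dual_vector_def)
    also have "\<dots> = (\<Sum>b'\<in>?B. of_int (e b') * (y \<bullet> b'))" unfolding e by (simp add: inner_sum_right)
    also have "\<dots> = (\<Sum>b'\<in>{b}. of_int (e b') * (y \<bullet> b'))"
      using b lattice_basis_finite[OF B] by (intro sum.mono_neutral_right) (auto simp: Z_def)
    finally have 1: "1 = of_int (e b) * (y \<bullet> b)" by simp
    have "y \<bullet> b \<in> \<int>" using inner_lattice_points dual_vector_lattice[OF D w(3)] lattice_basis_subset[OF B] bB by blast
    then obtain k where k: "y \<bullet> b = of_int k" by (auto elim: Ints_cases)
    then have "e b * k = 1" using 1 by (metis of_int_eq_1_iff of_int_mult)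
    then have "k = 1" using yB[OF bB] k by (auto simp: zmult_eq_1_iff)
    then show ?thesis using k by simp
  qed
  then have "dual_vector ?B b y" using b by (auto simp: dual_vector_def Z_def)
  then show ?thesis using that bB by blast
qed

text \<open>Simplicity of a smooth polytope: each vertex lies on exactly as many facets as it has
  edges.\<close>

lemma tight_facet_forms_bij:
  fixes P :: "(real^'n) set"
  assumes P: "smooth_polytope P" and v: "v extreme_point_of P"
  obtains \<eta> where "\<And>b. b \<in> primitive_edge_vectors P v \<Longrightarrow> dual_vector (primitive_edge_vectors P v) b (\<eta> b)"
    "bij_betw (\<lambda>b. (\<eta> b, - (\<eta> b \<bullet> v))) (primitive_edge_vectors P v)
        {(y, c) \<in> facet_forms P. y \<bullet> v + c = 0}"
proof -
  let ?B = "primitive_edge_vectors P v"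
  have B: "lattice_basis ?B" using smooth_polytopeD(2)[OF P v] .
  have "\<exists>y. dual_vector ?B b y" for b using dual_vector_exists[OF B] by blast
  then obtain \<eta> where \<eta>: "\<And>b. dual_vector ?B b (\<eta> b)" by metis
  have "bij_betw (\<lambda>b. (\<eta> b, - (\<eta> b \<bullet> v))) ?B {(y, c) \<in> facet_forms P. y \<bullet> v + c = 0}"
    unfolding bij_betw_def
  proof (intro conjI inj_onI equalityI subsetI)
    fix b b' assume "b \<in> ?B" "b' \<in> ?B" "(\<eta> b, - (\<eta> b \<bullet> v)) = (\<eta> b', - (\<eta> b' \<bullet> v))"
    then show "b = b'" using \<eta>[of b] \<eta>[of b'] unfolding dual_vector_def by (metis Pair_inject zero_neq_one)
  next
    fix p assume "p \<in> (\<lambda>b. (\<eta> b, - (\<eta> b \<bullet> v))) ` ?B"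
    then show "p \<in> {(y, c) \<in> facet_forms P. y \<bullet> v + c = 0}"
      using \<eta> v unfolding facet_forms_def by auto
  next
    fix p assume "p \<in> {(y, c) \<in> facet_forms P. y \<bullet> v + c = 0}"
    then obtain y c where p: "p = (y, c)" "(y, c) \<in> facet_forms P" "y \<bullet> v + c = 0" by auto
    obtain b where b: "b \<in> ?B" "dual_vector ?B b y" using tight_facet_form_dual[OF P p(2) v p(3)] .
    then have "y = \<eta> b" using \<eta> dual_vector_unique[OF B] by blast
    then show "p \<in> (\<lambda>b. (\<eta> b, - (\<eta> b \<bullet> v))) ` ?B" using b p by auto
  qed
  then show ?thesis using that \<eta> by blast
qed

lemma card_tight_facet_forms:
  fixes P :: "(real^'n) set"
  assumes P: "smooth_polytope P" and v: "v extreme_point_of P"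
  shows "card {(y, c) \<in> facet_forms P. y \<bullet> v + c = 0} = CARD('n)"
proof -
  obtain \<eta> where "bij_betw (\<lambda>b. (\<eta> b, - (\<eta> b \<bullet> v))) (primitive_edge_vectors P v)
        {(y, c) \<in> facet_forms P. y \<bullet> v + c = 0}" by (rule tight_facet_forms_bij[OF P v])
  then have "card (primitive_edge_vectors P v) = card {(y, c) \<in> facet_forms P. y \<bullet> v + c = 0}"
    by (rule bij_betw_same_card)
  then show ?thesis using lattice_basis_card[OF smooth_polytopeD(2)[OF P v]] by simp
qed

section \<open>Normal form at a vertex of small total distance\<close>

text \<open>The total distance from all facets is an affine function, so that some vertex has a value at
  most that of the point \<open>m / r\<close>, which has distance \<open>1 / r\<close> from each facet.\<close>

lemma small_distance_vertex:
  fixes P :: "(real^'n) set"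
  assumes P: "smooth_polytope P" and r: "r > 0"
    and m: "\<And>y c. (y, c) \<in> facet_forms P \<Longrightarrow> y \<bullet> m + real r * c = 1"
  obtains u where "u extreme_point_of P"
    "real r * (\<Sum>(y, c)\<in>facet_forms P. y \<bullet> u + c) \<le> real (card (facet_forms P))"
proof -
  let ?H = "facet_forms P"
  define G where "G x = (\<Sum>(y, c)\<in>?H. y \<bullet> x + c)" for x
  define Y where "Y = (\<Sum>(y, c)\<in>?H. y)"
  define C where "C = (\<Sum>(y, c)\<in>?H. c)"
  have G: "G x = Y \<bullet> x + C" for x
    by (simp add: G_def Y_def C_def sum.distrib inner_sum_left split_def)
  define m0 where "m0 = (1 / real r) *\<^sub>R m"
  have dist: "y \<bullet> m0 + c = 1 / real r" if "(y, c) \<in> ?H" for y c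
    using m[OF that] r by (simp add: m0_def field_simps)
  then have "m0 \<in> P" by (subst smooth_polytope_eq_facet_forms[OF P]) (auto simp: split_def)
  have Gm: "real r * G m0 = real (card ?H)"
  proof -
    have "G m0 = (\<Sum>(y, c)\<in>?H. 1 / real r)" unfolding G_def using dist by (intro sum.cong) auto
    then show ?thesis using r by (simp add: split_def)
  qed
  have "\<exists>u. u extreme_point_of P \<and> G u \<le> G m0"
  proof (rule ccontr)
    assume "\<not> ?thesis"
    then have "{u. u extreme_point_of P} \<subseteq> {x. Y \<bullet> x > G m0 - C}" using G by force
    then have "convex hull {u. u extreme_point_of P} \<subseteq> {x. Y \<bullet> x > G m0 - C}"
      by (rule hull_minimal) (rule convex_halfspace_gt)
    moreover have "P = convex hull {u. u extreme_point_of P}"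
      using Krein_Milman_Minkowski lattice_polytope_compact smooth_polytopeD(1)[OF P] by blast
    ultimately have "Y \<bullet> m0 > G m0 - C" using \<open>m0 \<in> P\<close> by blast
    then show False using G[of m0] by simp
  qed
  then obtain u where u: "u extreme_point_of P" "G u \<le> G m0" by blast
  then have "real r * G u \<le> real r * G m0" by (intro mult_left_mono) auto
  then show ?thesis using that u(1) Gm by (simp add: G_def)
qed

text \<open>The polytope in the coordinates given by the edges at the vertex of the previous lemma. The
pairs in \<open>K\<close> are the facets that miss this vertex, with \<open>C\<close> their distance from it. The equation for
\<open>C\<close> expresses that \<open>(1,...,1)\<close> has distance \<open>1\<close> from all facets of \<open>r Q\<close>; the last three
facts record integrality of the vertices, simplicity and the dual basis property.\<close>

lemma smooth_gorenstein_normal_form: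
  fixes P :: "(real^'n) set"
  assumes P: "smooth_polytope P" and gor: "gorenstein r P"
  obtains Q :: "(real^'n) set" and K where "P \<cong>\<^sub>L Q" "bounded Q" "finite K"
    "Q = {x. (\<forall>i. 0 \<le> x $ i) \<and> (\<forall>(a, C)\<in>K. a \<bullet> x \<le> C)}"
    "\<And>a C. (a, C) \<in> K \<Longrightarrow> a \<in> lattice_points"
    "\<And>a C. (a, C) \<in> K \<Longrightarrow> C \<in> \<int> \<and> 1 \<le> C \<and> real r * C = 1 + (\<Sum>i\<in>UNIV. a $ i)"
    "real r * (\<Sum>(a, C)\<in>K. C) \<le> real (CARD('n) + card K)"
    "\<And>x. x extreme_point_of Q \<Longrightarrow> x \<in> lattice_points"
    "\<And>x. x extreme_point_of Q \<Longrightarrow> card {i. x $ i = 0} + card {(a, C)\<in>K. a \<bullet> x = C} = CARD('n)"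
    "\<And>x a C. x extreme_point_of Q \<Longrightarrow> (a, C) \<in> K \<Longrightarrow> a \<bullet> x = C \<Longrightarrow>
       \<exists>z\<in>lattice_points. a \<bullet> z = 1 \<and> (\<forall>i. x $ i = 0 \<longrightarrow> z $ i = 0)"
proof -
  let ?H = "facet_forms P"
  note finH = finite_facet_forms[OF P]
  have r: "r > 0" using gor by (simp add: gorenstein_def)
  obtain m where mL: "m \<in> lattice_points" and m0: "\<And>y c. facet_form P y c \<Longrightarrow> y \<bullet> m + real r * c = 1"
    using gorenstein_facet_distance[OF gor] by blast
  have m: "y \<bullet> m + real r * c = 1" if "(y, c) \<in> ?H" for y c using m0 facet_forms_facet_form[OF P that] .
  obtain u where u: "u extreme_point_of P" and
    small: "real r * (\<Sum>(y, c)\<in>?H. y \<bullet> u + c) \<le> real (card ?H)"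
    using small_distance_vertex[OF P r m] by blast
  let ?B = "primitive_edge_vectors P u"
  have B: "lattice_basis ?B" using smooth_polytopeD(2)[OF P u] .
  note finB = lattice_basis_finite[OF B]
  have uL: "u \<in> lattice_points" using lattice_polytope_extreme_point smooth_polytopeD(1)[OF P] u by blast
  have uP: "u \<in> P" using u by (simp add: extreme_point_of_def)
  obtain \<eta>0 where \<eta>0: "\<And>b. b \<in> ?B \<Longrightarrow> dual_vector ?B b (\<eta>0 b)"
    and tight0: "bij_betw (\<lambda>b. (\<eta>0 b, - (\<eta>0 b \<bullet> u))) ?B {(y, c) \<in> ?H. y \<bullet> u + c = 0}"
    using tight_facet_forms_bij[OF P u] by blast
  obtain \<beta> where \<beta>: "bij_betw \<beta> (UNIV :: 'n set) ?B"
    using finite_same_card_bij[of "UNIV :: 'n set" ?B] finB lattice_basis_card[OF B] by auto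
  have \<beta>B: "\<beta> i \<in> ?B" for i using \<beta> bij_betwE by blast
  define \<eta> where "\<eta> i = \<eta>0 (\<beta> i)" for i
  have \<eta>\<beta>: "\<eta> i \<bullet> \<beta> j = (if i = j then 1 else 0)" for i j
  proof -
    have "\<eta> i \<bullet> \<beta> j = (if \<beta> j = \<beta> i then 1 else 0)"
      unfolding \<eta>_def using \<eta>0[OF \<beta>B[of i]] \<beta>B[of j] by (simp add: dual_vector_def)
    then show ?thesis using \<beta> by (simp add: bij_betw_def inj_eq)
  qed
  have \<eta>L: "\<eta> i \<in> lattice_points" for i unfolding \<eta>_def using dual_vector_lattice[OF B \<eta>0[OF \<beta>B]] .
  have \<beta>L: "\<beta> i \<in> lattice_points" for i using \<beta>B lattice_basis_subset[OF B] by blast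
  define Z where "Z = {(y, c) \<in> ?H. y \<bullet> u + c = 0}"
  have tight: "bij_betw (\<lambda>i. (\<eta> i, - (\<eta> i \<bullet> u))) UNIV Z"
    using bij_betw_trans[OF \<beta> tight0] unfolding Z_def \<eta>_def by (simp add: comp_def)
  have ZH: "Z \<subseteq> ?H" by (auto simp: Z_def)
  have \<eta>H: "(\<eta> i, - (\<eta> i \<bullet> u)) \<in> Z" for i using tight bij_betwE by blast
  define s where "s z = (\<Sum>i\<in>UNIV. z $ i *\<^sub>R \<beta> i)" for z :: "real^'n"
  define t where "t x = (\<chi> i. \<eta> i \<bullet> x)" for x :: "real^'n"
  have lin_s: "linear s" unfolding s_def
    by (intro linearI) (simp_all add: sum.distrib scaleR_add_left scaleR_sum_right)
  have lin_t: "linear t" unfolding t_def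
    by (intro linearI) (simp_all add: vec_eq_iff inner_add_right)
  have ts: "t (s z) = z" for z
  proof -
    have "\<eta> i \<bullet> s z = z $ i" for i
    proof -
      have "\<eta> i \<bullet> s z = (\<Sum>j\<in>UNIV. z $ j * (if i = j then 1 else 0))"
        unfolding s_def by (simp add: inner_sum_right \<eta>\<beta>)
      then show ?thesis by (simp add: if_distrib[of "\<lambda>t. _ * t"] cong: if_cong)
    qed
    then show ?thesis by (simp add: t_def vec_eq_iff)
  qed
  have "inj s" using ts by (metis injI)
  then have "surj s" using linear_injective_imp_surjective[OF lin_s] by blast
  then have st: "s (t x) = x" for x by (metis ts surjD)
  have sL: "s z \<in> lattice_points" if "z \<in> lattice_points" for z
    using that \<beta>L unfolding s_def lattice_points_vec_iff by (auto intro!: Ints_sum Ints_mult)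
  have tL: "t x \<in> lattice_points" if "x \<in> lattice_points" for x
    using that \<eta>L unfolding t_def by (auto simp: lattice_points_vec_iff intro!: inner_lattice_points)
  define Q where "Q = (\<lambda>x. t x + (- t u)) ` P"
  have "P \<cong>\<^sub>L Q"
  proof (rule lattice_isomorphic_chart(1)[OF lin_t lin_s _ _ _ Q_def])
    show "s (t x + - t u) + u = x" for x using lin_s st by (simp add: linear_diff)
    show "affine hull P = UNIV" using smooth_polytopeD(3)[OF P] .
    fix x
    have "t x \<in> lattice_points \<longleftrightarrow> x \<in> lattice_points" using sL tL st by metis
    moreover have "t x + - t u \<in> lattice_points \<longleftrightarrow> t x \<in> lattice_points"
      using lattice_points_diff[OF _ tL[OF uL]] lattice_points_add[OF _ tL[OF uL]]
      by (metis add_uminus_conv_diff diff_add_cancel)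
    ultimately show "t x + - t u \<in> lattice_points \<longleftrightarrow> x \<in> lattice_points" by simp
  qed
  have QP: "z \<in> Q \<longleftrightarrow> s z + u \<in> P" for z
  proof
    assume "z \<in> Q"
    then show "s z + u \<in> P" unfolding Q_def using lin_s st by (auto simp: linear_diff)
  next
    assume "s z + u \<in> P"
    moreover have "z = t (s z + u) + - t u" using lin_t ts by (simp add: linear_add)
    ultimately show "z \<in> Q" unfolding Q_def by blast
  qed
  define K0 where "K0 = ?H - Z"
  define k where "k = (\<lambda>(y, c). ((\<chi> i. - (y \<bullet> \<beta> i)), y \<bullet> u + c))"
  define K where "K = k ` K0"
  have val: "y \<bullet> (s z + u) + c = snd (k (y, c)) - fst (k (y, c)) \<bullet> z" for y c z
  proof -
    have "fst (k (y, c)) \<bullet> z = - (y \<bullet> s z)"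
      unfolding k_def s_def by (simp add: inner_vec_def[of _ z] inner_sum_right sum_negf mult.commute)
    then show ?thesis by (simp add: k_def inner_add_right)
  qed
  have inj_k: "inj k"
  proof (rule injI)
    fix p q :: "(real^'n) \<times> real" assume eq: "k p = k q"
    obtain y c y' c' where pq: "p = (y, c)" "q = (y', c')" by fastforce
    have "y = y'"
    proof (rule inner_lattice_basis_eq[OF B])
      fix b assume "b \<in> ?B"
      then obtain i where "b = \<beta> i" using \<beta> by (auto simp: bij_betw_def)
      moreover have "fst (k p) $ i = fst (k q) $ i" using eq by simp
      ultimately show "y \<bullet> b = y' \<bullet> b" by (simp add: k_def pq)
    qed
    then show "p = q" using eq by (simp add: k_def pq)
  qed
  have \<eta>val: "\<eta> i \<bullet> (s z + u) + - (\<eta> i \<bullet> u) = z $ i" for i z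
  proof -
    have "t (s z) $ i = z $ i" using ts by simp
    then show ?thesis by (simp add: t_def inner_add_right)
  qed
  have split_H: "(\<forall>(y, c)\<in>?H. R y c) \<longleftrightarrow> (\<forall>i. R (\<eta> i) (- (\<eta> i \<bullet> u))) \<and> (\<forall>(y, c)\<in>K0. R y c)" for R
  proof -
    have "?H = (\<lambda>i. (\<eta> i, - (\<eta> i \<bullet> u))) ` UNIV \<union> K0" using tight ZH by (auto simp: K0_def bij_betw_def)
    then show ?thesis by auto
  qed
  have Qeq: "Q = {x. (\<forall>i. 0 \<le> x $ i) \<and> (\<forall>(a, C)\<in>K. a \<bullet> x \<le> C)}"
  proof (rule set_eqI)
    fix z
    have "z \<in> Q \<longleftrightarrow> (\<forall>(y, c)\<in>?H. 0 \<le> y \<bullet> (s z + u) + c)"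
      unfolding QP by (subst smooth_polytope_eq_facet_forms[OF P]) simp
    also have "\<dots> \<longleftrightarrow> (\<forall>i. 0 \<le> z $ i) \<and> (\<forall>(y, c)\<in>K0. 0 \<le> y \<bullet> (s z + u) + c)"
      unfolding split_H \<eta>val ..
    also have "(\<forall>(y, c)\<in>K0. 0 \<le> y \<bullet> (s z + u) + c) \<longleftrightarrow> (\<forall>(a, C)\<in>K. a \<bullet> z \<le> C)"
      unfolding K_def by (auto simp: val split_def)
    finally show "z \<in> Q \<longleftrightarrow> z \<in> {x. (\<forall>i. 0 \<le> x $ i) \<and> (\<forall>(a, C)\<in>K. a \<bullet> x \<le> C)}" by simp
  qed
  have cardH: "card ?H = CARD('n) + card K"
  proof -
    have "card Z = CARD('n)" using bij_betw_same_card[OF tight] by simp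
    moreover have "card K = card K0" unfolding K_def using inj_k by (meson card_image inj_on_subset subset_UNIV)
    moreover have "card ?H = card Z + card K0"
      unfolding K0_def using ZH finH by (metis card_Diff_subset card_mono finite_subset le_add_diff_inverse)
    ultimately show ?thesis by simp
  qed
  have finK: "finite K" unfolding K_def K0_def using finH by simp
  \<comment> \<open>the facets through the chosen vertex contribute nothing to its total distance\<close>
  have sumK: "(\<Sum>(a, C)\<in>K. C) = (\<Sum>(y, c)\<in>?H. y \<bullet> u + c)"
  proof -
    have "(\<Sum>(a, C)\<in>K. C) = (\<Sum>p\<in>K0. snd (k p))"
      unfolding K_def using inj_k by (subst sum.reindex) (auto simp: split_def intro: inj_on_subset)
    also have "\<dots> = (\<Sum>(y, c)\<in>K0. y \<bullet> u + c)" by (auto simp: k_def intro!: sum.cong)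
    also have "\<dots> = (\<Sum>(y, c)\<in>?H. y \<bullet> u + c)"
      using finH by (intro sum.mono_neutral_left) (auto simp: K0_def Z_def)
    finally show ?thesis .
  qed
  have KL: "a \<in> lattice_points" "C \<in> \<int> \<and> 1 \<le> C \<and> real r * C = 1 + (\<Sum>i\<in>UNIV. a $ i)"
    if aC: "(a, C) \<in> K" for a C
  proof -
    obtain y c where yc: "(y, c) \<in> K0" "(a, C) = k (y, c)" using aC by (auto simp: K_def)
    then have yH: "(y, c) \<in> ?H" by (simp add: K0_def)
    have ff: "facet_form P y c" using facet_forms_facet_form[OF P yH] .
    then have yL: "y \<in> lattice_points" by (simp add: facet_form_def)
    have a: "a $ i = - (y \<bullet> \<beta> i)" for i using yc by (simp add: k_def)
    have C: "C = y \<bullet> u + c" using yc by (simp add: k_def)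
    show "a \<in> lattice_points"
      using inner_lattice_points[OF yL \<beta>L] by (auto simp: lattice_points_vec_iff a)
    obtain x0 where x0: "x0 \<in> lattice_points" "y \<bullet> x0 + c = 0" using ff by (auto simp: facet_form_def)
    then have "C = y \<bullet> u - y \<bullet> x0" using C by simp
    then have CZ: "C \<in> \<int>" using inner_lattice_points[OF yL] uL x0(1) by auto
    have "C \<noteq> 0" using yc C by (auto simp: K0_def Z_def)
    moreover have "0 \<le> C" using facet_forms_nonneg[OF P yH uP] C by simp
    ultimately have "1 \<le> C" using CZ Ints_nonzero_abs_ge1[of C] by simp
    moreover have "real r * C = 1 + (\<Sum>i\<in>UNIV. a $ i)"
    proof -
      \<comment> \<open>in the new coordinates the interior lattice point of the \<open>r\<close>-th dilate is \<open>(1,...,1)\<close>\<close>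
      have "\<eta> i \<bullet> (m - real r *\<^sub>R u) = 1" for i
        using m[of "\<eta> i" "- (\<eta> i \<bullet> u)"] \<eta>H[of i] ZH by (auto simp: inner_diff_right)
      then have "t (m - real r *\<^sub>R u) = (\<chi> i. 1)" by (simp add: t_def)
      then have "m - real r *\<^sub>R u = (\<Sum>i\<in>UNIV. \<beta> i)" using st[of "m - real r *\<^sub>R u"] by (simp add: s_def)
      then have "y \<bullet> (m - real r *\<^sub>R u) = - (\<Sum>i\<in>UNIV. a $ i)" by (simp add: inner_sum_right a sum_negf)
      then show ?thesis using m[OF yH] unfolding C by (simp add: inner_diff_right algebra_simps)
    qed
    ultimately show "C \<in> \<int> \<and> 1 \<le> C \<and> real r * C = 1 + (\<Sum>i\<in>UNIV. a $ i)" using CZ by blast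
  qed
  have ext: "s z + u extreme_point_of P" if z: "z extreme_point_of Q" for z
    unfolding extreme_point_of_def
  proof (intro conjI ballI notI)
    show "s z + u \<in> P" using z QP by (simp add: extreme_point_of_def)
    fix a b assume ab: "a \<in> P" "b \<in> P" "s z + u \<in> open_segment a b"
    then obtain e where e: "a \<noteq> b" "0 < e" "e < 1" "s z + u = (1 - e) *\<^sub>R a + e *\<^sub>R b" by (auto simp: in_segment)
    define a' b' where "a' = t (a - u)" and "b' = t (b - u)"
    have sa: "s a' + u = a" "s b' + u = b" using st by (simp_all add: a'_def b'_def)
    then have "a' \<in> Q" "b' \<in> Q" "a' \<noteq> b'" using QP ab e by auto
    moreover have "s z = s ((1 - e) *\<^sub>R a' + e *\<^sub>R b')"
    proof -
      have "s z = (1 - e) *\<^sub>R (s a' + u) + e *\<^sub>R (s b' + u) - u" using e(4) unfolding sa by (metis add_diff_cancel_right')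
      then show ?thesis using lin_s by (simp add: linear_add linear_diff linear_scale algebra_simps)
    qed
    then have "z = (1 - e) *\<^sub>R a' + e *\<^sub>R b'" using ts by metis
    ultimately have "z \<in> open_segment a' b'" using e by (auto simp: in_segment)
    then show False using z \<open>a' \<in> Q\<close> \<open>b' \<in> Q\<close> by (auto simp: extreme_point_of_def)
  qed
  have extL: "z \<in> lattice_points" if z: "z extreme_point_of Q" for z
  proof -
    have "s z + u \<in> lattice_points"
      using lattice_polytope_extreme_point[OF smooth_polytopeD(1)[OF P] ext[OF z]] .
    then have "s z \<in> lattice_points" using lattice_points_diff[OF _ uL] by fastforce
    then show ?thesis using tL[of "s z"] ts by simp
  qed
  have simple: "card {i. z $ i = 0} + card {(a, C)\<in>K. a \<bullet> z = C} = CARD('n)"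
    if z: "z extreme_point_of Q" for z
  proof -
    let ?v = "s z + u"
    let ?T = "{(y, c) \<in> ?H. y \<bullet> ?v + c = 0}"
    have "card ?T = CARD('n)" using card_tight_facet_forms[OF P ext[OF z]] .
    moreover have "?T = (\<lambda>i. (\<eta> i, - (\<eta> i \<bullet> u))) ` {i. z $ i = 0} \<union> {(y, c) \<in> K0. y \<bullet> ?v + c = 0}" (is "_ = ?T1 \<union> ?T2")
    proof (intro equalityI subsetI)
      fix p assume p: "p \<in> ?T"
      then obtain y c where yc: "p = (y, c)" "(y, c) \<in> ?H" "y \<bullet> ?v + c = 0" by auto
      show "p \<in> ?T1 \<union> ?T2"
      proof (cases "p \<in> Z")
        case True
        then obtain i where "p = (\<eta> i, - (\<eta> i \<bullet> u))" using tight by (auto simp: bij_betw_def)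
        then show ?thesis using yc \<eta>val[of i z] by auto
      next
        case False
        then show ?thesis using yc by (auto simp: K0_def)
      qed
    next
      fix p assume "p \<in> ?T1 \<union> ?T2"
      then show "p \<in> ?T" using \<eta>val[of _ z] \<eta>H ZH by (auto simp: K0_def)
    qed
    moreover have "?T1 \<inter> ?T2 = {}" using \<eta>H by (auto simp: K0_def)
    moreover have "finite ?T1" by simp
    moreover have "finite ?T2" by (rule finite_subset[OF _ finH]) (auto simp: K0_def)
    ultimately have "card ?T1 + card ?T2 = CARD('n)" using card_Un_disjoint[of ?T1 ?T2] by simp
    moreover have cT1: "card ?T1 = card {i. z $ i = 0}"
      using tight by (intro card_image) (blast intro: inj_on_subset dest: bij_betw_imp_inj_on)
    have iff: "y \<bullet> ?v + c = 0 \<longleftrightarrow> fst (k (y, c)) \<bullet> z = snd (k (y, c))" for y c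
      unfolding val by auto
    have "{(a, C)\<in>K. a \<bullet> z = C} = k ` ?T2"
    proof -
      have "{(a, C)\<in>K. a \<bullet> z = C} = {q \<in> K. fst q \<bullet> z = snd q}" by auto
      also have "\<dots> = {q \<in> k ` K0. fst q \<bullet> z = snd q}" unfolding K_def ..
      also have "\<dots> = k ` {p \<in> K0. fst (k p) \<bullet> z = snd (k p)}" by blast
      also have "{p \<in> K0. fst (k p) \<bullet> z = snd (k p)} = ?T2" using iff by fast
      finally show ?thesis .
    qed
    then have cK: "card {(a, C)\<in>K. a \<bullet> z = C} = card ?T2"
      using card_image[OF inj_on_subset[OF inj_k subset_UNIV], of ?T2] by simp
    ultimately show ?thesis unfolding cK cT1 by simp
  qed
  have dualz: "\<exists>w\<in>lattice_points. a \<bullet> w = 1 \<and> (\<forall>i. z $ i = 0 \<longrightarrow> w $ i = 0)"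
    if z: "z extreme_point_of Q" and aC: "(a, C) \<in> K" and tz: "a \<bullet> z = C" for z a C
  proof -
    let ?v = "s z + u"
    let ?D = "primitive_edge_vectors P ?v"
    note v = ext[OF z]
    have D: "lattice_basis ?D" using smooth_polytopeD(2)[OF P v] .
    obtain y c where yc: "(y, c) \<in> K0" "(a, C) = k (y, c)" using aC by (auto simp: K_def)
    then have yH: "(y, c) \<in> ?H" by (simp add: K0_def)
    have aC': "a = fst (k (y, c))" "C = snd (k (y, c))" using yc(2) by (metis fst_conv, metis snd_conv)
    have ty: "y \<bullet> ?v + c = 0" unfolding val using tz aC' by simp
    obtain b where b: "b \<in> ?D" "dual_vector ?D b y" using tight_facet_form_dual[OF P yH v ty] .
    define w where "w = - t b"
    have bL: "b \<in> lattice_points" using lattice_basis_subset[OF D] b(1) by blast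
    have "w \<in> lattice_points" using tL[OF bL] by (simp add: w_def lattice_points_vec_iff)
    moreover have "a \<bullet> w = 1"
    proof -
      have "y \<bullet> (s (t b) + u) + c = C - a \<bullet> t b" unfolding val aC' ..
      then have "y \<bullet> b + C = C - a \<bullet> t b" using aC'(2) st by (simp add: k_def inner_add_right)
      moreover have "y \<bullet> b = 1" using b by (simp add: dual_vector_def)
      ultimately show ?thesis by (simp add: w_def inner_minus_right)
    qed
    moreover have "w $ i = 0" if zi: "z $ i = 0" for i
    proof -
      let ?c = "- (\<eta> i \<bullet> u)"
      have iH: "(\<eta> i, ?c) \<in> ?H" using \<eta>H ZH by blast
      have ti: "\<eta> i \<bullet> ?v + ?c = 0" using \<eta>val[of i z] zi by simp
      obtain b2 where b2: "b2 \<in> ?D" "dual_vector ?D b2 (\<eta> i)" using tight_facet_form_dual[OF P iH v ti] .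
      have "b2 \<noteq> b"
      proof
        assume "b2 = b"
        then have "\<eta> i = y" using dual_vector_unique[OF D] b b2 by blast
        then have "(y, c) = (\<eta> i, ?c)" using ti ty by simp
        then show False using yc \<eta>H[of i] by (simp add: K0_def)
      qed
      then have "\<eta> i \<bullet> b = 0" using b2 b by (simp add: dual_vector_def)
      then show ?thesis by (simp add: w_def t_def)
    qed
    ultimately show ?thesis by blast
  qed
  have bddQ: "bounded Q"
  proof -
    have "compact P" using lattice_polytope_compact smooth_polytopeD(1)[OF P] by blast
    moreover have "continuous_on P (\<lambda>x. t x + - t u)"
      using lin_t by (intro continuous_intros linear_continuous_on) (simp add: linear_conv_bounded_linear)
    ultimately have "compact Q" unfolding Q_def using compact_continuous_image by blast
    then show ?thesis by (rule compact_imp_bounded)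
  qed
  have small': "real r * (\<Sum>(a, C)\<in>K. C) \<le> real (CARD('n) + card K)" using small sumK cardH by simp
  show ?thesis
    by (rule that[of Q K]) (fact \<open>P \<cong>\<^sub>L Q\<close> bddQ finK Qeq KL small' extL simple dualz)+
qed

section \<open>Inequalities for simplices and Cayley polytopes\<close>

abbreviation coord :: "(nat \<Rightarrow>\<^sub>0 real) \<Rightarrow> nat \<Rightarrow> real" where
  "coord \<equiv> Poly_Mapping.lookup"

lemma coord_scaleR: "coord (c *\<^sub>R p) i = c * coord p i"
proof -
  have "finite {j. c *\<^sub>R coord p j \<noteq> 0}"
    by (rule finite_subset[of _ "{j. coord p j \<noteq> 0}"]) auto
  then show ?thesis by (simp add: scaleR_poly_mapping_def)
qed

lemma coord_unit_seq: "coord (unit_seq j) i = (if i = j then 1 else 0)"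
  by (simp add: unit_seq_def lookup_single when_def)

lemmas coord_simps = lookup_add lookup_minus lookup_sum coord_scaleR coord_unit_seq

definition nonneg_below :: "nat \<Rightarrow> (nat \<Rightarrow>\<^sub>0 real) set" where
  "nonneg_below s = {p. (\<forall>i. 0 \<le> coord p i) \<and> (\<forall>i\<ge>s. coord p i = 0)}"

lemma nonneg_below_expansion:
  assumes "p \<in> nonneg_below s"
  shows "p = (\<Sum>i<s. coord p i *\<^sub>R unit_seq i)"
proof (rule poly_mapping_eqI)
  fix k
  have "coord (\<Sum>i<s. coord p i *\<^sub>R unit_seq i) k = (\<Sum>i<s. coord p i * (if k = i then 1 else 0))"
    by (simp add: coord_simps)
  also have "\<dots> = (if k < s then coord p k else 0)"
    by (simp add: if_distrib[of "\<lambda>t. _ * t"] cong: if_cong)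
  finally show "coord p k = coord (\<Sum>i<s. coord p i *\<^sub>R unit_seq i) k"
    using assms by (auto simp: nonneg_below_def)
qed

lemma unit_seq_nonneg_below: "j < s \<Longrightarrow> unit_seq j \<in> nonneg_below s"
  by (auto simp: nonneg_below_def coord_simps)

lemma convex_nonneg_below: "convex (nonneg_below s)"
  unfolding convex_def nonneg_below_def by (auto simp: coord_simps)

lemma dilate_unimodular_simplex_hull:
  "dilate c (unimodular_simplex s) = convex hull (insert 0 ((\<lambda>i. real c *\<^sub>R unit_seq i) ` {..<s}))"
proof -
  have "linear (\<lambda>x::nat \<Rightarrow>\<^sub>0 real. real c *\<^sub>R x)" by (intro linearI) (simp_all add: algebra_simps)
  then show ?thesis unfolding dilate_def unimodular_simplex_def
    by (simp add: convex_hull_linear_image image_image)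
qed

lemma dilate_unimodular_simplex_eq:
  "dilate c (unimodular_simplex s) = {p \<in> nonneg_below s. (\<Sum>i<s. coord p i) \<le> real c}" (is "_ = ?R")
proof
  have "convex {p::nat \<Rightarrow>\<^sub>0 real. (\<Sum>i<s. coord p i) \<le> real c}"
    unfolding convex_def
  proof clarify
    fix x y :: "nat \<Rightarrow>\<^sub>0 real" and u v :: real
    assume *: "(\<Sum>i<s. coord x i) \<le> real c" "(\<Sum>i<s. coord y i) \<le> real c" "0 \<le> u" "0 \<le> v" "u + v = 1"
    have "(\<Sum>i<s. coord (u *\<^sub>R x + v *\<^sub>R y) i) = u * (\<Sum>i<s. coord x i) + v * (\<Sum>i<s. coord y i)"
      by (simp add: coord_simps sum.distrib sum_distrib_left)
    also have "\<dots> \<le> real c" using * by (intro convex_bound_le) auto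
    finally show "(\<Sum>i<s. coord (u *\<^sub>R x + v *\<^sub>R y) i) \<le> real c" .
  qed
  from convex_Int[OF convex_nonneg_below this] have "convex ?R" by (simp add: Int_def)
  moreover have "insert 0 ((\<lambda>i. real c *\<^sub>R unit_seq i) ` {..<s}) \<subseteq> ?R"
    by (auto simp: nonneg_below_def coord_simps sum_distrib_left[symmetric])
  ultimately show "dilate c (unimodular_simplex s) \<subseteq> ?R"
    unfolding dilate_unimodular_simplex_hull by (intro hull_minimal)
next
  show "?R \<subseteq> dilate c (unimodular_simplex s)"
  proof
    fix p assume p: "p \<in> ?R"
    show "p \<in> dilate c (unimodular_simplex s)"
    proof (cases "c = 0")
      case True
      then have "(\<Sum>i<s. coord p i) = 0" using p by (auto simp: nonneg_below_def intro!: antisym sum_nonneg)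
      then have "\<forall>i<s. coord p i = 0" using p by (subst (asm) sum_nonneg_eq_0_iff) (auto simp: nonneg_below_def)
      then have "p = 0" using p by (intro poly_mapping_eqI) (auto simp: nonneg_below_def not_less[symmetric])
      then show ?thesis unfolding dilate_unimodular_simplex_hull by (simp add: hull_inc)
    next
      case False
      define y where "y i = (if i < s then real c *\<^sub>R unit_seq i else 0)" for i
      define a where "a i = (if i < s then coord p i / real c else 1 - (\<Sum>i<s. coord p i) / real c)" for i
      have "(\<Sum>i\<in>{..s}. a i *\<^sub>R y i) \<in> convex hull (insert 0 ((\<lambda>i. real c *\<^sub>R unit_seq i) ` {..<s}))"
      proof (rule convex_sum)
        show "(\<Sum>i\<in>{..s}. a i) = 1"
          by (simp add: a_def lessThan_Suc_atMost[symmetric] sum_divide_distrib)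
        show "0 \<le> a i" if "i \<in> {..s}" for i using p False by (auto simp: a_def nonneg_below_def)
        show "y i \<in> convex hull (insert 0 ((\<lambda>i. real c *\<^sub>R unit_seq i) ` {..<s}))" if "i \<in> {..s}" for i
          by (rule hull_inc) (auto simp: y_def)
      qed (auto simp: convex_convex_hull)
      also have "(\<Sum>i\<in>{..s}. a i *\<^sub>R y i) = (\<Sum>i<s. coord p i *\<^sub>R unit_seq i)"
        using False by (simp add: a_def y_def lessThan_Suc_atMost[symmetric])
      also have "\<dots> = p" using nonneg_below_expansion p by fastforce
      finally show ?thesis unfolding dilate_unimodular_simplex_hull .
    qed
  qed
qed

lemma dilate_one: "dilate (Suc 0) S = S"
  by (simp add: dilate_def)

lemma unimodular_simplex_eq:
  "unimodular_simplex s = {p \<in> nonneg_below s. (\<Sum>i<s. coord p i) \<le> 1}"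
  using dilate_unimodular_simplex_eq[of 1 s] by (simp add: dilate_one)

text \<open>The factors that are not dilated correspond to parts \<open>0\<close>, so that a factor is described
uniformly by its position.\<close>

definition padded :: "nat list \<Rightarrow> nat \<Rightarrow> nat" where
  "padded as j = (if j < length as then as ! j else 0)"

lemma cayley_simplices_hull_Union:
  assumes "length as \<le> r"
  shows "cayley_simplices s r as =
    convex hull (\<Union>j<r. dilate (padded as j + 1) (unimodular_simplex s) \<times> {unit_seq j})"
proof -
  have "(map (\<lambda>a. dilate (a + 1) (unimodular_simplex s)) as @ replicate (r - length as) (unimodular_simplex s)) ! j
      = dilate (padded as j + 1) (unimodular_simplex s)" if "j < r" for j
    using that by (simp add: nth_append padded_def dilate_one)
  moreover have "length (map (\<lambda>a. dilate (a + 1) (unimodular_simplex s)) as @ replicate (r - length as) (unimodular_simplex s)) = r"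
    using assms by simp
  ultimately show ?thesis unfolding cayley_simplices_def cayley_def by simp
qed

lemma convex_hull_UN_hull:
  "convex hull (\<Union>j\<in>J. convex hull (V j)) = convex hull (\<Union>j\<in>J. V j)"
proof
  have "convex hull (V j) \<subseteq> convex hull (\<Union>j\<in>J. V j)" if "j \<in> J" for j
    using that by (intro hull_mono) auto
  then show "convex hull (\<Union>j\<in>J. convex hull (V j)) \<subseteq> convex hull (\<Union>j\<in>J. V j)"
    by (intro hull_minimal convex_convex_hull) auto
  show "convex hull (\<Union>j\<in>J. V j) \<subseteq> convex hull (\<Union>j\<in>J. convex hull (V j))"
    by (intro hull_mono) (auto intro: hull_inc)
qed

text \<open>The pair \<open>(i, j)\<close> indexes the vertex in direction \<open>i\<close> of factor \<open>j\<close>, where \<open>i = s\<close> stands for the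
origin.\<close>

definition cayley_vertex :: "nat \<Rightarrow> (nat \<Rightarrow> nat) \<Rightarrow> nat \<times> nat \<Rightarrow> (nat \<Rightarrow>\<^sub>0 real) \<times> (nat \<Rightarrow>\<^sub>0 real)" where
  "cayley_vertex s w = (\<lambda>(i, j). ((if i < s then real (w j + 1) else 0) *\<^sub>R unit_seq i, unit_seq j))"

lemma cayley_simplices_eq_hull:
  assumes "length as \<le> r"
  shows "cayley_simplices s r as = convex hull (cayley_vertex s (padded as) ` ({..s} \<times> {..<r}))"
proof -
  have "dilate (padded as j + 1) (unimodular_simplex s) \<times> {unit_seq j} =
      convex hull (cayley_vertex s (padded as) ` ({..s} \<times> {j}))" for j
  proof -
    have "cayley_vertex s (padded as) ` ({..s} \<times> {j}) =
        insert 0 ((\<lambda>i. real (padded as j + 1) *\<^sub>R unit_seq i) ` {..<s}) \<times> {unit_seq j}"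
      unfolding lessThan_Suc_atMost[symmetric] lessThan_Suc by (auto simp: cayley_vertex_def image_iff)
    then show ?thesis unfolding dilate_unimodular_simplex_hull
      by (simp only: convex_hull_Times convex_hull_singleton)
  qed
  then have "cayley_simplices s r as = convex hull (\<Union>j<r. cayley_vertex s (padded as) ` ({..s} \<times> {j}))"
    unfolding cayley_simplices_hull_Union[OF assms] by (simp add: convex_hull_UN_hull)
  also have "(\<Union>j<r. cayley_vertex s (padded as) ` ({..s} \<times> {j})) = cayley_vertex s (padded as) ` ({..s} \<times> {..<r})"
    by auto
  finally show ?thesis .
qed

lemma lattice_polytope_cayley_simplices:
  assumes "length as \<le> r" "0 < r"
  shows "lattice_polytope (cayley_simplices s r as)"
  unfolding lattice_polytope_def cayley_simplices_eq_hull[OF assms(1)]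
proof (intro exI conjI)
  show "cayley_vertex s (padded as) ` ({..s} \<times> {..<r}) \<subseteq> lattice_points"
    by (auto simp: cayley_vertex_def lattice_points_pair_iff lattice_points_seq_iff coord_simps)
qed (use assms in auto)

definition cayley_inequalities :: "nat \<Rightarrow> nat \<Rightarrow> (nat \<Rightarrow> nat) \<Rightarrow> ((nat \<Rightarrow>\<^sub>0 real) \<times> (nat \<Rightarrow>\<^sub>0 real)) set" where
  "cayley_inequalities s r w = {(p, q). p \<in> nonneg_below s \<and> q \<in> nonneg_below r \<and>
     (\<Sum>j<r. coord q j) = 1 \<and> (\<Sum>i<s. coord p i) \<le> (\<Sum>j<r. real (w j + 1) * coord q j)}"

lemma convex_cayley_inequalities: "convex (cayley_inequalities s r w)"
  unfolding convex_def
proof clarify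
  fix p q p' q' :: "nat \<Rightarrow>\<^sub>0 real" and u v :: real
  assume *: "(p, q) \<in> cayley_inequalities s r w" "(p', q') \<in> cayley_inequalities s r w"
    "0 \<le> u" "0 \<le> v" "u + v = 1"
  have "u *\<^sub>R p + v *\<^sub>R p' \<in> nonneg_below s" "u *\<^sub>R q + v *\<^sub>R q' \<in> nonneg_below r"
    using * convex_nonneg_below by (auto simp: cayley_inequalities_def convex_def)
  moreover have "(\<Sum>j<r. coord (u *\<^sub>R q + v *\<^sub>R q') j) = u * (\<Sum>j<r. coord q j) + v * (\<Sum>j<r. coord q' j)"
    by (simp add: coord_simps sum.distrib sum_distrib_left)
  moreover have "(\<Sum>i<s. coord (u *\<^sub>R p + v *\<^sub>R p') i) = u * (\<Sum>i<s. coord p i) + v * (\<Sum>i<s. coord p' i)"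
    by (simp add: coord_simps sum.distrib sum_distrib_left)
  moreover have "(\<Sum>j<r. real (w j + 1) * coord (u *\<^sub>R q + v *\<^sub>R q') j)
      = u * (\<Sum>j<r. real (w j + 1) * coord q j) + v * (\<Sum>j<r. real (w j + 1) * coord q' j)"
    by (simp add: coord_simps sum.distrib sum_distrib_left algebra_simps)
  moreover have "u * (\<Sum>i<s. coord p i) + v * (\<Sum>i<s. coord p' i)
      \<le> u * (\<Sum>j<r. real (w j + 1) * coord q j) + v * (\<Sum>j<r. real (w j + 1) * coord q' j)"
    using * by (intro add_mono mult_left_mono) (auto simp: cayley_inequalities_def)
  ultimately show "u *\<^sub>R (p, q) + v *\<^sub>R (p', q') \<in> cayley_inequalities s r w"
    using * by (simp add: cayley_inequalities_def)
qed

text \<open>To see that a point of the inequality description lies in the Cayley polytope, distribute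
  its first component over the factors proportionally to their sizes.\<close>

lemma cayley_simplices_eq_inequalities:
  assumes len: "length as \<le> r"
  shows "cayley_simplices s r as = cayley_inequalities s r (padded as)"
proof
  let ?w = "padded as"
  have "(\<Union>j<r. dilate (?w j + 1) (unimodular_simplex s) \<times> {unit_seq j}) \<subseteq> cayley_inequalities s r ?w"
    unfolding dilate_unimodular_simplex_eq
    by (auto simp: cayley_inequalities_def coord_simps unit_seq_nonneg_below if_distrib[of "\<lambda>t. _ * t"] cong: if_cong)
  then show "cayley_simplices s r as \<subseteq> cayley_inequalities s r ?w"
    unfolding cayley_simplices_hull_Union[OF len] by (intro hull_minimal convex_cayley_inequalities)
next
  let ?w = "padded as"
  show "cayley_inequalities s r ?w \<subseteq> cayley_simplices s r as"
  proof clarify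
    fix p q assume pq: "(p, q) \<in> cayley_inequalities s r ?w"
    define W where "W = (\<Sum>j<r. real (?w j + 1) * coord q j)"
    have q0: "0 \<le> coord q j" for j using pq by (simp add: cayley_inequalities_def nonneg_below_def)
    have q1: "(\<Sum>j<r. coord q j) = 1" using pq by (simp add: cayley_inequalities_def)
    have "(\<Sum>j<r. coord q j) \<le> W" unfolding W_def
      using q0 by (intro sum_mono) (simp add: algebra_simps)
    then have W: "1 \<le> W" using q1 by simp
    define P where "P j = (real (?w j + 1) / W) *\<^sub>R p" for j
    have "(\<Sum>j\<in>{..<r}. coord q j *\<^sub>R (P j, unit_seq j)) \<in> cayley_simplices s r as"
      unfolding cayley_simplices_hull_Union[OF len]
    proof (rule convex_sum)
      fix j assume j: "j \<in> {..<r}"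
      have "P j \<in> dilate (?w j + 1) (unimodular_simplex s)"
        unfolding dilate_unimodular_simplex_eq
      proof (intro CollectI conjI)
        show "P j \<in> nonneg_below s"
          using pq W by (auto simp: P_def cayley_inequalities_def nonneg_below_def coord_simps)
        have "(\<Sum>i<s. coord (P j) i) = (real (?w j + 1) / W) * (\<Sum>i<s. coord p i)"
          by (simp add: P_def coord_simps sum_distrib_left)
        also have "\<dots> \<le> (real (?w j + 1) / W) * W"
          using pq W by (intro mult_left_mono) (auto simp: cayley_inequalities_def W_def)
        finally show "(\<Sum>i<s. coord (P j) i) \<le> real (?w j + 1)" using W by simp
      qed
      then show "(P j, unit_seq j) \<in> convex hull (\<Union>j<r. dilate (?w j + 1) (unimodular_simplex s) \<times> {unit_seq j})"
        using j by (intro hull_inc) blast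
    qed (use q0 q1 in \<open>auto simp: convex_convex_hull\<close>)
    moreover have "(\<Sum>j\<in>{..<r}. coord q j *\<^sub>R (P j, unit_seq j)) = (p, q)"
    proof -
      have "(\<Sum>j<r. coord q j *\<^sub>R P j) = (\<Sum>j<r. real (?w j + 1) * coord q j / W) *\<^sub>R p"
        unfolding P_def scaleR_scaleR scaleR_sum_left by (intro sum.cong) (simp_all add: algebra_simps)
      also have "(\<Sum>j<r. real (?w j + 1) * coord q j / W) = W / W"
        unfolding W_def by (rule sum_divide_distrib[symmetric])
      finally have "(\<Sum>j<r. coord q j *\<^sub>R P j) = p" using W by simp
      moreover have "(\<Sum>j<r. coord q j *\<^sub>R unit_seq j) = q"
        using nonneg_below_expansion[of q r] pq by (simp add: cayley_inequalities_def)
      ultimately show ?thesis by (simp add: sum_prod)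
    qed
    ultimately show "(p, q) \<in> cayley_simplices s r as" by simp
  qed
qed

section \<open>Models in the space of the polytope\<close>

definition simplex_model :: "nat \<Rightarrow> (real^'n) set" where
  "simplex_model c = {x. (\<forall>i. 0 \<le> x $ i) \<and> (\<Sum>i\<in>UNIV. x $ i) \<le> real c}"

text \<open>The coordinates in the complement of \<open>A\<close> select the Cayley factor, those in \<open>A\<close> run through it.
The factor at the origin is the unimodular simplex and the one at \<open>axis j 1\<close> is its dilate by
\<open>\<alpha> j + 1\<close>.\<close>

definition cayley_model :: "'n set \<Rightarrow> ('n \<Rightarrow> nat) \<Rightarrow> (real^'n) set" where
  "cayley_model A \<alpha> = {x. (\<forall>i. 0 \<le> x $ i) \<and> (\<Sum>j\<in>-A. x $ j) \<le> 1 \<and>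
     (\<Sum>i\<in>A. x $ i) \<le> 1 + (\<Sum>j\<in>-A. real (\<alpha> j) * x $ j)}"

lemma affine_hull_UNIV_axes:
  fixes S :: "(real^'n) set"
  assumes "0 \<in> S" "\<And>i. axis i 1 \<in> S"
  shows "affine hull S = UNIV"
proof -
  have "Basis \<subseteq> S" using assms by (auto simp: Basis_vec_def)
  then have "span Basis \<subseteq> span S" by (rule span_mono)
  then have "span S = UNIV" by auto
  moreover have "affine hull S = span S" using assms(1) hull_inc[of 0 S affine] by (intro affine_hull_span_0)
  ultimately show ?thesis by simp
qed

lemma sum_axis: "finite A \<Longrightarrow> (\<Sum>j\<in>A. f j * axis i (1::real) $ j) = (if i \<in> A then f i else 0)"
  by (simp add: axis_def if_distrib[of "\<lambda>t. _ * t"] cong: if_cong)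

lemma sum_axis': "finite A \<Longrightarrow> (\<Sum>j\<in>A. axis i (1::real) $ j) = (if i \<in> A then 1 else 0)"
  using sum_axis[of A "\<lambda>_. 1" i] by simp

lemma axis_nonneg: "0 \<le> axis i (1::real) $ j"
  by (simp add: axis_def)

lemma affine_hull_simplex_model: "0 < c \<Longrightarrow> affine hull (simplex_model c :: (real^'n) set) = UNIV"
  by (rule affine_hull_UNIV_axes) (auto simp: simplex_model_def sum_axis' axis_nonneg)

lemma affine_hull_cayley_model: "affine hull (cayley_model A \<alpha>) = UNIV"
  by (rule affine_hull_UNIV_axes) (auto simp: cayley_model_def sum_axis sum_axis' axis_nonneg)

definition place :: "'n::finite set \<Rightarrow> ('n \<Rightarrow> nat) \<Rightarrow> real^'n \<Rightarrow> (nat \<Rightarrow>\<^sub>0 real)" where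
  "place A \<sigma> x = (\<Sum>i\<in>A. x $ i *\<^sub>R unit_seq (\<sigma> i))"

lemma linear_place: "linear (place A \<sigma>)"
  unfolding place_def by (intro linearI) (simp_all add: sum.distrib scaleR_add_left scaleR_sum_right)

lemma coord_place:
  assumes "bij_betw \<sigma> A S"
  shows "i \<in> A \<Longrightarrow> coord (place A \<sigma> x) (\<sigma> i) = x $ i"
    "k \<notin> S \<Longrightarrow> coord (place A \<sigma> x) k = 0"
proof -
  have c: "coord (place A \<sigma> x) k = (\<Sum>i\<in>A. if k = \<sigma> i then x $ i else 0)" for k
    unfolding place_def by (simp add: coord_simps if_distrib[of "\<lambda>t. _ * t"] cong: if_cong)
  show "coord (place A \<sigma> x) (\<sigma> i) = x $ i" if i: "i \<in> A"
  proof -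
    have "(\<Sum>i'\<in>A. if \<sigma> i = \<sigma> i' then x $ i' else 0) = (\<Sum>i'\<in>A. if i' = i then x $ i' else 0)"
      using assms i by (intro sum.cong) (auto simp: bij_betw_def inj_on_def)
    then show ?thesis unfolding c using i by simp
  qed
  show "coord (place A \<sigma> x) k = 0" if "k \<notin> S"
    unfolding c using assms that by (intro sum.neutral) (auto simp: bij_betw_def)
qed

lemma sum_coord_place:
  assumes "bij_betw \<sigma> A S"
  shows "(\<Sum>k\<in>S. f k * coord (place A \<sigma> x) k) = (\<Sum>i\<in>A. f (\<sigma> i) * x $ i)"
  unfolding sum.reindex_bij_betw[OF assms, symmetric]
  by (intro sum.cong) (simp_all add: coord_place(1)[OF assms])

lemma place_nonneg_iff:
  assumes "bij_betw \<sigma> A S"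
  shows "(\<forall>k. 0 \<le> coord (place A \<sigma> x) k) \<longleftrightarrow> (\<forall>i\<in>A. 0 \<le> x $ i)"
proof
  assume "\<forall>k. 0 \<le> coord (place A \<sigma> x) k"
  then show "\<forall>i\<in>A. 0 \<le> x $ i" using coord_place(1)[OF assms] by metis
next
  assume *: "\<forall>i\<in>A. 0 \<le> x $ i"
  show "\<forall>k. 0 \<le> coord (place A \<sigma> x) k"
  proof
    fix k show "0 \<le> coord (place A \<sigma> x) k"
    proof (cases "k \<in> S")
      case True
      then obtain i where "i \<in> A" "k = \<sigma> i" using assms by (auto simp: bij_betw_def)
      then show ?thesis using coord_place(1)[OF assms] * by simp
    qed (simp add: coord_place(2)[OF assms])
  qed
qed

lemma place_lattice_iff:
  assumes "bij_betw \<sigma> A S"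
  shows "place A \<sigma> x \<in> lattice_points \<longleftrightarrow> (\<forall>i\<in>A. x $ i \<in> \<int>)"
proof
  assume "place A \<sigma> x \<in> lattice_points"
  then show "\<forall>i\<in>A. x $ i \<in> \<int>" using coord_place(1)[OF assms] unfolding lattice_points_seq_iff by metis
next
  assume *: "\<forall>i\<in>A. x $ i \<in> \<int>"
  then show "place A \<sigma> x \<in> lattice_points"
    unfolding lattice_points_seq_iff place_def by (auto simp: coord_simps intro!: Ints_sum)
qed

lemma place_eqI:
  assumes "bij_betw \<sigma> A S" "\<And>k. k \<notin> S \<Longrightarrow> coord p k = 0" "\<And>i. i \<in> A \<Longrightarrow> x $ i = coord p (\<sigma> i)"
  shows "place A \<sigma> x = p"
proof (rule poly_mapping_eqI)
  fix k show "coord (place A \<sigma> x) k = coord p k"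
  proof (cases "k \<in> S")
    case True
    then obtain i where "i \<in> A" "k = \<sigma> i" using assms(1) by (auto simp: bij_betw_def)
    then show ?thesis using coord_place(1)[OF assms(1)] assms(3) by simp
  qed (simp add: coord_place(2)[OF assms(1)] assms(2))
qed

lemma simplex_model_iso:
  fixes \<sigma> :: "'n::finite \<Rightarrow> nat"
  assumes \<sigma>: "bij_betw \<sigma> UNIV {..<d}" and c: "0 < c"
  shows "(simplex_model c :: (real^'n) set) \<cong>\<^sub>L dilate c (unimodular_simplex d)"
    "dilate c (unimodular_simplex d) \<cong>\<^sub>L (simplex_model c :: (real^'n) set)"
proof -
  define g :: "(nat \<Rightarrow>\<^sub>0 real) \<Rightarrow> real^'n" where "g p = (\<chi> i. coord p (\<sigma> i))" for p
  have g: "linear g" unfolding g_def by (intro linearI) (simp_all add: vec_eq_iff coord_simps)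
  have inv: "g (place UNIV \<sigma> x + 0) + 0 = x" for x
    by (simp add: g_def vec_eq_iff coord_place(1)[OF \<sigma>])
  have lat: "place UNIV \<sigma> x + 0 \<in> lattice_points \<longleftrightarrow> x \<in> lattice_points" for x
    by (simp add: place_lattice_iff[OF \<sigma>] lattice_points_vec_iff)
  have sub: "place UNIV \<sigma> x \<in> dilate c (unimodular_simplex d) \<longleftrightarrow> x \<in> simplex_model c" for x
    using place_nonneg_iff[OF \<sigma>, of x] coord_place(2)[OF \<sigma>, of _ x] sum_coord_place[OF \<sigma>, of "\<lambda>_. 1" x]
    by (auto simp: dilate_unimodular_simplex_eq simplex_model_def nonneg_below_def)
  have R: "dilate c (unimodular_simplex d) = (\<lambda>x. place UNIV \<sigma> x + 0) ` simplex_model c"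
  proof (intro equalityI subsetI)
    fix p assume p: "p \<in> dilate c (unimodular_simplex d)"
    have "place UNIV \<sigma> (g p) = p"
      by (rule place_eqI[OF \<sigma>]) (use p in \<open>auto simp: g_def dilate_unimodular_simplex_eq nonneg_below_def\<close>)
    then show "p \<in> (\<lambda>x. place UNIV \<sigma> x + 0) ` simplex_model c"
      using sub[of "g p"] p by (auto intro!: image_eqI[of _ _ "g p"])
  qed (use sub in auto)
  show "(simplex_model c :: (real^'n) set) \<cong>\<^sub>L dilate c (unimodular_simplex d)"
    "dilate c (unimodular_simplex d) \<cong>\<^sub>L (simplex_model c :: (real^'n) set)"
    using lattice_isomorphic_chart[OF linear_place g inv lat affine_hull_simplex_model[OF c] R] by blast+
qed

lemma linear_Pair: "linear f \<Longrightarrow> linear g \<Longrightarrow> linear (\<lambda>x. (f x, g x))"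
  by (intro linearI) (simp_all add: linear_add linear_scale)

lemma linear_collect_pair:
  "linear (\<lambda>pq :: (nat \<Rightarrow>\<^sub>0 real) \<times> (nat \<Rightarrow>\<^sub>0 real).
     (\<chi> i. if i \<in> A then coord (fst pq) (\<sigma> i) else coord (snd pq) (\<tau> i)) :: real^'n)"
  by (intro linearI) (simp_all add: vec_eq_iff coord_simps)

lemma simplex_product_iso:
  fixes A :: "'n::finite set"
  assumes \<sigma>: "bij_betw \<sigma> A {..<s}" and \<tau>: "bij_betw \<tau> (-A) {..<s'}"
  shows "cayley_model A (\<lambda>_. 0) \<cong>\<^sub>L unimodular_simplex s \<times> unimodular_simplex s'"
    "unimodular_simplex s \<times> unimodular_simplex s' \<cong>\<^sub>L cayley_model A (\<lambda>_. 0)"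
proof -
  define f where "f x = (place A \<sigma> x, place (-A) \<tau> x)" for x
  define g :: "(nat \<Rightarrow>\<^sub>0 real) \<times> (nat \<Rightarrow>\<^sub>0 real) \<Rightarrow> real^'n"
    where "g pq = (\<chi> i. if i \<in> A then coord (fst pq) (\<sigma> i) else coord (snd pq) (\<tau> i))" for pq
  have f: "linear f" unfolding f_def by (intro linear_Pair linear_place)
  have g: "linear g" unfolding g_def by (rule linear_collect_pair)
  have inv: "g (f x + 0) + 0 = x" for x
    by (simp add: g_def f_def vec_eq_iff coord_place(1)[OF \<sigma>] coord_place(1)[OF \<tau>])
  have lat: "f x + 0 \<in> lattice_points \<longleftrightarrow> x \<in> lattice_points" for x
    by (auto simp: f_def lattice_points_pair_iff place_lattice_iff[OF \<sigma>] place_lattice_iff[OF \<tau>] lattice_points_vec_iff)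
  have sub: "f x \<in> unimodular_simplex s \<times> unimodular_simplex s' \<longleftrightarrow> x \<in> cayley_model A (\<lambda>_. 0)" for x
    using place_nonneg_iff[OF \<sigma>, of x] coord_place(2)[OF \<sigma>, of _ x] sum_coord_place[OF \<sigma>, of "\<lambda>_. 1" x]
      place_nonneg_iff[OF \<tau>, of x] coord_place(2)[OF \<tau>, of _ x] sum_coord_place[OF \<tau>, of "\<lambda>_. 1" x]
    by (auto simp: f_def unimodular_simplex_eq cayley_model_def nonneg_below_def)
  have R: "unimodular_simplex s \<times> unimodular_simplex s' = (\<lambda>x. f x + 0) ` cayley_model A (\<lambda>_. 0)"
  proof (intro equalityI subsetI)
    fix pq assume pq: "pq \<in> unimodular_simplex s \<times> unimodular_simplex s'"
    have "place A \<sigma> (g pq) = fst pq"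
      by (rule place_eqI[OF \<sigma>]) (use pq in \<open>auto simp: g_def unimodular_simplex_eq nonneg_below_def\<close>)
    moreover have "place (-A) \<tau> (g pq) = snd pq"
      by (rule place_eqI[OF \<tau>]) (use pq in \<open>auto simp: g_def unimodular_simplex_eq nonneg_below_def\<close>)
    ultimately have "f (g pq) = pq" by (simp add: f_def)
    then show "pq \<in> (\<lambda>x. f x + 0) ` cayley_model A (\<lambda>_. 0)"
      using sub[of "g pq"] pq by (auto intro!: image_eqI[of _ _ "g pq"])
  next
    fix pq assume "pq \<in> (\<lambda>x. f x + 0) ` cayley_model A (\<lambda>_. 0)"
    then obtain x where "x \<in> cayley_model A (\<lambda>_. 0)" "pq = f x" by auto
    then show "pq \<in> unimodular_simplex s \<times> unimodular_simplex s'" using sub[of x] by metis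
  qed
  show "cayley_model A (\<lambda>_. 0) \<cong>\<^sub>L unimodular_simplex s \<times> unimodular_simplex s'"
    "unimodular_simplex s \<times> unimodular_simplex s' \<cong>\<^sub>L cayley_model A (\<lambda>_. 0)"
    using lattice_isomorphic_chart[OF f g inv lat affine_hull_cayley_model R] by blast+
qed

text \<open>The Cayley coordinates of the second component sum up to one; the chart omits the
  coordinate of a factor \<open>j0\<close> that is not dilated.\<close>

lemma cayley_model_iso:
  fixes A :: "'n::finite set"
  assumes \<sigma>: "bij_betw \<sigma> A {..<s}" and \<tau>: "bij_betw \<tau> (-A) ({..<r} - {j0})" and j0: "j0 < r"
    and len: "length as \<le> r" and pad0: "padded as j0 = 0" and \<alpha>: "\<And>j. j \<in> -A \<Longrightarrow> \<alpha> j = padded as (\<tau> j)"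
  shows "cayley_model A \<alpha> \<cong>\<^sub>L cayley_simplices s r as" "cayley_simplices s r as \<cong>\<^sub>L cayley_model A \<alpha>"
    "lattice_polytope (cayley_model A \<alpha>)"
proof -
  define q where "q x = place (-A) \<tau> x - (\<Sum>j\<in>-A. x $ j) *\<^sub>R unit_seq j0" for x
  define f where "f x = (place A \<sigma> x, q x)" for x
  define c where "c = (0 :: nat \<Rightarrow>\<^sub>0 real, unit_seq j0)"
  define g :: "(nat \<Rightarrow>\<^sub>0 real) \<times> (nat \<Rightarrow>\<^sub>0 real) \<Rightarrow> real^'n"
    where "g pq = (\<chi> i. if i \<in> A then coord (fst pq) (\<sigma> i) else coord (snd pq) (\<tau> i))" for pq
  have "linear q" unfolding q_def
    using linear_place[of "-A" \<tau>]
    by (intro linearI) (simp_all add: linear_add linear_scale sum.distrib sum_distrib_left[symmetric] algebra_simps)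
  then have f: "linear f" unfolding f_def by (intro linear_Pair linear_place)
  have g: "linear g" unfolding g_def by (rule linear_collect_pair)
  have \<tau>0: "\<tau> j \<noteq> j0" "\<tau> j < r" if "j \<in> -A" for j using bij_betwE[OF \<tau>] that by auto
  let ?q = "\<lambda>x. q x + unit_seq j0"
  have q1: "coord (?q x) (\<tau> j) = x $ j" if "j \<in> -A" for x j
    using coord_place(1)[OF \<tau> that] \<tau>0[OF that] by (simp add: q_def coord_simps)
  have q2: "coord (?q x) j0 = 1 - (\<Sum>j\<in>-A. x $ j)" for x
    using coord_place(2)[OF \<tau>, of j0 x] by (simp add: q_def coord_simps)
  have q3: "coord (?q x) k = 0" if "r \<le> k" for k x
    using coord_place(2)[OF \<tau>, of k x] that j0 by (simp add: q_def coord_simps)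
  have cases_k: "k = j0 \<or> r \<le> k \<or> (\<exists>j\<in>-A. k = \<tau> j)" for k
  proof (cases "k < r \<and> k \<noteq> j0")
    case True
    then have "k \<in> \<tau> ` (-A)" using \<tau> by (simp add: bij_betw_def)
    then show ?thesis by blast
  qed auto
  have qsum: "(\<Sum>j<r. h j * coord p j) = h j0 * coord p j0 + (\<Sum>j\<in>-A. h (\<tau> j) * coord p (\<tau> j))" for h p
    using sum.remove[of "{..<r}" j0 "\<lambda>j. h j * coord p j"] j0
      sum.reindex_bij_betw[OF \<tau>, of "\<lambda>j. h j * coord p j"] by simp
  have inv: "g (f x + c) + 0 = x" for x
    by (simp add: g_def f_def c_def vec_eq_iff coord_place(1)[OF \<sigma>] q1)
  have qL: "?q x \<in> lattice_points \<longleftrightarrow> (\<forall>j\<in>-A. x $ j \<in> \<int>)" for x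
  proof
    assume "?q x \<in> lattice_points"
    then show "\<forall>j\<in>-A. x $ j \<in> \<int>" unfolding lattice_points_seq_iff using q1 by metis
  next
    assume *: "\<forall>j\<in>-A. x $ j \<in> \<int>"
    show "?q x \<in> lattice_points" unfolding lattice_points_seq_iff
    proof
      fix k show "coord (?q x) k \<in> \<int>"
        using cases_k[of k] q1 q2 q3 * by (auto intro!: Ints_diff Ints_sum)
    qed
  qed
  have lat: "f x + c \<in> lattice_points \<longleftrightarrow> x \<in> lattice_points" for x
    using qL[of x] by (auto simp: f_def c_def lattice_points_pair_iff place_lattice_iff[OF \<sigma>] lattice_points_vec_iff)
  have qnn: "?q x \<in> nonneg_below r \<longleftrightarrow> (\<forall>j\<in>-A. 0 \<le> x $ j) \<and> (\<Sum>j\<in>-A. x $ j) \<le> 1" for x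
  proof
    assume "?q x \<in> nonneg_below r"
    then have "\<forall>k. 0 \<le> coord (?q x) k" by (simp add: nonneg_below_def)
    then show "(\<forall>j\<in>-A. 0 \<le> x $ j) \<and> (\<Sum>j\<in>-A. x $ j) \<le> 1" using q1 q2 by (metis diff_ge_0_iff_ge)
  next
    assume *: "(\<forall>j\<in>-A. 0 \<le> x $ j) \<and> (\<Sum>j\<in>-A. x $ j) \<le> 1"
    have "0 \<le> coord (?q x) k" for k using cases_k[of k] q1 q2 q3 * by fastforce
    then show "?q x \<in> nonneg_below r" using q3 by (simp add: nonneg_below_def)
  qed
  have qs: "(\<Sum>j<r. coord (?q x) j) = 1" for x
    using qsum[of "\<lambda>_. 1" "?q x"] q1 q2 by simp
  have qw: "(\<Sum>j<r. real (padded as j + 1) * coord (?q x) j) = 1 + (\<Sum>j\<in>-A. real (\<alpha> j) * x $ j)" for x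
  proof -
    have "(\<Sum>j<r. real (padded as j + 1) * coord (?q x) j)
        = real (padded as j0 + 1) * coord (?q x) j0 + (\<Sum>j\<in>-A. real (padded as (\<tau> j) + 1) * coord (?q x) (\<tau> j))"
      by (rule qsum)
    also have "(\<Sum>j\<in>-A. real (padded as (\<tau> j) + 1) * coord (?q x) (\<tau> j)) = (\<Sum>j\<in>-A. real (\<alpha> j) * x $ j + x $ j)"
      using \<alpha> q1 by (intro sum.cong) (simp_all add: algebra_simps)
    finally show ?thesis unfolding q2 pad0 by (simp add: sum.distrib)
  qed
  have sub: "f x + c \<in> cayley_simplices s r as \<longleftrightarrow> x \<in> cayley_model A \<alpha>" for x
    using place_nonneg_iff[OF \<sigma>, of x] coord_place(2)[OF \<sigma>, of _ x] sum_coord_place[OF \<sigma>, of "\<lambda>_. 1" x]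
      qnn[of x] qs[of x] qw[of x]
    unfolding cayley_simplices_eq_inequalities[OF len]
    by (auto simp: f_def c_def cayley_inequalities_def cayley_model_def nonneg_below_def[of s])
  have R: "cayley_simplices s r as = (\<lambda>x. f x + c) ` cayley_model A \<alpha>"
  proof (intro equalityI subsetI)
    fix z assume z: "z \<in> cayley_simplices s r as"
    obtain p p' where pp: "z = (p, p')" by fastforce
    have z': "p \<in> nonneg_below s" "p' \<in> nonneg_below r" "(\<Sum>j<r. coord p' j) = 1"
      using z unfolding cayley_simplices_eq_inequalities[OF len] pp by (auto simp: cayley_inequalities_def)
    have "place A \<sigma> (g z) = p"
      by (rule place_eqI[OF \<sigma>]) (use z' pp in \<open>auto simp: g_def nonneg_below_def\<close>)
    moreover have "?q (g z) = p'"
    proof (rule poly_mapping_eqI)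
      fix k
      have gj: "g z $ j = coord p' (\<tau> j)" if "j \<in> -A" for j using that pp by (simp add: g_def)
      have "coord p' j0 = 1 - (\<Sum>j\<in>-A. g z $ j)" using qsum[of "\<lambda>_. 1" p'] z'(3) gj by simp
      then show "coord (?q (g z)) k = coord p' k"
        using cases_k[of k] q1 q2 q3 gj z'(2) by (auto simp: nonneg_below_def)
    qed
    ultimately have "f (g z) + c = z" by (simp add: f_def c_def pp)
    then show "z \<in> (\<lambda>x. f x + c) ` cayley_model A \<alpha>"
      using sub[of "g z"] z by (auto intro!: image_eqI[of _ _ "g z"])
  qed (use sub in auto)
  show "cayley_model A \<alpha> \<cong>\<^sub>L cayley_simplices s r as" "cayley_simplices s r as \<cong>\<^sub>L cayley_model A \<alpha>"
    using lattice_isomorphic_chart[OF f g inv lat affine_hull_cayley_model R] by blast+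
  have "cayley_model A \<alpha> = g ` cayley_simplices s r as"
    unfolding R image_image using inv by simp
  moreover have "g z \<in> lattice_points" if "z \<in> lattice_points" for z
    using that by (cases z) (auto simp: g_def lattice_points_pair_iff lattice_points_seq_iff lattice_points_vec_iff)
  ultimately show "lattice_polytope (cayley_model A \<alpha>)"
    using lattice_polytope_linear_image[OF lattice_polytope_cayley_simplices[OF len] g] j0 by simp
qed

section \<open>The Gorenstein index of the models\<close>

lemma inner_axis_left: "axis i (1::real) \<bullet> x = x $ i"
  by (simp add: inner_axis inner_commute)

lemma axis_in_simplex_model: "0 < c \<Longrightarrow> real c *\<^sub>R axis i 1 \<in> (simplex_model c :: (real^'n) set)"
  by (auto simp: simplex_model_def sum_distrib_left[symmetric] sum_axis' axis_nonneg)

lemma zero_in_simplex_model: "0 \<in> simplex_model c"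
  by (simp add: simplex_model_def)

lemma coordinate_facet_form:
  assumes "0 \<in> P" "\<And>x. x \<in> P \<Longrightarrow> 0 \<le> x $ i" "0 < c" "\<And>j. j \<noteq> i \<Longrightarrow> c *\<^sub>R axis j 1 \<in> P"
  shows "facet_form P (axis i 1) 0"
  unfolding facet_form_def
proof (intro conjI ballI allI impI)
  show "axis i 1 \<in> (lattice_points :: (real^'a) set)" by (rule axis_in_lattice_points)
  show "\<exists>z\<in>lattice_points. axis i 1 \<bullet> (z :: real^'a) = 1"
    by (intro bexI[of _ "axis i 1"] axis_in_lattice_points) (simp add: inner_axis_axis)
  show "0 \<le> axis i 1 \<bullet> x + 0" if "x \<in> P" for x using assms(2)[OF that] by (simp add: inner_axis_left)
  show "\<exists>x\<in>P \<inter> lattice_points. axis i 1 \<bullet> x + 0 = 0" using assms(1) zero_in_lattice_points by (intro bexI[of _ 0]) auto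
  fix \<delta> :: "real^'a"
  assume *: "\<forall>x1\<in>P. \<forall>x2\<in>P. axis i 1 \<bullet> x1 + 0 = 0 \<and> axis i 1 \<bullet> x2 + 0 = 0 \<longrightarrow> \<delta> \<bullet> x1 = \<delta> \<bullet> x2"
  have "\<delta> $ j = 0" if "j \<noteq> i" for j
  proof -
    have t1: "axis i 1 \<bullet> (c *\<^sub>R axis j (1::real)) + 0 = 0" using that by (simp add: inner_axis_axis)
    have t2: "axis i 1 \<bullet> (0 :: real^'a) + 0 = 0" by simp
    have "\<delta> \<bullet> (c *\<^sub>R axis j 1) = \<delta> \<bullet> 0"
      using *[rule_format, OF assms(4)[OF that] assms(1) conjI[OF t1 t2]] .
    then show ?thesis using assms(3) by (simp add: inner_axis)
  qed
  then have "\<delta> = (\<delta> $ i) *\<^sub>R axis i 1" by (auto simp: vec_eq_iff axis_def)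
  then show "\<exists>\<tau>. \<delta> = \<tau> *\<^sub>R axis i 1" ..
qed

text \<open>The distances from the coordinate facets determine the interior lattice point \<open>m\<close> to be \<open>(1,...,1)\<close>;
the remaining facet then determines \<open>r\<close>.\<close>

lemma gorenstein_simplex_model_index:
  assumes gor: "gorenstein r (simplex_model c :: (real^'n) set)" and c: "0 < c"
  shows "r * c = CARD('n) + 1"
proof -
  let ?P = "simplex_model c :: (real^'n) set"
  obtain m :: "real^'n" where "m \<in> lattice_points" and m: "\<And>y c'. facet_form ?P y c' \<Longrightarrow> y \<bullet> m + real r * c' = 1"
    using gorenstein_facet_distance[OF gor] by metis
  have "facet_form ?P (axis i 1) 0" for i
  proof (rule coordinate_facet_form[of _ _ "real c"])
    show "0 \<le> x $ i" if "x \<in> ?P" for x using that by (simp add: simplex_model_def)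
    show "real c *\<^sub>R axis j 1 \<in> ?P" for j using axis_in_simplex_model[OF c] .
  qed (use c in \<open>simp_all add: zero_in_simplex_model\<close>)
  from m[OF this] have mi: "m $ i = 1" for i by (simp add: inner_axis_left)
  define y :: "real^'n" where "y = (\<chi> i. -1)"
  have yv: "y \<bullet> x = - (\<Sum>i\<in>UNIV. x $ i)" for x by (simp add: y_def inner_vec_def sum_negf)
  have "facet_form ?P y (real c)"
    unfolding facet_form_def
  proof (intro conjI ballI allI impI)
    show "y \<in> lattice_points" by (simp add: y_def lattice_points_vec_iff)
    show "\<exists>z\<in>lattice_points. y \<bullet> z = 1"
      by (rule bexI[of _ "- axis undefined 1"]) (auto simp: yv sum_negf sum_axis' lattice_points_vec_iff axis_def)
    show "0 \<le> y \<bullet> x + real c" if "x \<in> ?P" for x using that by (simp add: yv simplex_model_def)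
    show "\<exists>x\<in>?P \<inter> lattice_points. y \<bullet> x + real c = 0"
      using axis_in_simplex_model[OF c, of undefined] lattice_points_scaleR[OF _ axis_in_lattice_points, of "real c" undefined]
      by (intro bexI[of _ "real c *\<^sub>R axis undefined 1"]) (auto simp: yv sum_distrib_left[symmetric] sum_axis')
    fix \<delta> :: "real^'n"
    assume *: "\<forall>x1\<in>?P. \<forall>x2\<in>?P. y \<bullet> x1 + real c = 0 \<and> y \<bullet> x2 + real c = 0 \<longrightarrow> \<delta> \<bullet> x1 = \<delta> \<bullet> x2"
    have "\<delta> $ i = \<delta> $ j" for i j
    proof -
      have tight: "y \<bullet> (real c *\<^sub>R axis i 1) + real c = 0" for i by (simp add: yv sum_distrib_left[symmetric] sum_axis')
      have "\<delta> \<bullet> (real c *\<^sub>R axis i 1) = \<delta> \<bullet> (real c *\<^sub>R axis j 1)"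
        using *[rule_format, OF axis_in_simplex_model[OF c] axis_in_simplex_model[OF c] conjI[OF tight tight]] .
      then show ?thesis using c by (simp add: inner_axis)
    qed
    then have "\<delta> = (- (\<delta> $ undefined)) *\<^sub>R y" by (simp add: y_def vec_eq_iff)
    then show "\<exists>\<tau>. \<delta> = \<tau> *\<^sub>R y" ..
  qed
  from m[OF this] have "real r * real c = real CARD('n) + 1" by (simp add: yv mi)
  then show ?thesis by (metis of_nat_1 of_nat_add of_nat_eq_iff of_nat_mult)
qed

lemma gorenstein_cayley_model_index:
  fixes A :: "'n::finite set"
  assumes gor: "gorenstein r (cayley_model A (\<lambda>_. 0))" and A: "A \<noteq> UNIV"
  shows "r = card (-A) + 1"
proof -
  let ?P = "cayley_model A (\<lambda>_. 0)"
  obtain m :: "real^'n" where "m \<in> lattice_points" and m: "\<And>y c. facet_form ?P y c \<Longrightarrow> y \<bullet> m + real r * c = 1"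
    using gorenstein_facet_distance[OF gor] by metis
  have ax: "axis i 1 \<in> ?P" for i by (simp add: cayley_model_def sum_axis' axis_nonneg)
  have "facet_form ?P (axis i 1) 0" for i
  proof (rule coordinate_facet_form[of _ _ 1])
    show "0 \<le> x $ i" if "x \<in> ?P" for x using that by (simp add: cayley_model_def)
    show "1 *\<^sub>R axis j 1 \<in> ?P" for j using ax by simp
  qed (simp_all add: cayley_model_def)
  from m[OF this] have mi: "m $ i = 1" for i by (simp add: inner_axis_left)
  obtain j0 where j0: "j0 \<in> -A" using A by blast
  define y :: "real^'n" where "y = (\<chi> i. if i \<in> A then 0 else -1)"
  have yv: "y \<bullet> x = - (\<Sum>j\<in>-A. x $ j)" for x
  proof -
    have "y \<bullet> x = (\<Sum>j\<in>UNIV. if j \<in> -A then - (x $ j) else 0)" unfolding y_def inner_vec_def by (intro sum.cong) auto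
    also have "\<dots> = (\<Sum>j\<in>-A. - (x $ j))" by (simp only: sum.inter_restrict[symmetric] finite_class.finite_UNIV Int_UNIV_left)
    finally show ?thesis by (simp add: sum_negf)
  qed
  have "facet_form ?P y 1"
    unfolding facet_form_def
  proof (intro conjI ballI allI impI)
    show "y \<in> lattice_points" by (simp add: y_def lattice_points_vec_iff)
    show "\<exists>z\<in>lattice_points. y \<bullet> z = 1" using j0
      by (intro bexI[of _ "- axis j0 1"]) (auto simp: yv sum_negf sum_axis' lattice_points_vec_iff axis_def)
    show "0 \<le> y \<bullet> x + 1" if "x \<in> ?P" for x using that by (simp add: yv cayley_model_def)
    show "\<exists>x\<in>?P \<inter> lattice_points. y \<bullet> x + 1 = 0"
      using ax[of j0] axis_in_lattice_points[of j0] j0 by (intro bexI[of _ "axis j0 1"]) (auto simp: yv sum_axis')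
    fix \<delta> :: "real^'n"
    assume *: "\<forall>x1\<in>?P. \<forall>x2\<in>?P. y \<bullet> x1 + 1 = 0 \<and> y \<bullet> x2 + 1 = 0 \<longrightarrow> \<delta> \<bullet> x1 = \<delta> \<bullet> x2"
    have y1: "y \<bullet> axis j 1 + 1 = 0" if "j \<in> -A" for j using that by (simp add: yv sum_axis')
    have eq: "\<delta> $ j = \<delta> $ j0" if "j \<in> -A" for j
    proof -
      have "\<delta> \<bullet> axis j 1 = \<delta> \<bullet> axis j0 1"
        using *[rule_format, OF ax ax conjI[OF y1[OF that] y1[OF j0]]] .
      then show ?thesis by (simp add: inner_axis)
    qed
    have z: "\<delta> $ i = 0" if i: "i \<in> A" for i
    proof -
      have "axis j0 1 + axis i 1 \<in> ?P" using i j0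
        by (simp add: cayley_model_def sum.distrib sum_axis' axis_nonneg)
      moreover have "y \<bullet> (axis j0 1 + axis i 1) + 1 = 0" using i j0 by (simp add: yv sum.distrib sum_axis')
      ultimately have "\<delta> \<bullet> (axis j0 1 + axis i 1) = \<delta> \<bullet> axis j0 1"
        using *[rule_format, OF _ ax conjI[OF _ y1[OF j0]]] by simp
      then show ?thesis by (simp add: inner_axis inner_add_right)
    qed
    have "\<delta> = (- (\<delta> $ j0)) *\<^sub>R y" using eq z by (simp add: y_def vec_eq_iff)
    then show "\<exists>\<tau>. \<delta> = \<tau> *\<^sub>R y" ..
  qed
  from m[OF this] have "real r = real (card (-A)) + 1" by (simp add: yv mi)
  then show ?thesis by linarith
qed

text \<open>The bipolar theorem for a finite set: a hyperplane separating a point from the convex hull of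
\<open>N\<close> passes on the far side of \<open>0\<close> and can be scaled to a point of the halfspace intersection.\<close>

lemma dual_polytope_halfspaces:
  fixes N :: "(real^'n) set"
  assumes fin: "finite N" and zero: "0 \<in> convex hull N"
  shows "dual_polytope {x. \<forall>n\<in>N. -1 \<le> n \<bullet> x} = convex hull N"
proof
  let ?R = "{x. \<forall>n\<in>N. -1 \<le> n \<bullet> x}"
  have "convex (dual_polytope ?R)"
  proof -
    have "dual_polytope ?R = (\<Inter>x\<in>?R. {y. x \<bullet> y \<ge> -1})" by (auto simp: dual_polytope_def inner_commute)
    then show ?thesis by (auto intro!: convex_INT convex_halfspace_ge)
  qed
  then show "convex hull N \<subseteq> dual_polytope ?R"
    by (intro hull_minimal) (auto simp: dual_polytope_def)
  show "dual_polytope ?R \<subseteq> convex hull N"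
  proof
    fix y assume y: "y \<in> dual_polytope ?R"
    show "y \<in> convex hull N"
    proof (rule ccontr)
      assume "y \<notin> convex hull N"
      then obtain a b where ab: "a \<bullet> y < b" "\<And>x. x \<in> convex hull N \<Longrightarrow> b < a \<bullet> x"
        using separating_hyperplane_closed_point[of "convex hull N" y] fin
        by (auto simp: finite_imp_compact_convex_hull compact_imp_closed)
      have b: "b < 0" using ab(2)[OF zero] by simp
      define x where "x = (1 / (- b)) *\<^sub>R a"
      have "x \<in> ?R"
      proof clarify
        fix n assume "n \<in> N"
        then have "b < a \<bullet> n" using ab(2) hull_inc by metis
        then show "-1 \<le> n \<bullet> x" using b by (simp add: x_def inner_commute field_simps)
      qed
      then have "-1 \<le> y \<bullet> x" using y by (simp add: dual_polytope_def)
      then show False using ab(1) b by (simp add: x_def inner_commute field_simps)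
    qed
  qed
qed

text \<open>The hypotheses on the cardinalities say that \<open>(1,...,1)\<close> has distance \<open>1\<close> from every facet of the
\<open>r\<close>-th dilate. After translating this point to the origin, the dual polytope is the convex hull of the
facet normals \<open>nA\<close>, \<open>nB\<close> and \<open>axis i 1\<close>, which are lattice points.\<close>

lemma gorenstein_cayley_model:
  fixes A :: "'n::finite set"
  assumes lp: "lattice_polytope (cayley_model A \<alpha>)" and r: "0 < r"
    and cA: "card (-A) + 1 = r" and sum\<alpha>: "card A + 1 = r + (\<Sum>j\<in>-A. \<alpha> j)"
  shows "gorenstein r (cayley_model A \<alpha>)"
proof -
  define m :: "real^'n" where "m = (\<chi> i. -1)"
  define nB :: "real^'n" where "nB = (\<chi> i. if i \<in> A then 0 else -1)"
  define nA :: "real^'n" where "nA = (\<chi> i. if i \<in> A then -1 else real (\<alpha> i))"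
  define N where "N = insert nA (insert nB ((\<lambda>i. axis i 1) ` UNIV))"
  define R where "R = (\<lambda>x. x + m) ` dilate r (cayley_model A \<alpha>)"
  have split_sum: "(\<Sum>i\<in>UNIV. h i) = (\<Sum>i\<in>A. h i) + (\<Sum>j\<in>-A. h j)" for h :: "'n \<Rightarrow> real"
    using sum.subset_diff[of A UNIV h] by (simp add: Compl_eq_Diff_UNIV)
  have nB: "nB \<bullet> x = - (\<Sum>j\<in>-A. x $ j)" for x
    unfolding inner_vec_def split_sum by (simp add: nB_def sum_negf)
  have nA: "nA \<bullet> x = (\<Sum>j\<in>-A. real (\<alpha> j) * x $ j) - (\<Sum>i\<in>A. x $ i)" for x
    unfolding inner_vec_def split_sum by (simp add: nA_def sum_negf)
  have m: "m \<in> lattice_points" by (simp add: m_def lattice_points_vec_iff)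
  have R: "R = (\<lambda>x. real r *\<^sub>R x + m) ` cayley_model A \<alpha>" by (simp add: R_def dilate_def image_image)
  have key: "(\<forall>n\<in>N. -1 \<le> n \<bullet> (real r *\<^sub>R x + m)) \<longleftrightarrow> x \<in> cayley_model A \<alpha>" for x
  proof -
    have 1: "-1 \<le> axis i 1 \<bullet> (real r *\<^sub>R x + m) \<longleftrightarrow> 0 \<le> x $ i" for i
      using r by (simp add: inner_axis_left m_def zero_le_mult_iff)
    have sum_shift: "(\<Sum>j\<in>S. (real r *\<^sub>R x + m) $ j) = real r * (\<Sum>j\<in>S. x $ j) - real (card S)" for S
      by (simp add: m_def sum_subtractf sum_distrib_left)
    have "real (card (-A)) = real r - 1" using cA by (metis add_diff_cancel_right' of_nat_1 of_nat_add)
    then have "nB \<bullet> (real r *\<^sub>R x + m) = real r * (1 - (\<Sum>j\<in>-A. x $ j)) - 1"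
      unfolding nB sum_shift by (simp add: algebra_simps)
    then have 2: "-1 \<le> nB \<bullet> (real r *\<^sub>R x + m) \<longleftrightarrow> (\<Sum>j\<in>-A. x $ j) \<le> 1"
      using r by (simp add: zero_le_mult_iff)
    have s: "real (card A) = real r + (\<Sum>j\<in>-A. real (\<alpha> j)) - 1" using sum\<alpha> by (metis add_diff_cancel_right' of_nat_1 of_nat_add of_nat_sum)
    have "nA \<bullet> (real r *\<^sub>R x + m) = real r * (1 + (\<Sum>j\<in>-A. real (\<alpha> j) * x $ j) - (\<Sum>i\<in>A. x $ i)) - 1"
    proof -
      have "(\<Sum>j\<in>-A. real (\<alpha> j) * (real r *\<^sub>R x + m) $ j)
          = real r * (\<Sum>j\<in>-A. real (\<alpha> j) * x $ j) - (\<Sum>j\<in>-A. real (\<alpha> j))"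
        by (simp add: m_def sum_subtractf sum_distrib_left algebra_simps)
      then show ?thesis unfolding nA sum_shift using s by (simp add: algebra_simps)
    qed
    then have 3: "-1 \<le> nA \<bullet> (real r *\<^sub>R x + m) \<longleftrightarrow> (\<Sum>i\<in>A. x $ i) \<le> 1 + (\<Sum>j\<in>-A. real (\<alpha> j) * x $ j)"
      using r by (simp add: zero_le_mult_iff)
    show ?thesis unfolding N_def cayley_model_def using 1 2 3 by auto
  qed
  have Req: "R = {x. \<forall>n\<in>N. -1 \<le> n \<bullet> x}"
  proof (intro equalityI subsetI)
    fix X assume "X \<in> R"
    then show "X \<in> {x. \<forall>n\<in>N. -1 \<le> n \<bullet> x}" unfolding R using key by auto
  next
    fix X assume X: "X \<in> {x. \<forall>n\<in>N. -1 \<le> n \<bullet> x}"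
    define x where "x = (1 / real r) *\<^sub>R (X - m)"
    have "X = real r *\<^sub>R x + m" using r by (simp add: x_def)
    then show "X \<in> R" unfolding R using key[of x] X by auto
  qed
  have finN: "finite N" by (simp add: N_def)
  have NL: "N \<subseteq> lattice_points"
    using axis_in_lattice_points by (auto simp: N_def nA_def nB_def lattice_points_vec_iff axis_def)
  have zero: "0 \<in> convex hull N"
  proof (rule ccontr)
    assume "0 \<notin> convex hull N"
    then obtain a b where ab: "a \<bullet> 0 < b" "\<And>x. x \<in> convex hull N \<Longrightarrow> b < a \<bullet> x"
      using separating_hyperplane_closed_point[of "convex hull N" 0] finN
      by (auto simp: finite_imp_compact_convex_hull compact_imp_closed)
    then have pos: "0 < n \<bullet> a" if "n \<in> N" for n
      using ab(2)[of n] that hull_inc[of n N convex] by (simp add: inner_commute)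
    \<comment> \<open>a functional cannot be positive on all unit vectors and on \<open>nB\<close>, whose entries are at most \<open>0\<close>\<close>
    have "0 < a $ i" for i using pos[of "axis i 1"] by (simp add: N_def inner_axis_left)
    then have "0 \<le> (\<Sum>j\<in>-A. a $ j)" by (intro sum_nonneg) (simp add: less_imp_le)
    then show False using pos[of nB] by (simp add: N_def nB)
  qed
  have "reflexive R"
    unfolding reflexive_def
  proof (intro conjI)
    have "linear (\<lambda>x :: real^'n. real r *\<^sub>R x)" by (intro linearI) (simp_all add: algebra_simps)
    then have "lattice_polytope (dilate r (cayley_model A \<alpha>))"
      unfolding dilate_def
      by (rule lattice_polytope_linear_image[OF lp]) (intro lattice_points_scaleR Ints_of_nat)
    then show "lattice_polytope R" unfolding R_def using lattice_polytope_translate m by blast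
    have "open (\<Inter>n\<in>N. {x. -1 < n \<bullet> x})" using finN by (intro open_INT) (auto simp: open_halfspace_gt)
    moreover have "(\<Inter>n\<in>N. {x. -1 < n \<bullet> x}) \<subseteq> R" unfolding Req by (auto intro: less_imp_le)
    moreover have "0 \<in> (\<Inter>n\<in>N. {x. -1 < n \<bullet> x})" by simp
    ultimately show "0 \<in> interior R" by (meson interiorI)
    have "dual_polytope R = convex hull N" unfolding Req using dual_polytope_halfspaces[OF finN zero] .
    then show "lattice_polytope (dual_polytope R)"
      unfolding lattice_polytope_def using finN NL by (intro exI[of _ N]) (auto simp: N_def)
  qed
  then show ?thesis unfolding gorenstein_def using r lp m R_def by blast
qed

section \<open>Non-isomorphic Cayley polytopes\<close>

text \<open>For two different lattice points these are the divisors of the lattice length of the segment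
between them.\<close>

definition lattice_divisors :: "'a::lattice_space set \<Rightarrow> 'a \<times> 'a \<Rightarrow> nat set" where
  "lattice_divisors P = (\<lambda>(v, w). {k. \<exists>u\<in>affine hull P \<inter> lattice_points. w - v = real k *\<^sub>R (u - v)})"

lemma affine_combination_in_hull:
  assumes "v \<in> affine hull P" "u \<in> affine hull P"
  shows "v + c *\<^sub>R (u - v) \<in> affine hull P"
proof -
  have "(1 - c) *\<^sub>R v + c *\<^sub>R u \<in> affine hull P" by (rule mem_affine[OF affine_affine_hull assms]) simp
  then show ?thesis by (simp add: algebra_simps)
qed

lemma lattice_points_multiple:
  fixes u v :: "(nat \<Rightarrow>\<^sub>0 real) \<times> (nat \<Rightarrow>\<^sub>0 real)"
  assumes "v \<in> lattice_points" "u \<in> lattice_points"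
  shows "v + real k *\<^sub>R (u - v) \<in> lattice_points"
  using assms by (cases u; cases v) (auto simp: lattice_points_pair_iff lattice_points_seq_iff coord_simps)

text \<open>An isomorphism is by definition a bijection between lattice points only. This is enough here,
because for lattice points \<open>v\<close> and \<open>u\<close> also \<open>v + k (u - v)\<close> is a lattice point of the affine hull.\<close>

lemma lattice_divisors_isomorphism:
  fixes P Q :: "((nat \<Rightarrow>\<^sub>0 real) \<times> (nat \<Rightarrow>\<^sub>0 real)) set"
  assumes f: "linear f"
    and bij: "bij_betw (\<lambda>x. f x + c) (affine hull P \<inter> lattice_points) (affine hull Q \<inter> lattice_points)"
    and vw: "v \<in> affine hull P \<inter> lattice_points" "w \<in> affine hull P \<inter> lattice_points"
  shows "lattice_divisors Q (f v + c, f w + c) = lattice_divisors P (v, w)"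
proof -
  let ?\<phi> = "\<lambda>x. f x + c"
  have \<phi>: "?\<phi> (v + real k *\<^sub>R (u - v)) = ?\<phi> v + real k *\<^sub>R (?\<phi> u - ?\<phi> v)" for u k
    using f by (simp add: linear_add linear_diff linear_scale)
  have "(\<exists>u'\<in>affine hull Q \<inter> lattice_points. ?\<phi> w - ?\<phi> v = real k *\<^sub>R (u' - ?\<phi> v))
      \<longleftrightarrow> (\<exists>u\<in>affine hull P \<inter> lattice_points. w - v = real k *\<^sub>R (u - v))" for k
  proof -
    have "(\<exists>u'\<in>affine hull Q \<inter> lattice_points. ?\<phi> w - ?\<phi> v = real k *\<^sub>R (u' - ?\<phi> v))
      \<longleftrightarrow> (\<exists>u\<in>affine hull P \<inter> lattice_points. ?\<phi> w - ?\<phi> v = real k *\<^sub>R (?\<phi> u - ?\<phi> v))"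
      unfolding bij_betw_imp_surj_on[OF bij, symmetric] by blast
    also have "\<dots> \<longleftrightarrow> (\<exists>u\<in>affine hull P \<inter> lattice_points. w = v + real k *\<^sub>R (u - v))"
    proof (intro bex_cong refl)
      fix u assume u: "u \<in> affine hull P \<inter> lattice_points"
      have "v + real k *\<^sub>R (u - v) \<in> affine hull P \<inter> lattice_points"
        using affine_combination_in_hull lattice_points_multiple vw u by blast
      then have "w = v + real k *\<^sub>R (u - v) \<longleftrightarrow> ?\<phi> w = ?\<phi> (v + real k *\<^sub>R (u - v))"
        using bij vw(2) by (auto simp: bij_betw_def inj_on_def)
      then show "?\<phi> w - ?\<phi> v = real k *\<^sub>R (?\<phi> u - ?\<phi> v) \<longleftrightarrow> w = v + real k *\<^sub>R (u - v)"
        unfolding \<phi> by (auto simp: algebra_simps)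
    qed
    also have "\<dots> \<longleftrightarrow> (\<exists>u\<in>affine hull P \<inter> lattice_points. w - v = real k *\<^sub>R (u - v))"
      by (auto simp: algebra_simps)
    finally show ?thesis .
  qed
  then show ?thesis by (simp add: lattice_divisors_def)
qed

lemma cayley_vertex_coords:
  "coord (fst (cayley_vertex s w (i, j))) k = (if k = i \<and> i < s then real (w j + 1) else 0)"
  "coord (snd (cayley_vertex s w (i, j))) l = (if l = j then 1 else 0)"
  by (auto simp: cayley_vertex_def coord_simps)

lemma inj_on_cayley_vertex: "inj_on (cayley_vertex s w) ({..s} \<times> {..<r})"
proof (rule inj_onI, clarify)
  fix i j i' j' assume i: "i \<le> s" "i' \<le> s" and eq: "cayley_vertex s w (i, j) = cayley_vertex s w (i', j')"
  have "coord (snd (cayley_vertex s w (i, j))) j = coord (snd (cayley_vertex s w (i', j'))) j" using eq by simp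
  then have j: "j = j'" by (simp add: cayley_vertex_coords split: if_splits)
  have "coord (fst (cayley_vertex s w (i, j))) k = coord (fst (cayley_vertex s w (i', j'))) k" for k using eq by simp
  from this[of i] this[of i'] have "i = i'" using i by (auto simp: cayley_vertex_coords split: if_splits)
  then show "i = i' \<and> j = j'" using j by simp
qed

lemma convex_combination_eq_bound:
  fixes x y b u :: real
  assumes "x \<le> b" "y \<le> b" "0 < u" "u < 1" "(1 - u) * x + u * y = b"
  shows "x = b" "y = b"
proof -
  have "(1 - u) * (b - x) + u * (b - y) = 0" using assms(5) by (simp add: algebra_simps)
  moreover have "0 \<le> (1 - u) * (b - x)" "0 \<le> u * (b - y)" using assms by auto
  ultimately have "(1 - u) * (b - x) = 0" "u * (b - y) = 0" by linarith+
  then show "x = b" "y = b" using assms by auto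
qed

lemma convex_combination_zero:
  fixes x y u :: real
  assumes "0 \<le> x" "0 \<le> y" "0 < u" "u < 1" "(1 - u) * x + u * y = 0"
  shows "x = 0" "y = 0"
  using convex_combination_eq_bound[of "-x" 0 "-y" u] assms by (auto simp: algebra_simps)

text \<open>On the vertex \<open>(i, j)\<close> all coordinates other than \<open>i\<close> and \<open>j\<close> attain their minimum \<open>0\<close>; given this,
coordinate \<open>j\<close> equals one and coordinate \<open>i\<close> attains its maximum. So these equations pass to the
ends of every segment through the vertex.\<close>

lemma cayley_vertex_extreme:
  assumes len: "length as \<le> r" and ij: "i \<le> s" "j < r"
  shows "cayley_vertex s (padded as) (i, j) extreme_point_of cayley_simplices s r as"
proof -
  let ?w = "padded as"
  let ?v = "cayley_vertex s ?w (i, j)"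
  have vP: "?v \<in> cayley_simplices s r as"
    unfolding cayley_simplices_eq_hull[OF len] using ij by (intro hull_inc) auto
  have key: "z = ?v" if z: "z \<in> cayley_inequalities s r ?w"
    and z0: "\<And>k. k \<noteq> j \<Longrightarrow> coord (snd z) k = 0" "\<And>k. k \<noteq> i \<Longrightarrow> coord (fst z) k = 0"
    and top: "i < s \<Longrightarrow> coord (fst z) i = real (?w j + 1)" for z
  proof -
    have "(\<Sum>l<r. coord (snd z) l) = (\<Sum>l\<in>{j}. coord (snd z) l)"
      using z0(1) ij by (intro sum.mono_neutral_right) auto
    then have j1: "coord (snd z) j = 1" using z by (auto simp: cayley_inequalities_def)
    have "snd z = snd ?v" using z0 j1 by (intro poly_mapping_eqI) (simp add: cayley_vertex_coords)
    moreover have "fst z = fst ?v"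
    proof (rule poly_mapping_eqI)
      fix k
      have "coord (fst z) k = 0" if "s \<le> k" using z that by (auto simp: cayley_inequalities_def nonneg_below_def)
      then show "coord (fst z) k = coord (fst ?v) k"
        using z0(2)[of k] top by (auto simp: cayley_vertex_coords not_less)
    qed
    ultimately show ?thesis by (simp add: prod_eq_iff)
  qed
  show ?thesis
    unfolding extreme_point_of_def
  proof (intro conjI vP ballI notI)
    fix a b assume ab: "a \<in> cayley_simplices s r as" "b \<in> cayley_simplices s r as" "?v \<in> open_segment a b"
    then obtain u where u: "a \<noteq> b" "0 < u" "u < 1" "?v = (1 - u) *\<^sub>R a + u *\<^sub>R b" by (auto simp: in_segment)
    have abI: "a \<in> cayley_inequalities s r ?w" "b \<in> cayley_inequalities s r ?w"
      using ab cayley_simplices_eq_inequalities[OF len] by auto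
    then have nn: "0 \<le> coord (fst a) k" "0 \<le> coord (fst b) k" "0 \<le> coord (snd a) k" "0 \<le> coord (snd b) k" for k
      by (auto simp: cayley_inequalities_def nonneg_below_def)
    have c1: "(1 - u) * coord (fst a) k + u * coord (fst b) k = coord (fst ?v) k" for k
      unfolding u(4) by (simp add: coord_simps)
    have c2: "(1 - u) * coord (snd a) k + u * coord (snd b) k = coord (snd ?v) k" for k
      unfolding u(4) by (simp add: coord_simps)
    have s0: "coord (snd a) k = 0" "coord (snd b) k = 0" if "k \<noteq> j" for k
      using convex_combination_zero[OF nn(3,4) u(2,3)] c2[of k] that by (auto simp: cayley_vertex_coords)
    have f0: "coord (fst a) k = 0" "coord (fst b) k = 0" if "k \<noteq> i" for k
      using convex_combination_zero[OF nn(1,2) u(2,3)] c1[of k] that by (auto simp: cayley_vertex_coords)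
    have bound: "coord (fst z) i \<le> real (?w j + 1)"
      if z: "z \<in> cayley_inequalities s r ?w" and z0: "\<And>k. k \<noteq> j \<Longrightarrow> coord (snd z) k = 0"
        "\<And>k. k \<noteq> i \<Longrightarrow> coord (fst z) k = 0" and i: "i < s" for z
    proof -
      have "(\<Sum>l<r. coord (snd z) l) = (\<Sum>l\<in>{j}. coord (snd z) l)"
        "(\<Sum>l<r. real (?w l + 1) * coord (snd z) l) = (\<Sum>l\<in>{j}. real (?w l + 1) * coord (snd z) l)"
        using z0(1) ij by (intro sum.mono_neutral_right; auto)+
      moreover have "(\<Sum>k<s. coord (fst z) k) = (\<Sum>k\<in>{i}. coord (fst z) k)"
        using z0(2) i by (intro sum.mono_neutral_right) auto
      ultimately show ?thesis using z by (auto simp: cayley_inequalities_def)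
    qed
    have top: "coord (fst a) i = real (?w j + 1)" "coord (fst b) i = real (?w j + 1)" if i: "i < s"
      using convex_combination_eq_bound[OF bound[OF abI(1) s0(1) f0(1) i] bound[OF abI(2) s0(2) f0(2) i] u(2,3)]
        c1[of i] i by (auto simp: cayley_vertex_coords)
    have "a = ?v" "b = ?v" using key abI s0 f0 top by blast+
    then show False using u(1) by simp
  qed
qed

lemma extreme_points_cayley_simplices:
  assumes "length as \<le> r"
  shows "{v. v extreme_point_of cayley_simplices s r as} = cayley_vertex s (padded as) ` ({..s} \<times> {..<r})"
proof
  show "{v. v extreme_point_of cayley_simplices s r as} \<subseteq> cayley_vertex s (padded as) ` ({..s} \<times> {..<r})"
    unfolding cayley_simplices_eq_hull[OF assms] by (rule extreme_points_of_convex_hull)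
qed (use cayley_vertex_extreme[OF assms] in auto)

lemma cayley_vertex_lattice_point:
  "cayley_vertex s w x \<in> lattice_points"
  by (cases x) (auto simp: cayley_vertex_def lattice_points_pair_iff lattice_points_seq_iff coord_simps)

lemma Ints_dvd_iff: "real a = real k * t \<Longrightarrow> t \<in> \<int> \<Longrightarrow> k dvd a"
proof -
  assume a: "real a = real k * t" "t \<in> \<int>"
  then obtain z where "t = of_int z" by (auto elim: Ints_cases)
  then have "real_of_int (int a) = real_of_int (int k * z)" using a by simp
  then have "int a = int k * z" by (simp only: of_int_eq_iff)
  then show "k dvd a" by (metis dvd_triv_left int_dvd_int_iff)
qed

text \<open>Two vertices of different factors differ by \<open>1\<close> in a coordinate of the second component, so their
lattice distance is one; two vertices of factor \<open>j\<close> are vertices of a dilate of the unimodular simplex.\<close>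

lemma lattice_divisors_cayley:
  assumes len: "length as \<le> r" and x: "i \<le> s" "j < r" and x': "i' \<le> s" "j' < r"
  shows "lattice_divisors (cayley_simplices s r as)
      (cayley_vertex s (padded as) (i, j), cayley_vertex s (padded as) (i', j')) =
    (if j \<noteq> j' then {1} else if i = i' then UNIV else {k. k dvd padded as j + 1})" (is "?D = ?E")
proof -
  let ?w = "padded as"
  let ?v = "cayley_vertex s ?w (i, j)" and ?v' = "cayley_vertex s ?w (i', j')"
  let ?H = "affine hull (cayley_simplices s r as)"
  have vH: "?v \<in> ?H" "?v' \<in> ?H"
    unfolding cayley_simplices_eq_hull[OF len] using x x' by (auto intro!: hull_inc)
  have D: "k \<in> ?D \<longleftrightarrow> (\<exists>u\<in>?H \<inter> lattice_points. ?v' - ?v = real k *\<^sub>R (u - ?v))" for k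
    by (simp add: lattice_divisors_def)
  have one: "1 \<in> ?D" unfolding D using vH cayley_vertex_lattice_point by (intro bexI[of _ ?v']) auto
  consider "j \<noteq> j'" | "j = j'" "i = i'" | "j = j'" "i \<noteq> i'" by blast
  then show ?thesis
  proof cases
    case 1
    have "k = 1" if k: "k \<in> ?D" for k
    proof -
      obtain u where u: "u \<in> lattice_points" "?v' - ?v = real k *\<^sub>R (u - ?v)" using k D by auto
      have "coord (snd (?v' - ?v)) j' = real k * coord (snd (u - ?v)) j'" unfolding u(2) by (simp add: coord_simps)
      then have "real 1 = real k * coord (snd u) j'" using 1 by (simp add: coord_simps cayley_vertex_coords)
      moreover have "coord (snd u) j' \<in> \<int>"
        using u(1) by (cases u) (simp add: lattice_points_pair_iff lattice_points_seq_iff)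
      ultimately have "k dvd 1" by (rule Ints_dvd_iff)
      then show ?thesis by simp
    qed
    then have "?D = {1}" using one by blast
    then show ?thesis using 1 by simp
  next
    case 2
    have "k \<in> ?D" for k unfolding D using 2 vH cayley_vertex_lattice_point by (intro bexI[of _ ?v]) auto
    then show ?thesis using 2 by auto
  next
    case 3
    have "k \<in> ?D \<longleftrightarrow> k dvd ?w j + 1" for k
    proof
      assume k: "k \<in> ?D"
      obtain u where u: "u \<in> lattice_points" "?v' - ?v = real k *\<^sub>R (u - ?v)" using k D by auto
      have int: "coord (fst (u - ?v)) l \<in> \<int>" for l
        using u(1) cayley_vertex_lattice_point[of s ?w "(i, j)"]
        by (cases u; cases ?v) (simp add: lattice_points_pair_iff lattice_points_seq_iff coord_simps)
      have eq: "coord (fst (?v' - ?v)) l = real k * coord (fst (u - ?v)) l" for l unfolding u(2) by (simp add: coord_simps)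
      show "k dvd ?w j + 1"
      proof (cases "i < s")
        case True
        have "real (?w j + 1) = real k * (- coord (fst (u - ?v)) i)"
          using eq[of i] 3 True by (simp add: coord_simps cayley_vertex_coords algebra_simps)
        then show ?thesis using int Ints_dvd_iff by (metis Ints_minus)
      next
        case False
        then have "i' < s" using 3 x x' by simp
        then have "real (?w j + 1) = real k * coord (fst (u - ?v)) i'"
          using eq[of i'] 3 by (simp add: coord_simps cayley_vertex_coords)
        then show ?thesis using int Ints_dvd_iff by metis
      qed
    next
      assume "k dvd ?w j + 1"
      then obtain q where q: "?w j + 1 = k * q" by (elim dvdE)
      then have k0: "k \<noteq> 0" by (cases k) auto
      define u where "u = ?v + (1 / real k) *\<^sub>R (?v' - ?v)"
      have "u \<in> ?H" unfolding u_def using affine_combination_in_hull vH by blast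
      moreover have "u \<in> lattice_points"
      proof -
        have W: "real (?w j + 1) = real k * real q" unfolding q by simp
        have "u = (((if i < s then real (?w j + 1) else 0)) *\<^sub>R unit_seq i +
            (if i' < s then real q else 0) *\<^sub>R unit_seq i' - (if i < s then real q else 0) *\<^sub>R unit_seq i, unit_seq j)"
          unfolding u_def cayley_vertex_def split 3(1)[symmetric] W
          using k0 by (simp add: scaleR_diff_right)
        then show ?thesis by (simp add: lattice_points_pair_iff lattice_points_seq_iff coord_simps)
      qed
      moreover have "?v' - ?v = real k *\<^sub>R (u - ?v)" using k0 by (simp add: u_def)
      ultimately show "k \<in> ?D" unfolding D by blast
    qed
    then show ?thesis using 3 by auto
  qed
qed

text \<open>From \<open>K = 2\<close> on, pairs of different factors and pairs of equal vertices do not contribute, and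
each factor of size \<open>K\<close> contributes the same number of pairs.\<close>

lemma card_vertex_pairs_by_divisors:
  fixes s :: nat
  assumes len: "length as \<le> r" and K: "2 \<le> K"
  defines "E \<equiv> {(i, i'). i \<le> s \<and> i' \<le> s \<and> i \<noteq> (i'::nat)}"
  shows "card {p \<in> {v. v extreme_point_of cayley_simplices s r as} \<times> {v. v extreme_point_of cayley_simplices s r as}.
      lattice_divisors (cayley_simplices s r as) p = {k. k dvd K}} = card E * card {j. j < r \<and> padded as j + 1 = K}"
proof -
  let ?P = "cayley_simplices s r as" and ?V = "cayley_vertex s (padded as)" and ?J = "{j. j < r \<and> padded as j + 1 = K}"
  define g where "g = (\<lambda>((i, i'), j). (?V (i, j), ?V (i', j)))"
  have d1: "{k. k dvd K} \<noteq> {1}" using K by (metis One_nat_def dvd_refl mem_Collect_eq numeral_le_one_iff semiring_norm(69) singletonD)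
  have d2: "{k. k dvd K} \<noteq> UNIV"
  proof
    assume "{k. k dvd K} = UNIV"
    then have "Suc K dvd K" by blast
    then show False using K dvd_imp_le[of "Suc K" K] by simp
  qed
  have d3: "{k. k dvd a} = {k. k dvd K} \<longleftrightarrow> a = K" for a :: nat
    by (metis dvd_antisym dvd_refl mem_Collect_eq)
  have "{p \<in> {v. v extreme_point_of ?P} \<times> {v. v extreme_point_of ?P}. lattice_divisors ?P p = {k. k dvd K}} = g ` (E \<times> ?J)"
    unfolding extreme_points_cayley_simplices[OF len]
  proof (intro equalityI subsetI)
    fix p assume p: "p \<in> {p \<in> ?V ` ({..s} \<times> {..<r}) \<times> ?V ` ({..s} \<times> {..<r}). lattice_divisors ?P p = {k. k dvd K}}"
    then obtain i j i' j' where ij: "p = (?V (i, j), ?V (i', j'))" "i \<le> s" "j < r" "i' \<le> s" "j' < r" by auto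
    have "(if j \<noteq> j' then {1} else if i = i' then UNIV else {k. k dvd padded as j + 1}) = {k. k dvd K}"
      using p lattice_divisors_cayley[OF len ij(2-5)] unfolding ij(1) by simp
    then have "j = j'" "i \<noteq> i'" "padded as j + 1 = K" using d1 d2 d3 by (auto split: if_splits)
    then show "p \<in> g ` (E \<times> ?J)" using ij by (intro image_eqI[of _ _ "((i, i'), j)"]) (auto simp: g_def E_def)
  next
    fix p assume "p \<in> g ` (E \<times> ?J)"
    then obtain i i' j where ij: "p = (?V (i, j), ?V (i', j))" "i \<le> s" "i' \<le> s" "i \<noteq> i'" "j < r" "padded as j + 1 = K"
      by (auto simp: g_def E_def)
    then show "p \<in> {p \<in> ?V ` ({..s} \<times> {..<r}) \<times> ?V ` ({..s} \<times> {..<r}). lattice_divisors ?P p = {k. k dvd K}}"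
      using lattice_divisors_cayley[OF len, of i s j i' j] by auto
  qed
  moreover have "inj_on g (E \<times> ?J)"
  proof (rule inj_onI)
    fix x y assume xy: "x \<in> E \<times> ?J" "y \<in> E \<times> ?J" "g x = g y"
    obtain i i' j k k' l where e: "x = ((i, i'), j)" "y = ((k, k'), l)" by (metis surj_pair)
    have "(i, j) = (k, l)" "(i', j) = (k', l)"
      using xy inj_onD[OF inj_on_cayley_vertex[of s "padded as" r]] by (auto simp: e g_def E_def)
    then show "x = y" by (simp add: e)
  qed
  ultimately show ?thesis by (simp add: card_image card_cartesian_product)
qed

text \<open>An isomorphism maps the vertices onto the vertices: every vertex of the image is the image of a
vertex, and both polytopes have the same number of vertices.\<close>

lemma cayley_simplices_isomorphic_imp_counts:
  assumes len: "length as \<le> r" "length bs \<le> r" and s: "0 < s" and K: "2 \<le> K"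
    and iso: "cayley_simplices s r as \<cong>\<^sub>L cayley_simplices s r bs"
  shows "card {j. j < r \<and> padded as j + 1 = K} = card {j. j < r \<and> padded bs j + 1 = K}"
proof -
  let ?P = "cayley_simplices s r as" and ?Q = "cayley_simplices s r bs"
  let ?E = "{(i, i'). i \<le> s \<and> i' \<le> s \<and> i \<noteq> (i'::nat)}"
  obtain f c where f: "linear f"
    and bij: "bij_betw (\<lambda>x. f x + c) (affine hull ?P \<inter> lattice_points) (affine hull ?Q \<inter> lattice_points)"
    and im: "(\<lambda>x. f x + c) ` ?P = ?Q" using iso unfolding lattice_isomorphic_def by auto
  let ?\<phi> = "\<lambda>x. f x + c"
  define VP where "VP = {v. v extreme_point_of ?P}"
  define VQ where "VQ = {v. v extreme_point_of ?Q}"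
  have VP: "VP = cayley_vertex s (padded as) ` ({..s} \<times> {..<r})" "VQ = cayley_vertex s (padded bs) ` ({..s} \<times> {..<r})"
    unfolding VP_def VQ_def using extreme_points_cayley_simplices len by auto
  have fin: "finite VP" and cards: "card VP = card VQ"
    unfolding VP by (simp_all add: card_image inj_on_cayley_vertex)
  have VPL: "VP \<subseteq> affine hull ?P \<inter> lattice_points"
    using cayley_vertex_lattice_point VP by (auto simp: VP_def extreme_point_of_def intro: hull_inc)
  have inj: "inj_on ?\<phi> VP" using bij VPL by (auto simp: bij_betw_def intro: inj_on_subset)
  have "?Q = convex hull (?\<phi> ` VP)"
  proof -
    have "?P = convex hull VP" unfolding VP using cayley_simplices_eq_hull[OF len(1)] .
    then have "?\<phi> ` ?P = (\<lambda>x. c + x) ` (f ` (convex hull VP))" by (simp add: image_image add.commute)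
    also have "\<dots> = convex hull ((\<lambda>x. c + x) ` (f ` VP))"
      using convex_hull_linear_image[OF f] convex_hull_translation by metis
    finally show ?thesis using im by (simp add: image_image add.commute)
  qed
  then have "VQ \<subseteq> ?\<phi> ` VP" unfolding VQ_def using extreme_points_of_convex_hull by metis
  then have VQ: "?\<phi> ` VP = VQ"
    using card_subset_eq[of "?\<phi> ` VP" VQ] fin cards card_image[OF inj] by simp
  let ?S = "\<lambda>P V. {p \<in> V \<times> V. lattice_divisors P p = {k. k dvd K}}"
  have "bij_betw (map_prod ?\<phi> ?\<phi>) (?S ?P VP) (?S ?Q VQ)"
    unfolding bij_betw_def
  proof
    show "inj_on (map_prod ?\<phi> ?\<phi>) (?S ?P VP)"
      by (rule inj_on_subset[OF map_prod_inj_on[OF inj inj]]) auto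
    have div: "lattice_divisors ?Q (?\<phi> v, ?\<phi> w) = lattice_divisors ?P (v, w)" if "v \<in> VP" "w \<in> VP" for v w
      using lattice_divisors_isomorphism[OF f bij] that VPL by blast
    show "map_prod ?\<phi> ?\<phi> ` ?S ?P VP = ?S ?Q VQ"
    proof (intro equalityI subsetI)
      fix p assume "p \<in> map_prod ?\<phi> ?\<phi> ` ?S ?P VP"
      then obtain v w where "v \<in> VP" "w \<in> VP" "p = (?\<phi> v, ?\<phi> w)" "lattice_divisors ?P (v, w) = {k. k dvd K}" by auto
      then show "p \<in> ?S ?Q VQ" using div[of v w] VQ by blast
    next
      fix p assume p: "p \<in> ?S ?Q VQ"
      then obtain v w where "v \<in> VP" "w \<in> VP" "p = (?\<phi> v, ?\<phi> w)" using VQ by blast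
      then show "p \<in> map_prod ?\<phi> ?\<phi> ` ?S ?P VP"
        using p div[of v w] by (intro image_eqI[of _ _ "(v, w)"]) simp_all
    qed
  qed
  then have "card (?S ?P VP) = card (?S ?Q VQ)" by (rule bij_betw_same_card)
  then have "card ?E * card {j. j < r \<and> padded as j + 1 = K} = card ?E * card {j. j < r \<and> padded bs j + 1 = K}"
    unfolding VP_def VQ_def card_vertex_pairs_by_divisors[OF len(1) K] card_vertex_pairs_by_divisors[OF len(2) K] .
  moreover have "card ?E \<noteq> 0"
  proof -
    have fin: "finite ?E" by (rule finite_subset[of _ "{..s} \<times> {..s}"]) auto
    have "(0, s) \<in> ?E" using s by simp
    then have "?E \<noteq> {}" by blast
    then show ?thesis using fin by (simp only: card_0_eq) simp
  qed
  ultimately show ?thesis by simp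
qed

lemma count_eq_card_padded:
  assumes "length as \<le> r" "a \<noteq> 0"
  shows "count (mset as) a = card {j. j < r \<and> padded as j + 1 = a + 1}"
proof -
  have "{j. j < r \<and> padded as j + 1 = a + 1} = {j. j < length as \<and> a = as ! j}"
    using assms by (auto simp: padded_def)
  then show ?thesis by (simp add: count_mset count_list_eq_length_filter length_filter_conv_card)
qed

lemma cayley_simplices_isomorphic_imp_same_partition:
  assumes len: "length as \<le> r" "length bs \<le> r" and s: "0 < s"
    and iso: "cayley_simplices s r as \<cong>\<^sub>L cayley_simplices s r bs"
  shows "same_partition as bs"
  unfolding same_partition_def
proof (rule multiset_eqI)
  fix a
  show "count {#a \<in># mset as. a \<noteq> 0#} a = count {#b \<in># mset bs. b \<noteq> 0#} a"
  proof (cases "a = 0")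
    case False
    then have "count (mset as) a = count (mset bs) a"
      using count_eq_card_padded len cayley_simplices_isomorphic_imp_counts[OF len s _ iso, of "a + 1"] by simp
    then show ?thesis by simp
  qed simp
qed

section \<open>The classification for large index\<close>

lemma bounded_ray:
  fixes Q :: "(real^'n) set"
  assumes "bounded Q" "\<And>t. 0 \<le> t \<Longrightarrow> x + t *\<^sub>R v \<in> Q"
  shows "v = 0"
proof (rule ccontr)
  assume v: "v \<noteq> 0"
  obtain b where b: "\<And>y. y \<in> Q \<Longrightarrow> norm y \<le> b" using assms(1) by (auto simp: bounded_iff)
  define t where "t = (\<bar>b\<bar> + norm x + 1) / norm v"
  have t: "0 \<le> t" by (simp add: t_def)
  have "norm (t *\<^sub>R v) \<le> norm (x + t *\<^sub>R v) + norm x" by (metis add.commute add_diff_cancel_left' norm_triangle_ineq4)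
  also have "\<dots> \<le> b + norm x" using b[OF assms(2)[OF t]] by simp
  finally show False using v t by (simp add: t_def)
qed

text \<open>The coordinate ray through \<open>axis i 1\<close> leaves a bounded polyhedron in the nonnegative orthant
  at a vertex.\<close>

lemma axis_vertex:
  fixes Q :: "(real^'n) set"
  assumes bdd: "bounded Q" and fin: "finite K"
    and Q: "Q = {x. (\<forall>i. 0 \<le> x $ i) \<and> (\<forall>(a, C)\<in>K. a \<bullet> x \<le> C)}"
    and C: "\<And>a C. (a, C) \<in> K \<Longrightarrow> 1 \<le> C"
  obtains t a C where "0 < t" "(t *\<^sub>R axis i 1) extreme_point_of Q" "(a, C) \<in> K" "0 < a $ i" "t * a $ i = C"
    "\<And>a' C'. (a', C') \<in> K \<Longrightarrow> t * a' $ i \<le> C'"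
proof -
  let ?K = "{p\<in>K. 0 < fst p $ i}"
  have inn: "a \<bullet> (t *\<^sub>R axis i 1) = t * a $ i" for a :: "real^'n" and t by (simp add: inner_axis)
  have inQ: "t *\<^sub>R axis i 1 \<in> Q" if t: "0 \<le> t" "\<And>a C. (a, C) \<in> K \<Longrightarrow> t * a $ i \<le> C" for t
  proof -
    have "a \<bullet> (t *\<^sub>R axis i 1) \<le> C" if "(a, C) \<in> K" for a C unfolding inn using t(2)[OF that] .
    then show ?thesis unfolding Q using t(1) by (auto simp: axis_nonneg)
  qed
  have ne: "?K \<noteq> {}"
  proof
    assume e: "?K = {}"
    have "0 + t *\<^sub>R axis i 1 \<in> Q" if "0 \<le> t" for t
    proof -
      have "t * a $ i \<le> C" if aC: "(a, C) \<in> K" for a C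
      proof -
        have "a $ i \<le> 0" using e aC by (auto simp: not_less)
        then show ?thesis using \<open>0 \<le> t\<close> C[OF aC] mult_nonneg_nonpos[of t "a $ i"] by linarith
      qed
      then show ?thesis using inQ that by simp
    qed
    then have "axis i (1::real) = 0" using bounded_ray[OF bdd] by blast
    then show False by (simp add: axis_eq_0_iff)
  qed
  define t where "t = Min ((\<lambda>p. snd p / fst p $ i) ` ?K)"
  have fin': "finite ((\<lambda>p. snd p / fst p $ i) ` ?K)" using fin by simp
  have "t \<in> (\<lambda>p. snd p / fst p $ i) ` ?K" unfolding t_def using Min_in[OF fin'] ne by blast
  then obtain a C0 where aC: "(a, C0) \<in> K" "0 < a $ i" "t = C0 / a $ i" by force
  have t: "0 < t" using aC C[OF aC(1)] by simp
  have tt: "t * a $ i = C0" using aC by simp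
  have le: "t * a' $ i \<le> C'" if a': "(a', C') \<in> K" for a' C'
  proof (cases "0 < a' $ i")
    case True
    then have "t \<le> C' / a' $ i" unfolding t_def using a' Min_le[OF fin'] by force
    then show ?thesis using True by (simp add: field_simps)
  next
    case False
    then show ?thesis using t C[OF a'] mult_nonneg_nonpos[of t "a' $ i"] by linarith
  qed
  have "(t *\<^sub>R axis i 1) extreme_point_of Q"
    unfolding extreme_point_of_def
  proof (intro conjI ballI notI)
    show "t *\<^sub>R axis i 1 \<in> Q" using inQ t le by simp
    fix x y assume xy: "x \<in> Q" "y \<in> Q" "t *\<^sub>R axis i 1 \<in> open_segment x y"
    then obtain u where u: "x \<noteq> y" "0 < u" "u < 1" "t *\<^sub>R axis i 1 = (1 - u) *\<^sub>R x + u *\<^sub>R y" by (auto simp: in_segment)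
    have c: "(1 - u) * x $ j + u * y $ j = (if j = i then t else 0)" for j
      using arg_cong[OF u(4), of "\<lambda>z. z $ j"] by (auto simp: axis_def)
    have nn: "0 \<le> z $ j" if "z \<in> Q" for z j using that Q by auto
    have off: "x $ j = 0" "y $ j = 0" if "j \<noteq> i" for j
      using convex_combination_zero[OF nn[OF xy(1)] nn[OF xy(2)] u(2,3)] c[of j] that by auto
    have on: "z $ i \<le> t" if z: "z \<in> Q" and z0: "\<And>j. j \<noteq> i \<Longrightarrow> z $ j = 0" for z
    proof -
      have "z = z $ i *\<^sub>R axis i 1" using z0 by (auto simp: vec_eq_iff axis_def)
      then have "z $ i * a $ i \<le> C0" using z aC(1) inn[of a "z $ i"] unfolding Q by force
      then have "z $ i * a $ i \<le> t * a $ i" using tt by simp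
      then show ?thesis by (rule mult_right_le_imp_le[OF _ aC(2)])
    qed
    have "x $ i = t" "y $ i = t"
      using convex_combination_eq_bound[OF on[OF xy(1) off(1)] on[OF xy(2) off(2)] u(2,3)] c[of i] by auto
    then have "x = y" using off by (metis vec_eq_iff)
    then show False using u(1) by simp
  qed
  then show ?thesis using that t aC tt le by blast
qed

lemma sum_Compl_split:
  fixes h :: "'n::finite \<Rightarrow> real"
  shows "(\<Sum>i\<in>UNIV. h i) = (\<Sum>i\<in>A. h i) + (\<Sum>j\<in>-A. h j)"
  using sum.subset_diff[of A UNIV h] by (simp add: Compl_eq_Diff_UNIV)

lemma large_index_nat_iff: "(real d + 3) / 3 < real r \<longleftrightarrow> d + 3 < 3 * r"
proof -
  have "(real d + 3) / 3 < real r \<longleftrightarrow> real (d + 3) < real (3 * r)" by (simp add: field_simps)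
  then show ?thesis by (simp only: of_nat_less_iff)
qed

lemma card_Compl_finite: "card (-A) = CARD('n) - card A" for A :: "'n::finite set"
  by (simp add: Compl_eq_Diff_UNIV card_Diff_subset)

lemma half_index_nat_iff: "real r \<le> (real d + 1) / 2 \<longleftrightarrow> 2 * r \<le> d + 1"
proof -
  have "real r \<le> (real d + 1) / 2 \<longleftrightarrow> real (2 * r) \<le> real (d + 1)" by (simp add: field_simps)
  then show ?thesis by (simp only: of_nat_le_iff)
qed

text \<open>The last disjunct is the product of the third one in dimension \<open>2\<close>, the unit square.\<close>

definition large_index_list :: "nat \<Rightarrow> nat \<Rightarrow> (real^'n) set \<Rightarrow> bool" where
  "large_index_list d r P \<longleftrightarrow>
           P \<cong>\<^sub>L unimodular_simplex d \<or>
           (d \<ge> 5 \<and> odd d \<and> P \<cong>\<^sub>L dilate 2 (unimodular_simplex d)) \<or>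
           (d \<ge> 4 \<and> even d \<and> P \<cong>\<^sub>L unimodular_simplex (d div 2) \<times> unimodular_simplex (d div 2)) \<or>
           (cayley_range d r \<and>
              (\<exists>as. length as \<le> r \<and> integer_partition as (d + 2 - 2 * r) \<and>
                    P \<cong>\<^sub>L cayley_simplices (d + 1 - r) r as)) \<or>
           (d = 2 \<and> P \<cong>\<^sub>L unimodular_simplex 1 \<times> unimodular_simplex 1)"

lemma sum_padded:
  assumes "length as \<le> r"
  shows "(\<Sum>j<r. padded as j) = sum_list as"
proof -
  have "(\<Sum>j<r. padded as j) = (\<Sum>j<length as. padded as j)"
    using assms by (intro sum.mono_neutral_right) (auto simp: padded_def)
  also have "\<dots> = sum_list as" by (simp add: sum_list_sum_nth padded_def atLeast0LessThan)
  finally show ?thesis .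
qed

text \<open>The cardinality conditions give \<open>d + 2 - 2 r\<close> as the sum of the \<open>\<alpha> j\<close>. If it is zero the model is a
product of two simplices of dimension \<open>d / 2\<close>; otherwise the \<open>\<alpha> j\<close> form the partition and the
factor at the origin supplies a part \<open>0\<close>.\<close>

lemma cayley_model_in_large_index_list:
  fixes P :: "(real^'n) set" and A :: "'n set"
  assumes iso: "P \<cong>\<^sub>L cayley_model A \<alpha>" and cA: "card (-A) + 1 = r"
    and sum\<alpha>: "card A + 1 = r + (\<Sum>j\<in>-A. \<alpha> j)" and large: "(real CARD('n) + 3) / 3 < real r"
  shows "large_index_list CARD('n) r P"
proof -
  let ?d = "CARD('n)"
  have cd: "card A + card (-A) = ?d"
    using card_Un_disjoint[of A "-A"] by (simp add: Compl_partition)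
  then have sum\<alpha>': "(\<Sum>j\<in>-A. \<alpha> j) + 2 * r = ?d + 2" using cA sum\<alpha> by linarith
  show ?thesis
  proof (cases "2 * r = ?d + 2")
    case True
    then have "\<forall>j\<in>-A. \<alpha> j = 0" using sum\<alpha>' by simp
    then have "cayley_model A \<alpha> = cayley_model A (\<lambda>_. 0)" by (auto simp: cayley_model_def)
    then have iso': "P \<cong>\<^sub>L cayley_model A (\<lambda>_. 0)" using iso by simp
    have d2: "?d = 2 * card (-A)" using True cA by linarith
    have "card A = card (-A)" using d2 cd by linarith
    then have halves: "card A = ?d div 2" "card (-A) = ?d div 2" "even ?d" using d2 by simp_all
    obtain \<sigma> where \<sigma>: "bij_betw \<sigma> A {..<?d div 2}" using finite_same_card_bij[of A "{..<?d div 2}"] halves by auto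
    obtain \<tau> where \<tau>: "bij_betw \<tau> (-A) {..<?d div 2}" using finite_same_card_bij[of "-A" "{..<?d div 2}"] halves by auto
    have prod: "P \<cong>\<^sub>L unimodular_simplex (?d div 2) \<times> unimodular_simplex (?d div 2)"
      using lattice_isomorphic_trans[OF iso' simplex_product_iso(1)[OF \<sigma> \<tau>]] .
    have "?d > 0" by simp
    then have "4 \<le> ?d \<or> ?d = 2" using halves(3) by presburger
    then show ?thesis
    proof
      assume "?d = 2"
      then show ?thesis using prod by (simp add: large_index_list_def)
    qed (use prod halves in \<open>simp add: large_index_list_def\<close>)
  next
    case False
    then have r: "2 * r \<le> ?d + 1" using sum\<alpha>' by linarith
    have rng: "cayley_range ?d r" unfolding cayley_range_def half_index_nat_iff using large r by simp
    have "card A = ?d + 1 - r" using cA cd by linarith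
    then obtain \<sigma> where \<sigma>: "bij_betw \<sigma> A {..<?d + 1 - r}" using finite_same_card_bij[of A "{..<?d + 1 - r}"] by auto
    have r0: "0 < r" using cA by linarith
    have rr: "{..<r} - {r - 1} = {..<r - 1}" using r0 by auto
    have "card (-A) = r - 1" using cA by linarith
    then obtain \<tau> where \<tau>: "bij_betw \<tau> (-A) {..<r - 1}" using finite_same_card_bij[of "-A" "{..<r - 1}"] by auto
    define as where "as = map (\<lambda>k. \<alpha> (inv_into (-A) \<tau> k)) [0..<r - 1]"
    have len: "length as = r - 1" by (simp add: as_def)
    have pad: "padded as (\<tau> j) = \<alpha> j" if j: "j \<in> -A" for j
    proof -
      have "\<tau> j < r - 1" using bij_betwE[OF \<tau>] j by auto
      then show ?thesis using j \<tau> by (simp add: padded_def as_def bij_betw_def inv_into_f_f)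
    qed
    have "cayley_model A \<alpha> \<cong>\<^sub>L cayley_simplices (?d + 1 - r) r as"
    proof (rule cayley_model_iso(1)[OF \<sigma>])
      show "bij_betw \<tau> (-A) ({..<r} - {r - 1})" using \<tau> rr by simp
    qed (use r0 len pad in \<open>auto simp: padded_def\<close>)
    then have "P \<cong>\<^sub>L cayley_simplices (?d + 1 - r) r as" using lattice_isomorphic_trans[OF iso] by blast
    moreover have "integer_partition as (?d + 2 - 2 * r)"
    proof -
      have "sum_list as = (\<Sum>j<r - 1. padded as j)" using sum_padded[of as "r - 1"] len by simp
      also have "\<dots> = (\<Sum>j\<in>-A. padded as (\<tau> j))" using sum.reindex_bij_betw[OF \<tau>] by metis
      also have "\<dots> = (\<Sum>j\<in>-A. \<alpha> j)" using pad by simp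
      finally show ?thesis unfolding integer_partition_def using sum\<alpha>' by linarith
    qed
    ultimately show ?thesis unfolding large_index_list_def using rng len r0 by auto
  qed
qed

text \<open>The negated coefficients of \<open>a\<close> outside \<open>A\<close> are the parameters of the Cayley model. The equations for
\<open>r\<close> are those of the normal form with both constants equal to \<open>1\<close>.\<close>

lemma two_form_polytope_in_large_index_list:
  fixes P :: "(real^'n) set" and a b :: "real^'n"
  assumes iso: "P \<cong>\<^sub>L {x. (\<forall>i. 0 \<le> x $ i) \<and> a \<bullet> x \<le> 1 \<and> b \<bullet> x \<le> 1}"
    and a: "\<And>i. i \<in> A \<Longrightarrow> a $ i = 1" "\<And>i. i \<notin> A \<Longrightarrow> a $ i \<le> 0" "a \<in> lattice_points"
    and b: "\<And>i. i \<in> A \<Longrightarrow> b $ i = 0" "\<And>i. i \<notin> A \<Longrightarrow> b $ i = 1"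
    and r: "real r = 1 + (\<Sum>i\<in>UNIV. a $ i)" "real r = 1 + (\<Sum>i\<in>UNIV. b $ i)"
    and large: "(real CARD('n) + 3) / 3 < real r"
  shows "large_index_list CARD('n) r P"
proof -
  define \<alpha> where "\<alpha> j = nat \<lfloor>- a $ j\<rfloor>" for j
  have \<alpha>: "real (\<alpha> j) = - a $ j" if "j \<in> -A" for j
  proof -
    have "a $ j \<in> \<int>" using a(3) by (simp add: lattice_points_vec_iff)
    then obtain z where "a $ j = of_int z" by (auto elim: Ints_cases)
    then show ?thesis using a(2)[of j] that by (simp add: \<alpha>_def)
  qed
  have inn: "y \<bullet> x = (\<Sum>i\<in>A. y $ i * x $ i) + (\<Sum>j\<in>-A. y $ j * x $ j)" for y x :: "real^'n"
    unfolding inner_vec_def by (simp add: sum_Compl_split[of _ A])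
  have bx: "b \<bullet> x = (\<Sum>j\<in>-A. x $ j)" for x unfolding inn using b by simp
  have ax: "a \<bullet> x = (\<Sum>i\<in>A. x $ i) - (\<Sum>j\<in>-A. real (\<alpha> j) * x $ j)" for x
    unfolding inn using a(1) \<alpha> by (simp add: sum_negf)
  have "{x. (\<forall>i. 0 \<le> x $ i) \<and> a \<bullet> x \<le> 1 \<and> b \<bullet> x \<le> 1} = cayley_model A \<alpha>"
    unfolding cayley_model_def ax bx by (auto simp: algebra_simps)
  then have iso': "P \<cong>\<^sub>L cayley_model A \<alpha>" using iso by simp
  have "real r = 1 + real (card (-A))" using r(2) b unfolding sum_Compl_split[of _ A] by simp
  then have cA: "card (-A) + 1 = r" by linarith
  have "(\<Sum>i\<in>UNIV. a $ i) = real (card A) - real (\<Sum>j\<in>-A. \<alpha> j)"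
    unfolding sum_Compl_split[of _ A] using a(1) \<alpha> by (simp add: sum_negf)
  then have "card A + 1 = r + (\<Sum>j\<in>-A. \<alpha> j)" using r(1) by linarith
  then show ?thesis using cayley_model_in_large_index_list[OF iso' cA _ large] by blast
qed

lemma large_index_imp_list:
  fixes P :: "(real^'n) set"
  assumes P: "smooth_polytope P" and gor: "gorenstein r P" and large: "(real CARD('n) + 3) / 3 < real r"
  shows "large_index_list CARD('n) r P"
proof (rule smooth_gorenstein_normal_form[OF P gor])
  let ?d = "CARD('n)"
  have d0: "0 < ?d" by simp
  fix Q :: "(real^'n) set" and K
  assume iso: "P \<cong>\<^sub>L Q" and bdd: "bounded Q" and fin: "finite K"
    and Q: "Q = {x. (\<forall>i. 0 \<le> x $ i) \<and> (\<forall>(a, C)\<in>K. a \<bullet> x \<le> C)}"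
    and KL: "\<And>a C. (a, C) \<in> K \<Longrightarrow> a \<in> lattice_points"
    and KC: "\<And>a C. (a, C) \<in> K \<Longrightarrow> C \<in> \<int> \<and> 1 \<le> C \<and> real r * C = 1 + (\<Sum>i\<in>UNIV. a $ i)"
    and small: "real r * (\<Sum>(a, C)\<in>K. C) \<le> real (CARD('n) + card K)"
    and extL: "\<And>x. x extreme_point_of Q \<Longrightarrow> x \<in> lattice_points"
    and simple: "\<And>x. x extreme_point_of Q \<Longrightarrow> card {i. x $ i = 0} + card {(a, C)\<in>K. a \<bullet> x = C} = CARD('n)"
    and dual: "\<And>x a C. x extreme_point_of Q \<Longrightarrow> (a, C) \<in> K \<Longrightarrow> a \<bullet> x = C \<Longrightarrow>
       \<exists>z\<in>lattice_points. a \<bullet> z = 1 \<and> (\<forall>i. x $ i = 0 \<longrightarrow> z $ i = 0)"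
  have aZ: "a $ i \<in> \<int>" if "(a, C) \<in> K" for a C i using KL[OF that] by (simp add: lattice_points_vec_iff)
  have vertex: "\<exists>t a C. 0 < t \<and> (t *\<^sub>R axis i 1) extreme_point_of Q \<and> (a, C) \<in> K \<and> 0 < a $ i \<and> t * a $ i = C \<and>
      (\<forall>(a', C')\<in>K. t * a' $ i \<le> C')" for i
    using axis_vertex[OF bdd fin Q, of i] KC by (metis (no_types, lifting) case_prodI2)
  have Kne: "K \<noteq> {}" using vertex by blast
  have "(\<Sum>(a, C)\<in>K. 1) \<le> (\<Sum>(a, C)\<in>K. C)" using KC by (intro sum_mono) auto
  then have "real (card K) \<le> (\<Sum>(a, C)\<in>K. C)" by (simp add: split_def)
  then have "real r * real (card K) \<le> real r * (\<Sum>(a, C)\<in>K. C)" by (intro mult_left_mono) auto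
  then have "real r * real (card K) \<le> real ?d + real (card K)" using small by simp
  then have le: "(real r - 1) * real (card K) \<le> real ?d" by (simp add: algebra_simps)
  have "card K < 3"
  proof (rule ccontr)
    assume "\<not> card K < 3"
    then have "(real r - 1) * 3 \<le> (real r - 1) * real (card K)" using large by (intro mult_left_mono) auto
    moreover have "real ?d < (real r - 1) * 3" using large by (simp add: field_simps)
    ultimately show False using le by (meson not_less order_trans)
  qed
  moreover have "card K \<noteq> 0" using Kne fin by simp
  ultimately consider "card K = 1" | "card K = 2" by linarith
  then show ?thesis
  proof cases
    case 1
    then obtain a C where K: "K = {(a, C)}" using card_1_singletonE by (metis surj_pair)
    obtain c where c: "C = real c" "0 < c"
    proof -
      have "C \<in> \<int>" "1 \<le> C" using KC[of a C] K by auto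
      then obtain z where "C = of_int z" by (auto elim: Ints_cases)
      then have "C = real (nat z)" "0 < nat z" using \<open>1 \<le> C\<close> by auto
      then show ?thesis using that by blast
    qed
    \<comment> \<open>the dual basis property at the end of the coordinate edge makes \<open>a $ i\<close> a unit in the integers\<close>
    have ai: "a $ i = 1" for i
    proof -
      obtain t where t: "0 < t" "(t *\<^sub>R axis i 1) extreme_point_of Q" "0 < a $ i" "t * a $ i = C"
        using vertex[of i] K by auto
      have aK: "(a, C) \<in> K" using K by simp
      have tight: "a \<bullet> (t *\<^sub>R axis i 1) = C" using t(4) by (simp add: inner_axis)
      obtain z where z: "z \<in> lattice_points" "a \<bullet> z = 1" and z0: "\<forall>j. (t *\<^sub>R axis i (1::real)) $ j = 0 \<longrightarrow> z $ j = 0"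
        using dual[OF t(2) aK tight] by blast
      have zj: "z $ j = 0" if "j \<noteq> i" for j using z0 that by (simp add: axis_def)
      have "a \<bullet> z = (\<Sum>j\<in>{i}. a $ j * z $ j)"
        unfolding inner_vec_def using zj by (intro sum.mono_neutral_cong_right) auto
      then have az: "a $ i * z $ i = 1" using z(2) by simp
      have "a $ i \<in> \<int>" "z $ i \<in> \<int>" using aZ[OF aK] z(1) by (simp_all add: lattice_points_vec_iff)
      then obtain k l where kl: "a $ i = of_int k" "z $ i = of_int l" by (meson Ints_cases)
      then have "k * l = 1" using az by (metis of_int_eq_1_iff of_int_mult)
      then have "k = 1" using t(3) kl by (auto simp: zmult_eq_1_iff)
      then show ?thesis using kl by simp
    qed
    have "Q = simplex_model c" unfolding Q K simplex_model_def using ai c by (simp add: inner_vec_def)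
    moreover obtain \<sigma> where \<sigma>: "bij_betw \<sigma> (UNIV::'n set) {..<?d}"
      using finite_same_card_bij[of "UNIV::'n set" "{..<?d}"] by auto
    ultimately have iso': "P \<cong>\<^sub>L dilate c (unimodular_simplex ?d)"
      using lattice_isomorphic_trans[OF iso] simplex_model_iso(1)[OF \<sigma> c(2)] by metis
    have "real r * real c = 1 + real ?d" using KC[of a C] K ai c by simp
    then have rc: "r * c = ?d + 1" by (metis add.commute of_nat_1 of_nat_add of_nat_eq_iff of_nat_mult)
    have r3: "?d + 3 < 3 * r" using large unfolding large_index_nat_iff .
    have "c < 3"
    proof (rule ccontr)
      assume "\<not> c < 3"
      then have "3 * r \<le> r * c" by simp
      then show False using rc r3 by linarith
    qed
    then consider "c = 1" | "c = 2" using c(2) by linarith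
    then show ?thesis
    proof cases
      case 1
      then show ?thesis using iso' by (simp add: large_index_list_def dilate_one)
    next
      case 2
      then have "2 * r = ?d + 1" using rc by simp
      then have "odd ?d" "3 < ?d" using r3 by presburger+
      then have "odd ?d" "5 \<le> ?d" by presburger+
      then show ?thesis using iso' 2 by (simp add: large_index_list_def)
    qed
  next
    case 2
    then obtain p q where pq: "K = {p, q}" "p \<noteq> q" by (meson card_2_iff)
    obtain a C b C' where K: "K = {(a, C), (b, C')}" "(a, C) \<noteq> (b, C')" using pq by (cases p; cases q) auto
    have CC: "C + C' < 3"
    proof (rule ccontr)
      assume "\<not> C + C' < 3"
      then have "real r * 3 \<le> real r * (C + C')" by (intro mult_left_mono) auto
      moreover have "real r * (C + C') \<le> real ?d + 2" using small 2 K by simp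
      ultimately show False using large by simp
    qed
    have "1 \<le> C" "1 \<le> C'" "C \<in> \<int>" "C' \<in> \<int>" using KC K by auto
    moreover obtain z z' where "C = of_int z" "C' = of_int z'" using calculation by (auto elim!: Ints_cases)
    ultimately have C1: "C = 1" "C' = 1" using CC by auto
    have ra: "real r = 1 + (\<Sum>i\<in>UNIV. a $ i)" "real r = 1 + (\<Sum>i\<in>UNIV. b $ i)"
      using KC[of a C] KC[of b C'] K C1 by auto
    have Q2: "Q = {x. (\<forall>i. 0 \<le> x $ i) \<and> a \<bullet> x \<le> 1 \<and> b \<bullet> x \<le> 1}" unfolding Q K C1 by auto
    have abZ: "a $ i \<in> \<int>" "b $ i \<in> \<int>" for i using aZ K by auto
    \<comment> \<open>Exactly one of the two forms is tight at the end of each coordinate edge, which is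
      the unit vector.\<close>
    have coeff: "(a $ i = 1 \<and> b $ i \<le> 0) \<or> (b $ i = 1 \<and> a $ i \<le> 0)" for i
    proof -
      obtain t y D where t: "0 < t" "(t *\<^sub>R axis i 1) extreme_point_of Q" "(y, D) \<in> K" "0 < y $ i" "t * y $ i = D"
        and le: "\<And>y' D'. (y', D') \<in> K \<Longrightarrow> t * y' $ i \<le> D'" using vertex[of i] by blast
      have D: "D = 1" using t(3) K C1 by auto
      have "(t *\<^sub>R axis i (1::real)) $ i \<in> \<int>" using extL[OF t(2)] unfolding lattice_points_vec_iff by blast
      then have "t \<in> \<int>" by (simp add: axis_def)
      then obtain k l where kl: "t = of_int k" "y $ i = of_int l" using aZ[OF t(3)] by (meson Ints_cases)
      then have "k * l = 1" using t(5) D by (metis of_int_eq_1_iff of_int_mult)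
      then have t1: "t = 1" and y1: "y $ i = 1" using t(1) kl by (auto simp: zmult_eq_1_iff)
      have ab1: "a $ i \<le> 1" "b $ i \<le> 1" using le K C1 t1 by auto
      have "{j. (t *\<^sub>R axis i (1::real)) $ j = 0} = - {i}" using t1 by (auto simp: axis_def)
      moreover have "card (- {i}) = ?d - 1" by (simp add: card_Compl_finite)
      ultimately have "card {j. (t *\<^sub>R axis i (1::real)) $ j = 0} = ?d - 1" by metis
      then have "card {(a, C)\<in>K. a \<bullet> (t *\<^sub>R axis i 1) = C} = 1" using simple[OF t(2)] d0 by linarith
      moreover have "{(a, C)\<in>K. a \<bullet> (t *\<^sub>R axis i 1) = C} = K" if "a $ i = 1" "b $ i = 1"
        using that K C1 t1 by (auto simp: inner_axis)
      ultimately have notboth: "\<not> (a $ i = 1 \<and> b $ i = 1)" using 2 by auto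
      have "a $ i = 1 \<or> b $ i = 1" using t(3) y1 K by auto
      moreover have "x \<le> 0" if "x \<in> \<int>" "x \<le> 1" "x \<noteq> 1" for x :: real using that by (auto elim!: Ints_cases)
      ultimately show ?thesis using notboth ab1 abZ by metis
    qed
    define A where "A = {i. a $ i = 1}"
    have A: "i \<in> A \<Longrightarrow> a $ i = 1 \<and> b $ i \<le> 0" "i \<notin> A \<Longrightarrow> b $ i = 1 \<and> a $ i \<le> 0" for i
      using coeff[of i] by (auto simp: A_def)
    \<comment> \<open>otherwise a ray in direction \<open>e_j - a_j e_i\<close> would stay in the polytope\<close>
    have ortho: "a $ j = 0 \<or> b $ i = 0" if ij: "i \<in> A" "j \<notin> A" for i j
    proof (rule ccontr)
      assume n: "\<not> ?thesis"
      have neg: "x \<le> -1" if "x \<in> \<int>" "x \<le> 0" "x \<noteq> 0" for x :: real using that by (auto elim!: Ints_cases)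
      have "a $ j \<le> -1" "b $ i \<le> -1"
        using n A(1)[OF ij(1)] A(2)[OF ij(2)] abZ neg[of "a $ j"] neg[of "b $ i"] by auto
      then have ab: "1 \<le> a $ j * b $ i" using mult_mono[of 1 "- a $ j" 1 "- b $ i"] by simp
      define v where "v = axis j 1 - a $ j *\<^sub>R axis i (1::real)"
      have "axis i 1 + t *\<^sub>R v \<in> Q" if t: "0 \<le> t" for t
      proof -
        have ne: "i \<noteq> j" using ij by auto
        have "0 \<le> (axis i 1 + t *\<^sub>R v) $ k" for k
          using t A(2)[OF ij(2)] mult_nonneg_nonpos[of t "a $ j"] ne by (auto simp: v_def axis_def)
        moreover have "a \<bullet> (axis i 1 + t *\<^sub>R v) = 1"
          using A(1)[OF ij(1)] by (simp add: v_def inner_add_right inner_diff_right inner_axis)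
        moreover have "b \<bullet> (axis i 1 + t *\<^sub>R v) \<le> 1"
        proof -
          have "b \<bullet> (axis i 1 + t *\<^sub>R v) = b $ i + t * (1 - a $ j * b $ i)"
            using A(2)[OF ij(2)] by (simp add: v_def inner_add_right inner_diff_right inner_axis)
          also have "\<dots> \<le> 1" using A(1)[OF ij(1)] t ab mult_nonneg_nonpos[of t "1 - a $ j * b $ i"] by linarith
          finally show ?thesis .
        qed
        ultimately show ?thesis unfolding Q2 by simp
      qed
      then have "v = 0" using bounded_ray[OF bdd] by blast
      then have "v $ j = 0" by simp
      then show False using ij by (auto simp: v_def axis_def split: if_splits)
    qed
    have aL: "a \<in> lattice_points" and bL: "b \<in> lattice_points" using KL K by auto
    show ?thesis
    proof (cases "\<forall>i\<in>A. b $ i = 0")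
      case True
      show ?thesis
        by (rule two_form_polytope_in_large_index_list[of P a b A])
          (use iso Q2 A True ra large aL in auto)
    next
      case False
      then have a0: "\<forall>j. j \<notin> A \<longrightarrow> a $ j = 0" using ortho by blast
      have swap: "{x. (\<forall>i. 0 \<le> x $ i) \<and> b \<bullet> x \<le> 1 \<and> a \<bullet> x \<le> 1} = Q" unfolding Q2 by auto
      show ?thesis
        by (rule two_form_polytope_in_large_index_list[of P b a "-A"])
          (use iso swap A a0 ra large bL in auto)
    qed
  qed
qed

lemma index_simplex:
  fixes P :: "(real^'n) set"
  assumes P: "smooth_polytope P" and gor: "gorenstein r P" and c: "0 < c"
    and iso: "P \<cong>\<^sub>L dilate c (unimodular_simplex CARD('n))"
  shows "r * c = CARD('n) + 1"
proof -
  obtain \<sigma> where \<sigma>: "bij_betw \<sigma> (UNIV::'n set) {..<CARD('n)}"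
    using finite_same_card_bij[of "UNIV::'n set" "{..<CARD('n)}"] by auto
  have "P \<cong>\<^sub>L (simplex_model c :: (real^'n) set)" using lattice_isomorphic_trans[OF iso simplex_model_iso(2)[OF \<sigma> c]] .
  then have "gorenstein r (simplex_model c :: (real^'n) set)"
    using gorenstein_lattice_isomorphic[OF gor] smooth_polytopeD(3)[OF P] affine_hull_simplex_model[OF c] by blast
  then show ?thesis using gorenstein_simplex_model_index c by blast
qed

lemma index_simplex_product:
  fixes P :: "(real^'n) set"
  assumes P: "smooth_polytope P" and gor: "gorenstein r P" and even: "even CARD('n)"
    and iso: "P \<cong>\<^sub>L unimodular_simplex (CARD('n) div 2) \<times> unimodular_simplex (CARD('n) div 2)"
  shows "2 * r = CARD('n) + 2"
proof -
  let ?h = "CARD('n) div 2"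
  have h: "?h \<le> card (UNIV :: 'n set)" "0 < ?h"
  proof -
    have "0 < CARD('n)" by simp
    then show "0 < ?h" using even by presburger
  qed simp
  obtain A :: "'n set" where A: "card A = ?h" using obtain_subset_with_card_n[OF h(1)] by blast
  then have A': "card (-A) = ?h" using even by (auto simp: card_Compl_finite elim!: evenE)
  obtain \<sigma> where \<sigma>: "bij_betw \<sigma> A {..<?h}" using finite_same_card_bij[of A "{..<?h}"] A by auto
  obtain \<tau> where \<tau>: "bij_betw \<tau> (-A) {..<?h}" using finite_same_card_bij[of "-A" "{..<?h}"] A' by auto
  have "P \<cong>\<^sub>L cayley_model A (\<lambda>_. 0)" using lattice_isomorphic_trans[OF iso simplex_product_iso(2)[OF \<sigma> \<tau>]] .
  then have "gorenstein r (cayley_model A (\<lambda>_. 0))"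
    using gorenstein_lattice_isomorphic[OF gor] smooth_polytopeD(3)[OF P] affine_hull_cayley_model by blast
  moreover have "A \<noteq> UNIV" using A' h by auto
  ultimately have "r = ?h + 1" using gorenstein_cayley_model_index A' by metis
  then show ?thesis using even by auto
qed

text \<open>In the given range the parts sum up to less than the number \<open>r\<close> of factors, so that some factor
is not dilated and its coordinate can be omitted in the model.\<close>

lemma cayley_range_Gorenstein_exists:
  assumes rng: "cayley_range CARD('n) r" and len: "length as \<le> r" and part: "integer_partition as (CARD('n) + 2 - 2 * r)"
  obtains Q :: "(real^'n) set" where "gorenstein r Q" "Q \<cong>\<^sub>L cayley_simplices (CARD('n) + 1 - r) r as"
proof -
  let ?d = "CARD('n)" and ?s = "CARD('n) + 1 - r"
  have "(real ?d + 3) / 3 < real r" "real r \<le> (real ?d + 1) / 2" using rng by (simp_all add: cayley_range_def)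
  then have r: "?d + 3 < 3 * r" "2 * r \<le> ?d + 1" unfolding large_index_nat_iff half_index_nat_iff .
  have sum: "(\<Sum>j<r. padded as j) = ?d + 2 - 2 * r" using sum_padded[OF len] part by (simp add: integer_partition_def)
  have "\<exists>j0<r. padded as j0 = 0"
  proof (rule ccontr)
    assume "\<not> ?thesis"
    then have "(\<Sum>j<r. 1) \<le> (\<Sum>j<r. padded as j)" by (intro sum_mono) (auto simp: Suc_le_eq)
    then show False using sum r by simp
  qed
  then obtain j0 where j0: "j0 < r" "padded as j0 = 0" by blast
  have "?s \<le> card (UNIV :: 'n set)" using r by linarith
  then obtain A :: "'n set" where A: "card A = ?s" using obtain_subset_with_card_n by blast
  then have A': "card (-A) = r - 1" using r by (simp add: card_Compl_finite)
  obtain \<sigma> where \<sigma>: "bij_betw \<sigma> A {..<?s}" using finite_same_card_bij[of A "{..<?s}"] A by auto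
  obtain \<tau> where \<tau>: "bij_betw \<tau> (-A) ({..<r} - {j0})"
    using finite_same_card_bij[of "-A" "{..<r} - {j0}"] A' j0 by auto
  define \<alpha> where "\<alpha> j = padded as (\<tau> j)" for j
  note model = cayley_model_iso[OF \<sigma> \<tau> j0(1) len j0(2), of \<alpha>]
  have "(\<Sum>j\<in>-A. \<alpha> j) = (\<Sum>j\<in>{..<r} - {j0}. padded as j)" unfolding \<alpha>_def using sum.reindex_bij_betw[OF \<tau>] .
  also have "\<dots> = (\<Sum>j<r. padded as j)" using j0 by (intro sum.mono_neutral_left) auto
  finally have "card A + 1 = r + (\<Sum>j\<in>-A. \<alpha> j)" unfolding A sum using r by linarith
  moreover have "card (-A) + 1 = r" using A' r by linarith
  ultimately have "gorenstein r (cayley_model A \<alpha>)"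
    using gorenstein_cayley_model[of A \<alpha> r] model(3) j0(1) by (auto simp: \<alpha>_def)
  then show ?thesis using that model(1) by (auto simp: \<alpha>_def)
qed

theorem theorem3p2:
  fixes d :: nat
  assumes d: "d = CARD('n)"
  shows
    "(\<forall>(P :: (real ^ 'n) set) r. smooth_polytope P \<and> gorenstein r P \<longrightarrow>
        (real r > (real d + 3) / 3 \<longleftrightarrow>
           P \<cong>\<^sub>L unimodular_simplex d \<or>
           (d \<ge> 5 \<and> odd d \<and> P \<cong>\<^sub>L dilate 2 (unimodular_simplex d)) \<or>
           (d \<ge> 4 \<and> even d \<and> P \<cong>\<^sub>L unimodular_simplex (d div 2) \<times> unimodular_simplex (d div 2)) \<or>
           (cayley_range d r \<and>
              (\<exists>as. length as \<le> r \<and> integer_partition as (d + 2 - 2 * r) \<and>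
                    P \<cong>\<^sub>L cayley_simplices (d + 1 - r) r as)) \<or>
           (d = 2 \<and> P \<cong>\<^sub>L unimodular_simplex 1 \<times> unimodular_simplex 1))
        \<and> (P \<cong>\<^sub>L unimodular_simplex d \<longrightarrow> real r = real d + 1)
        \<and> (d \<ge> 5 \<and> odd d \<and> P \<cong>\<^sub>L dilate 2 (unimodular_simplex d) \<longrightarrow> real r = (real d + 1) / 2)
        \<and> (d \<ge> 4 \<and> even d \<and> P \<cong>\<^sub>L unimodular_simplex (d div 2) \<times> unimodular_simplex (d div 2)
             \<longrightarrow> real r = (real d + 2) / 2))
     \<and>
     (\<forall>r as bs. cayley_range d r \<and>
        length as \<le> r \<and> integer_partition as (d + 2 - 2 * r) \<and>
        length bs \<le> r \<and> integer_partition bs (d + 2 - 2 * r) \<longrightarrow>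
          (\<exists>Q :: (real ^ 'n) set. gorenstein r Q \<and> Q \<cong>\<^sub>L cayley_simplices (d + 1 - r) r as) \<and>
          (\<not> same_partition as bs \<longrightarrow>
             \<not> cayley_simplices (d + 1 - r) r as \<cong>\<^sub>L cayley_simplices (d + 1 - r) r bs))"
proof -
  have d0: "0 < d" using d by simp
  have part1: "((real d + 3) / 3 < real r \<longleftrightarrow> large_index_list d r P)
      \<and> (P \<cong>\<^sub>L unimodular_simplex d \<longrightarrow> real r = real d + 1)
      \<and> (d \<ge> 5 \<and> odd d \<and> P \<cong>\<^sub>L dilate 2 (unimodular_simplex d) \<longrightarrow> real r = (real d + 1) / 2)
      \<and> (d \<ge> 4 \<and> even d \<and> P \<cong>\<^sub>L unimodular_simplex (d div 2) \<times> unimodular_simplex (d div 2)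
             \<longrightarrow> real r = (real d + 2) / 2)"
    if P: "smooth_polytope P" "gorenstein r P" for P :: "(real^'n) set" and r
  proof -
    have i1: "real r = real d + 1" if "P \<cong>\<^sub>L unimodular_simplex d"
      using index_simplex[OF P, of 1] that d by (simp add: dilate_one)
    have i2: "real r = (real d + 1) / 2" if "P \<cong>\<^sub>L dilate 2 (unimodular_simplex d)"
    proof -
      have "r * 2 = d + 1" using index_simplex[OF P, of 2] that d by simp
      then have "real (r * 2) = real (d + 1)" by (rule arg_cong)
      then show ?thesis by simp
    qed
    have i3: "real r = (real d + 2) / 2"
      if "even d" "P \<cong>\<^sub>L unimodular_simplex (d div 2) \<times> unimodular_simplex (d div 2)"
    proof -
      have "2 * r = d + 2" using index_simplex_product[OF P] that d by simp
      then have "real (2 * r) = real (d + 2)" by (rule arg_cong)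
      then show ?thesis by simp
    qed
    have "(real d + 3) / 3 < real r" if "large_index_list d r P"
      using that[unfolded large_index_list_def]
    proof (elim disjE conjE)
      assume "P \<cong>\<^sub>L unimodular_simplex d"
      then show ?thesis using i1 d0 by simp
    next
      assume "5 \<le> d" "P \<cong>\<^sub>L dilate 2 (unimodular_simplex d)"
      then show ?thesis using i2 by simp
    next
      assume "4 \<le> d" "even d" "P \<cong>\<^sub>L unimodular_simplex (d div 2) \<times> unimodular_simplex (d div 2)"
      then show ?thesis using i3 by simp
    next
      assume "cayley_range d r"
      then show ?thesis by (simp add: cayley_range_def)
    next
      assume "d = 2" "P \<cong>\<^sub>L unimodular_simplex 1 \<times> unimodular_simplex 1"
      then show ?thesis using i3 by simp
    qed
    then show ?thesis using large_index_imp_list[OF P] i1 i2 i3 unfolding d by blast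
  qed
  have part2: "(\<exists>Q :: (real ^ 'n) set. gorenstein r Q \<and> Q \<cong>\<^sub>L cayley_simplices (d + 1 - r) r as) \<and>
      (\<not> same_partition as bs \<longrightarrow> \<not> cayley_simplices (d + 1 - r) r as \<cong>\<^sub>L cayley_simplices (d + 1 - r) r bs)"
    if rng: "cayley_range d r" and len: "length as \<le> r" "length bs \<le> r"
      and part: "integer_partition as (d + 2 - 2 * r)" for r as bs
  proof (intro conjI impI notI)
    show "\<exists>Q :: (real ^ 'n) set. gorenstein r Q \<and> Q \<cong>\<^sub>L cayley_simplices (d + 1 - r) r as"
      using cayley_range_Gorenstein_exists rng len part unfolding d by blast
    assume "\<not> same_partition as bs" "cayley_simplices (d + 1 - r) r as \<cong>\<^sub>L cayley_simplices (d + 1 - r) r bs"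
    moreover have "0 < d + 1 - r"
    proof -
      have "2 * r \<le> d + 1" using rng unfolding cayley_range_def half_index_nat_iff by simp
      then show ?thesis using d0 by linarith
    qed
    ultimately show False using cayley_simplices_isomorphic_imp_same_partition len by blast
  qed
  show ?thesis
  proof (rule conjI, goal_cases)
    case 1
    show ?case by (intro allI impI, elim conjE, rule part1[unfolded large_index_list_def])
  next
    case 2
    show ?case using part2 by blast
  qed
qed

end
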